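(* Let $V$ satisfy (P) and the growth condition (G), let $\Xi_0$ satisfy (C), $\Xi_0\in\mathcal H^\beta([0,U],H)$ with $\beta>1$, and $\kappa+\eta_0\le\Xi_0(r)\le K-\eta_0$ for $0\le r\le U$, for some $\eta_0>0$ (all notation as in the context). Consider the graded mesh with exponent $\vartheta>(2\beta+2)/(2\beta+1)$. Then there exist fixed architecture constants $L_{\rm net},C_p,C_s,C_B$ and constants $m_0,H_1<\infty$ such that for every $m\ge m_0$ there exists $\xi_m\in\mathfrak X_m$ satisfying on every cell $J_{j,m}$, $1\le j\le m$, the moment cancellation $$\int_{J_{j,m}}\bigl(\xi_m(u)-\Xi_0(u)\bigr)\frac{\mathrm du}{u\,\Xi_0(u)^2}=0,$$ and $$\|\xi_m-\Xi_0\|_{\infty,[0,U]}\le C_{\rm app}\,m^{-\beta},\qquad \|\mathcal A(\xi_m-\Xi_0)\|_{L^2(\nu_0)}\le C_{\rm fwd}\,m^{-(\beta+1)},$$ where $C_{\rm app}$ depends only on $(\beta,H,U,\kappa,K,\vartheta)$ and $C_{\rm fwd}$ only on $(\beta,H,U,\kappa,K,\vartheta,r_0,\alpha,C_\nu)$. Moreover, for every $\varepsilon\in(0,1]$, the covering numbers of the sieve satisfy $$\log N(\varepsilon,\mathfrak X_m,\|\cdot\|_\infty)\le C_{\rm ent}\,m\log\left(C_{\rm ent}\,m/\varepsilon\right),$$ where $C_{\rm ent}$ depends only on the fixed sieve-architecture constants, $U$, $\kappa$, $K$ and $L_\tau$.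
   Context: (P): $d\ge1$; $V:\mathbb R^d\to[v_\star,\infty)$ is $C^2$, coercive, $v_\star=\min V$, $e^{-aV}$ integrable for every $a>0$; $m_V(s)=\int_{\{V=s\}}\|\nabla V\|_2^{-1}\mathrm d\mathcal H^{d-1}$ ($s>v_\star$) is locally finite and bounded above and below by positive constants on compact intervals away from critical values; $\int\varphi(V(x))\mathrm dx=\int_{v_\star}^\infty\varphi(s)m_V(s)\mathrm ds$ for measurable $\varphi\ge0$. (G): there are $C_V<\infty$, $\alpha\ge0$, $v_V>v_\star$ with $m_V(s)\le C_V(1+s-v_\star)^\alpha$ for $s\ge v_V$. (C): with constants $0<\kappa<K<\infty$, $L<\infty$, a coefficient $\xi:[0,\infty)\to\mathbb R$ satisfies $\kappa\le\xi\le K$ and $|\xi(r)-\xi(u)|\le L|r-u|$. Stationary model: $g_\xi(r)=\int_1^r(u\xi(u))^{-1}\mathrm du$; $\mu_\xi$ is the unique constant with $\int_{v_\star}^\infty g_\xi^{-1}(\mu_\xi-s)m_V(s)\mathrm ds=1$; $q_\xi(s)=g_\xi^{-1}(\mu_\xi-s)$; $\pi_\xi(x)=q_\xi(V(x))$; $a_\xi=q_\xi(v_\star)$. Subscript $0$ means $\xi=\Xi_0$. $Z_c=\int_{\mathbb R^d}e^{-c(V(x)-v_\star)}\mathrm dx$, $a_+=Z_K^{-1}$ (so $a_\xi\le a_+$), and $U\ge\max\{1,a_+\}$ is fixed. Hölder balls: for $\beta>0$, $k=\lceil\beta\rceil-1$, $\mathcal H^\beta([0,U],H)$ is the set of $f$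 with $k$ continuous derivatives and Hölder norm $\|f\|_{\mathcal H^\beta}$ (sup norms of derivatives up to order $k$ plus the $(\beta-k)$-Hölder seminorm of $f^{(k)}$) at most $H$. Operators: $w_0(u)=(u\Xi_0(u)^2)^{-1}$, $(\mathcal Kh)(r)=\int_1^rh(u)w_0(u)\mathrm du$, $(\mathcal Ah)(r)=\Xi_0(r)\bigl(c_0(h)+(\mathcal Kh)(r)\bigr)$, where $$c_0(h)=-\frac{\int_{v_\star}^\infty q_0(s)\Xi_0(q_0(s))(\mathcal Kh)(q_0(s))m_V(s)\mathrm ds}{\int_{v_\star}^\infty q_0(s)\Xi_0(q_0(s))m_V(s)\mathrm ds}.$$ $\nu_0$ is the law of $\pi_0(X)$ for $X\sim\pi_0$; with $s_0(r)=q_0^{-1}(r)$ it has density $v_0(r)=m_V(s_0(r))/\Xi_0(r)$ on $(0,a_0)$. Under (G) there are $r_0>0$ and $C_\nu<\infty$ with $v_0(r)\le C_\nu(1+\log(r_0/r))^\alpha$ for $0<r\le r_0$; these are the $r_0,C_\nu$ in the claim. Graded mesh: start with $\widetilde r_{j,m}=U(j/m)^\vartheta$, $0\le j\le m$, and replace the knot nearest to $1$ by $1$, giving $0=r_{0,m}<r_{1,m}<\dots<r_{m,m}=U$ with $1\in\{r_{j,m}\}$; $J_{j,m}=[r_{j-1,m},r_{j,m}]$. Sieve: $\sigma_{\rm ReQU}(z)=(z_+)^2$; $\mathrm{NN}(L_{\rm net},\mathbf p,s,B)$ is the class of real-valued feedforward networks of one real variable (alternating affine maps and componentwise $\sigma_{\rm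 ReQU}$) with depth $L_{\rm net}$, width vector $\mathbf p$, at most $s$ nonzero parameters, all parameters bounded by $B$ in absolute value. For the $m$-th sieve the depth $L_{\rm net}$ is fixed and the architecture satisfies $\max_jp_{m,j}\le C_pm$, $s_m=\lceil C_sm\rceil$, $B_m\le m^{C_B}$, with constants independent of $m$ ($\mathbf p_m$, $B_m$ are chosen subject to these constraints). Fix $0<\tau<\eta_0/(4(K-\kappa))$ and a globally Lipschitz $S_\tau:\mathbb R\to[0,1]$ with Lipschitz constant $L_\tau$ and $S_\tau(z)=z$ on $[\tau,1-\tau]$. Then $$\mathfrak X_m=\bigl\{\xi_\theta=\kappa+(K-\kappa)S_\tau(N_\theta)\text{ on }[0,U]:\ N_\theta\in\mathrm{NN}(L_{\rm net},\mathbf p_m,s_m,B_m)\bigr\}\cap\mathcal H^\beta([0,U],H_1),$$ and elements are extended by the constant $\xi_\theta(U)$ for $r>U$. $N(\varepsilon,\cdot,\|\cdot\|_\infty)$ is the $\varepsilon$-covering number in the sup norm on $[0,U]$. *)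

theory Defs
  imports "HOL-Analysis.Analysis"
begin

section \<open>Euclidean space with the dimension as a term\<close>

text \<open>
  The constants of the theorem must not depend on the dimension \<open>d\<close>, so \<open>d\<close> has to be
  quantified inside the formula and cannot be a type. Points of \<open>R^d\<close> are the extensional
  functions on \<open>{..<d}\<close>; this is the space of the product measure \<open>PiM {..<d}\<close>, and its
  topology, as a subspace of the function space, is the Euclidean one.
\<close>

definition euc :: "nat \<Rightarrow> (nat \<Rightarrow> real) set" where
  "euc d = ({..<d} \<rightarrow>\<^sub>E UNIV)"

definition leb :: "nat \<Rightarrow> (nat \<Rightarrow> real) measure" where
  "leb d = PiM {..<d} (\<lambda>_. lborel)"

definition euc_norm :: "nat \<Rightarrow> (nat \<Rightarrow> real) \<Rightarrow> real" where
  "euc_norm d x = L2_set x {..<d}"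

definition euc_dist :: "nat \<Rightarrow> (nat \<Rightarrow> real) \<Rightarrow> (nat \<Rightarrow> real) \<Rightarrow> real" where
  "euc_dist d x y = L2_set (\<lambda>i. x i - y i) {..<d}"

definition pderiv_at :: "nat \<Rightarrow> ((nat \<Rightarrow> real) \<Rightarrow> real) \<Rightarrow> (nat \<Rightarrow> real) \<Rightarrow> real" where
  "pderiv_at i f x = deriv (\<lambda>t. f (x(i := t))) (x i)"

fun C_k :: "nat \<Rightarrow> nat \<Rightarrow> ((nat \<Rightarrow> real) \<Rightarrow> real) \<Rightarrow> bool" where
  "C_k d 0 f \<longleftrightarrow> continuous_on (euc d) f"
| "C_k d (Suc k) f \<longleftrightarrow> continuous_on (euc d) f \<and>
     (\<forall>i<d. (\<forall>x\<in>euc d. (\<lambda>t. f (x(i := t))) differentiable (at (x i))) \<and> C_k d k (pderiv_at i f))"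

definition grad_norm :: "nat \<Rightarrow> ((nat \<Rightarrow> real) \<Rightarrow> real) \<Rightarrow> (nat \<Rightarrow> real) \<Rightarrow> real" where
  "grad_norm d f x = L2_set (\<lambda>i. pderiv_at i f x) {..<d}"


section \<open>Hausdorff measure\<close>

definition euc_diam :: "nat \<Rightarrow> (nat \<Rightarrow> real) set \<Rightarrow> real" where
  "euc_diam d S = (SUP (x, y) \<in> S \<times> S. euc_dist d x y)"

text \<open>
  The normalisation \<open>unit_ball_vol k * (diam / 2) ^ k\<close> is the one for which the coarea formula
  holds. The empty set is treated separately so that for \<open>k = 0\<close>, where \<open>0 ^ 0 = 1\<close>, one gets
  counting measure.
\<close>

definition hausdorff_size :: "nat \<Rightarrow> nat \<Rightarrow> (nat \<Rightarrow> real) set \<Rightarrow> ennreal" where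
  "hausdorff_size d k S =
     (if S = {} then 0 else ennreal (unit_ball_vol (real k) * (euc_diam d S / 2) ^ k))"

definition hausdorff_pre :: "nat \<Rightarrow> nat \<Rightarrow> real \<Rightarrow> (nat \<Rightarrow> real) set \<Rightarrow> ennreal" where
  "hausdorff_pre d k \<delta> A =
     (INF S \<in> {S :: nat \<Rightarrow> (nat \<Rightarrow> real) set. A \<subseteq> (\<Union>i. S i) \<and>
                (\<forall>i. S i \<subseteq> euc d \<and> (\<forall>x\<in>S i. \<forall>y\<in>S i. euc_dist d x y \<le> \<delta>))}.
        (\<Sum>i. hausdorff_size d k (S i)))"

definition hausdorff_outer :: "nat \<Rightarrow> nat \<Rightarrow> (nat \<Rightarrow> real) set \<Rightarrow> ennreal" where
  "hausdorff_outer d k A = (SUP \<delta> \<in> {0<..}. hausdorff_pre d k \<delta> A)"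

text \<open>A metric outer measure is countably additive on the Borel sets, here \<open>sets (leb d)\<close>.\<close>

definition hausdorff :: "nat \<Rightarrow> nat \<Rightarrow> (nat \<Rightarrow> real) measure" where
  "hausdorff d k = measure_of (euc d) (sets (leb d)) (hausdorff_outer d k)"


section \<open>Potential and level-set density\<close>

text \<open>The integrand is \<open>\<infinity>\<close> at critical points of \<open>V\<close>.\<close>

definition m_V :: "nat \<Rightarrow> ((nat \<Rightarrow> real) \<Rightarrow> real) \<Rightarrow> real \<Rightarrow> ennreal" where
  "m_V d V s = (\<integral>\<^sup>+ x. inverse (ennreal (grad_norm d V x)) * indicator {x \<in> euc d. V x = s} x
                  \<partial>hausdorff d (d - 1))"

text \<open>
  Local finiteness is that of the measure \<open>m_V(s) ds\<close> on \<open>(vs, \<infinity>)\<close>; the value \<open>m_V(s) = \<infinity>\<close>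
  is allowed at critical values \<open>s\<close>. Measurability of \<open>m_V\<close> is implicit in the level-set
  integration formula and is spelled out.
\<close>

definition cond_P :: "nat \<Rightarrow> ((nat \<Rightarrow> real) \<Rightarrow> real) \<Rightarrow> real \<Rightarrow> bool" where
  "cond_P d V vs \<longleftrightarrow>
     1 \<le> d \<and>
     C_k d 2 V \<and>
     (\<forall>M. \<exists>R. \<forall>x\<in>euc d. R < euc_norm d x \<longrightarrow> M < V x) \<and>
     (\<exists>x\<in>euc d. V x = vs) \<and> (\<forall>x\<in>euc d. vs \<le> V x) \<and>
     (\<forall>a>0. integrable (leb d) (\<lambda>x. exp (- a * V x))) \<and>
     m_V d V \<in> borel_measurable lebesgue \<and>
     (\<forall>a b. vs < a \<and> a \<le> b \<longrightarrow> (\<integral>\<^sup>+ s\<in>{a..b}. m_V d V s \<partial>lebesgue) < \<infinity>) \<and>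
     (\<forall>a b. vs < a \<and> a \<le> b \<and> (\<forall>x\<in>euc d. V x \<in> {a..b} \<longrightarrow> grad_norm d V x \<noteq> 0) \<longrightarrow>
        (\<exists>c C. 0 < c \<and> (\<forall>s\<in>{a..b}. ennreal c \<le> m_V d V s \<and> m_V d V s \<le> ennreal C))) \<and>
     (\<forall>\<phi> :: real \<Rightarrow> ennreal. \<phi> \<in> borel_measurable borel \<longrightarrow>
        (\<integral>\<^sup>+ x. \<phi> (V x) \<partial>leb d) = (\<integral>\<^sup>+ s\<in>{vs<..}. \<phi> s * m_V d V s \<partial>lebesgue))"

definition cond_G :: "nat \<Rightarrow> ((nat \<Rightarrow> real) \<Rightarrow> real) \<Rightarrow> real \<Rightarrow> real \<Rightarrow> bool" where
  "cond_G d V vs \<alpha> \<longleftrightarrow> 0 \<le> \<alpha> \<and>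
     (\<exists>C\<^sub>V v\<^sub>V. vs < v\<^sub>V \<and> (\<forall>s\<ge>v\<^sub>V. m_V d V s \<le> ennreal (C\<^sub>V * (1 + s - vs) powr \<alpha>)))"

definition cond_C :: "real \<Rightarrow> real \<Rightarrow> real \<Rightarrow> (real \<Rightarrow> real) \<Rightarrow> bool" where
  "cond_C \<kappa> K L \<xi> \<longleftrightarrow> 0 < \<kappa> \<and> \<kappa> < K \<and> (\<forall>r\<ge>0. \<kappa> \<le> \<xi> r \<and> \<xi> r \<le> K) \<and>
     (\<forall>r\<ge>0. \<forall>u\<ge>0. \<bar>\<xi> r - \<xi> u\<bar> \<le> L * \<bar>r - u\<bar>)"


section \<open>Stationary model\<close>

definition g_fun :: "(real \<Rightarrow> real) \<Rightarrow> real \<Rightarrow> real" where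
  "g_fun \<xi> r = (LBINT u=1..r. 1 / (u * \<xi> u))"

definition g_inv :: "(real \<Rightarrow> real) \<Rightarrow> real \<Rightarrow> real" where
  "g_inv \<xi> = the_inv_into {0<..} (g_fun \<xi>)"

definition mu_const :: "nat \<Rightarrow> ((nat \<Rightarrow> real) \<Rightarrow> real) \<Rightarrow> real \<Rightarrow> (real \<Rightarrow> real) \<Rightarrow> real" where
  "mu_const d V vs \<xi> =
     (THE \<mu>. (\<integral>\<^sup>+ s\<in>{vs<..}. ennreal (g_inv \<xi> (\<mu> - s)) * m_V d V s \<partial>lebesgue) = 1)"

definition q_fun :: "nat \<Rightarrow> ((nat \<Rightarrow> real) \<Rightarrow> real) \<Rightarrow> real \<Rightarrow> (real \<Rightarrow> real) \<Rightarrow> real \<Rightarrow> real" where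
  "q_fun d V vs \<xi> s = g_inv \<xi> (mu_const d V vs \<xi> - s)"

definition pi_fun :: "nat \<Rightarrow> ((nat \<Rightarrow> real) \<Rightarrow> real) \<Rightarrow> real \<Rightarrow> (real \<Rightarrow> real) \<Rightarrow> (nat \<Rightarrow> real) \<Rightarrow> real" where
  "pi_fun d V vs \<xi> x = q_fun d V vs \<xi> (V x)"

definition a_max :: "nat \<Rightarrow> ((nat \<Rightarrow> real) \<Rightarrow> real) \<Rightarrow> real \<Rightarrow> (real \<Rightarrow> real) \<Rightarrow> real" where
  "a_max d V vs \<xi> = q_fun d V vs \<xi> vs"

definition Z_const :: "nat \<Rightarrow> ((nat \<Rightarrow> real) \<Rightarrow> real) \<Rightarrow> real \<Rightarrow> real \<Rightarrow> real" where
  "Z_const d V vs c = (LINT x|leb d. exp (- c * (V x - vs)))"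

definition a_plus :: "nat \<Rightarrow> ((nat \<Rightarrow> real) \<Rightarrow> real) \<Rightarrow> real \<Rightarrow> real \<Rightarrow> real" where
  "a_plus d V vs K = inverse (Z_const d V vs K)"

definition nu_law :: "nat \<Rightarrow> ((nat \<Rightarrow> real) \<Rightarrow> real) \<Rightarrow> real \<Rightarrow> (real \<Rightarrow> real) \<Rightarrow> real measure" where
  "nu_law d V vs \<xi> =
     distr (density (leb d) (\<lambda>x. ennreal (pi_fun d V vs \<xi> x))) borel (pi_fun d V vs \<xi>)"

text \<open>Meaningful for \<open>r\<close> in \<open>(0, a_max)\<close> only.\<close>

definition nu_density :: "nat \<Rightarrow> ((nat \<Rightarrow> real) \<Rightarrow> real) \<Rightarrow> real \<Rightarrow> (real \<Rightarrow> real) \<Rightarrow> real \<Rightarrow> ennreal" where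
  "nu_density d V vs \<xi> r =
     m_V d V (the_inv_into {vs..} (q_fun d V vs \<xi>) r) / ennreal (\<xi> r)"

definition nu_log_bound ::
  "nat \<Rightarrow> ((nat \<Rightarrow> real) \<Rightarrow> real) \<Rightarrow> real \<Rightarrow> (real \<Rightarrow> real) \<Rightarrow> real \<Rightarrow> real \<Rightarrow> real \<Rightarrow> bool" where
  "nu_log_bound d V vs \<xi> r0 \<alpha> C\<^sub>\<nu> \<longleftrightarrow> 0 < r0 \<and>
     (\<forall>r. 0 < r \<and> r \<le> r0 \<and> r < a_max d V vs \<xi> \<longrightarrow>
        nu_density d V vs \<xi> r \<le> ennreal (C\<^sub>\<nu> * (1 + ln (r0 / r)) powr \<alpha>))"


section \<open>Linearised forward operator\<close>

definition w_fun :: "(real \<Rightarrow> real) \<Rightarrow> real \<Rightarrow> real" where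
  "w_fun \<Xi> u = 1 / (u * (\<Xi> u)\<^sup>2)"

definition K_op :: "(real \<Rightarrow> real) \<Rightarrow> (real \<Rightarrow> real) \<Rightarrow> real \<Rightarrow> real" where
  "K_op \<Xi> h r = (LBINT u=1..r. h u * w_fun \<Xi> u)"

definition c_const ::
  "nat \<Rightarrow> ((nat \<Rightarrow> real) \<Rightarrow> real) \<Rightarrow> real \<Rightarrow> (real \<Rightarrow> real) \<Rightarrow> (real \<Rightarrow> real) \<Rightarrow> real" where
  "c_const d V vs \<Xi> h =
     - (LINT s:{vs<..}|lebesgue. q_fun d V vs \<Xi> s * \<Xi> (q_fun d V vs \<Xi> s)
            * K_op \<Xi> h (q_fun d V vs \<Xi> s) * enn2real (m_V d V s))
     / (LINT s:{vs<..}|lebesgue. q_fun d V vs \<Xi> s * \<Xi> (q_fun d V vs \<Xi> s) * enn2real (m_V d V s))"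

definition A_op ::
  "nat \<Rightarrow> ((nat \<Rightarrow> real) \<Rightarrow> real) \<Rightarrow> real \<Rightarrow> (real \<Rightarrow> real) \<Rightarrow> (real \<Rightarrow> real) \<Rightarrow> real \<Rightarrow> real" where
  "A_op d V vs \<Xi> h r = \<Xi> r * (c_const d V vs \<Xi> h + K_op \<Xi> h r)"


section \<open>Hoelder balls and covering numbers\<close>

definition sup_norm :: "real \<Rightarrow> (real \<Rightarrow> real) \<Rightarrow> ennreal" where
  "sup_norm U f = (SUP r\<in>{0..U}. ennreal \<bar>f r\<bar>)"

text \<open>Derivatives on \<open>[0, U]\<close> are one-sided at the end points.\<close>

definition deriv_on :: "real \<Rightarrow> nat \<Rightarrow> (real \<Rightarrow> real) \<Rightarrow> real \<Rightarrow> real" where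
  "deriv_on U j f = ((\<lambda>g x. vector_derivative g (at x within {0..U})) ^^ j) f"

definition holder_order :: "real \<Rightarrow> nat" where
  "holder_order \<beta> = nat (\<lceil>\<beta>\<rceil> - 1)"

definition holder_norm :: "real \<Rightarrow> real \<Rightarrow> (real \<Rightarrow> real) \<Rightarrow> ennreal" where
  "holder_norm \<beta> U f =
     (\<Sum>j\<le>holder_order \<beta>. sup_norm U (deriv_on U j f)) +
     (SUP (x, y) \<in> {(x, y). x \<in> {0..U} \<and> y \<in> {0..U} \<and> x \<noteq> y}.
        ennreal (\<bar>deriv_on U (holder_order \<beta>) f x - deriv_on U (holder_order \<beta>) f y\<bar>
                 / \<bar>x - y\<bar> powr (\<beta> - real (holder_order \<beta>))))"

definition holder_ball :: "real \<Rightarrow> real \<Rightarrow> real \<Rightarrow> (real \<Rightarrow> real) set" where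
  "holder_ball \<beta> U H =
     {f. (\<forall>j<holder_order \<beta>. \<forall>x\<in>{0..U}. deriv_on U j f differentiable (at x within {0..U})) \<and>
         continuous_on {0..U} (deriv_on U (holder_order \<beta>) f) \<and>
         holder_norm \<beta> U f \<le> ennreal H}"

text \<open>
  Covers have their centres in the covered set; this is at least the covering number
  with arbitrary centres. It is \<open>\<infinity>\<close> if there is no finite cover.
\<close>

definition covering_number :: "real \<Rightarrow> real \<Rightarrow> (real \<Rightarrow> real) set \<Rightarrow> enat" where
  "covering_number U \<epsilon> F =
     (INF C \<in> {C. finite C \<and> C \<subseteq> F \<and> (\<forall>f\<in>F. \<exists>c\<in>C. sup_norm U (\<lambda>r. f r - c r) \<le> ennreal \<epsilon>)}.
        enat (card C))"


section \<open>Graded mesh and network sieve\<close>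

text \<open>A relation, since two knots may be equally near to \<open>1\<close>.\<close>

definition graded_mesh :: "real \<Rightarrow> real \<Rightarrow> nat \<Rightarrow> (nat \<Rightarrow> real) \<Rightarrow> bool" where
  "graded_mesh U \<theta> m r \<longleftrightarrow>
     (let t = (\<lambda>j. U * (real j / real m) powr \<theta>)
      in \<exists>i\<le>m. (\<forall>j\<le>m. \<bar>t i - 1\<bar> \<le> \<bar>t j - 1\<bar>) \<and> r = t(i := 1))"

definition requ :: "real \<Rightarrow> real" where
  "requ z = (max z 0)\<^sup>2"

text \<open>
  \<open>W l i j\<close> and \<open>b l i\<close> are weights and biases of the \<open>l\<close>-th affine map, \<open>0 \<le> l \<le> L\<close>, which
  maps layer \<open>l\<close> of width \<open>p l\<close> to layer \<open>l + 1\<close>. The depth \<open>L\<close> is the number of hidden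
  layers; the activation is not applied to the output.
\<close>

fun hidden ::
  "(nat \<Rightarrow> nat) \<Rightarrow> (nat \<Rightarrow> nat \<Rightarrow> nat \<Rightarrow> real) \<Rightarrow> (nat \<Rightarrow> nat \<Rightarrow> real) \<Rightarrow> real \<Rightarrow> nat \<Rightarrow> nat \<Rightarrow> real" where
  "hidden p W b x 0 i = x"
| "hidden p W b x (Suc l) i = requ ((\<Sum>j<p l. W l i j * hidden p W b x l j) + b l i)"

definition network ::
  "nat \<Rightarrow> (nat \<Rightarrow> nat) \<Rightarrow> (nat \<Rightarrow> nat \<Rightarrow> nat \<Rightarrow> real) \<Rightarrow> (nat \<Rightarrow> nat \<Rightarrow> real) \<Rightarrow> real \<Rightarrow> real" where
  "network L p W b x = (\<Sum>j<p L. W L 0 j * hidden p W b x L j) + b L 0"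

definition NN :: "nat \<Rightarrow> (nat \<Rightarrow> nat) \<Rightarrow> nat \<Rightarrow> real \<Rightarrow> (real \<Rightarrow> real) set" where
  "NN L p s B = {network L p W b | W b.
     p 0 = 1 \<and> p (L + 1) = 1 \<and>
     card {(l, i, j). l \<le> L \<and> i < p (l + 1) \<and> j < p l \<and> W l i j \<noteq> 0} +
       card {(l, i). l \<le> L \<and> i < p (l + 1) \<and> b l i \<noteq> 0} \<le> s \<and>
     (\<forall>l\<le>L. \<forall>i<p (l + 1). \<bar>b l i\<bar> \<le> B \<and> (\<forall>j<p l. \<bar>W l i j\<bar> \<le> B))}"

definition sieve ::
  "real \<Rightarrow> real \<Rightarrow> real \<Rightarrow> real \<Rightarrow> (real \<Rightarrow> real) \<Rightarrow> real \<Rightarrow> nat \<Rightarrow> (nat \<Rightarrow> nat) \<Rightarrow> nat \<Rightarrow> real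
     \<Rightarrow> (real \<Rightarrow> real) set" where
  "sieve \<beta> U \<kappa> K S H1 L p s B =
     {(\<lambda>r. \<kappa> + (K - \<kappa>) * S (N (min r U))) | N. N \<in> NN L p s B} \<inter> holder_ball \<beta> U H1"

end

theory Submission
  imports Defs
begin

text \<open>
  The sieve element is a spline. On the cell \<open>[a, b]\<close> it equals the Taylor polynomial of \<open>\<Xi>0\<close>
  at \<open>a\<close> plus a combination of the truncated powers \<open>(y - i)\<^sub>+\<^sup>n\<close>, \<open>i \<le> n + 1\<close>, in the rescaled
  variable \<open>y = (n + 1) (x - a) / (b - a)\<close>. Since the full powers \<open>(y - i)\<^sup>n\<close> span the polynomials
  of degree at most \<open>n\<close>, this combination can be made to agree, right of \<open>b\<close>, with the difference
  of the Taylor polynomials at \<open>b\<close> and at \<open>a\<close>; the one linear relation among the powers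
  is the B-spline, a nonnegative bump supported in the cell, whose multiple is fixed by the moment
  condition. All terms on a cell of length \<open>h\<close> are of order \<open>h\<^sup>\<beta>\<close>, so that the Hoelder
  norms are bounded uniformly in the mesh. For \<open>n\<close> a power of two \<open>(x - t)\<^sub>+\<^sup>n\<close> is an iterated ReQU,
  and the whole spline is a network with \<open>O(m)\<close> parameters.

  By the moment conditions \<open>K_op\<close> at \<open>r\<close> is an integral over a part of the cell of \<open>r\<close> only. On
  the graded mesh it is at most \<open>m\<close> to the power \<open>- (\<beta> + 1)\<close> times a power of \<open>r\<close> that is
  square integrable with respect to \<open>nu_law\<close>. Integrals with respect to \<open>nu_law\<close> are integrals over
  levels \<open>s\<close>, where \<open>q_fun\<close> decays at least like \<open>exp (- \<kappa> s)\<close>; this dominates the logarithmic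
  growth of the density.
\<close>

section \<open>Truncated powers and B-splines\<close>

text \<open>Constants may depend on the listed parameters only, so each quantitative lemma asserts
  its constant before the dimension, the potential, the coefficient and the mesh are introduced;
  Hilbert choice later turns such constants into functions of the parameters. Matching the Taylor
  polynomials exactly, rather than approximately, right of each cell gives the spline the full jet
  of \<open>\<Xi>0\<close> of order \<open>holder_order \<beta>\<close> at every knot. A Hoelder
  difference between points in distant cells is then compared through two knots with that of
  \<open>\<Xi>0\<close> itself, so no error accumulates over the cells in between. Writing the bumps
  as truncated powers in the original variable costs coefficients of order h to the power -n on a
  cell of length h. Hence the smallest cell needs a polynomial lower bound in m, also after the knot
  nearest to 1 has been moved; this is the source of the weight bound m to the power
  \<open>C_B\<close>. The outer function \<open>S\<close> is the identity on the values that occur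
  once the error is at most \<open>\<eta>0 / 2\<close>, so on [0, U] the sieve element is the spline
  itself and the moment cancellation stays exact.\<close>

definition tp :: "nat \<Rightarrow> real \<Rightarrow> real" where
  "tp n z = (max z 0) ^ n"

lemma tp_nonneg: "0 \<le> tp n z" by (simp add: tp_def)
lemma tp_pos: "0 \<le> z \<Longrightarrow> tp n z = z ^ n" by (simp add: tp_def)
lemma tp_neg: "z \<le> 0 \<Longrightarrow> 0 < n \<Longrightarrow> tp n z = 0" by (simp add: tp_def)

lemma tp_Suc: "0 < n \<Longrightarrow> tp (Suc n) z = z * tp n z"
  by (auto simp: tp_def max_def)

lemma continuous_tp [continuous_intros]:
  "continuous_on A f \<Longrightarrow> continuous_on A (\<lambda>x. tp n (f x))"
  unfolding tp_def by (intro continuous_intros)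

lemma DERIV_tp:
  assumes "0 < n"
  shows "(tp (Suc n) has_real_derivative (of_nat (Suc n) * tp n z)) (at z)"
proof -
  consider "z < 0" | "0 < z" | "z = 0" by linarith
  then show ?thesis
  proof cases
    case 1
    have "((\<lambda>_. 0) has_real_derivative 0) (at z)" by simp
    then have "(tp (Suc n) has_real_derivative 0) (at z)"
      by (rule has_field_derivative_transform_within_open[where S = "{..<0}"])
         (use 1 in \<open>auto simp: tp_neg\<close>)
    then show ?thesis using 1 assms by (simp add: tp_neg)
  next
    case 2
    have "((\<lambda>x. x ^ Suc n) has_real_derivative of_nat (Suc n) * z ^ n) (at z)"
      by (rule derivative_eq_intros refl | simp)+
    then have "(tp (Suc n) has_real_derivative of_nat (Suc n) * z ^ n) (at z)"
      by (rule has_field_derivative_transform_within_open[where S = "{0<..}"])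
         (use 2 in \<open>auto simp: tp_pos\<close>)
    then show ?thesis using 2 by (simp add: tp_pos)
  next
    case 3
    have "isCont (tp n) 0"
      using continuous_tp[OF continuous_on_id, of UNIV n] by (simp add: continuous_on_eq_continuous_at)
    \<comment> \<open>Where the two branches meet, \<open>tp (Suc n) z = z * tp n z\<close> is a
      Caratheodory factorisation with the continuous factor \<open>tp n\<close>.\<close>
    then have "(tp (Suc n) has_real_derivative tp n 0) (at 0)"
      unfolding CARAT_DERIV by (intro exI[of _ "tp n"]) (use assms in \<open>auto simp: tp_Suc\<close>)
    then show ?thesis using 3 assms by (simp add: tp_neg)
  qed
qed

section \<open>Finite differences and the span of shifted powers\<close>

lemma sum_alternating_binomial_Suc:
  fixes f :: "nat \<Rightarrow> real"
  shows "(\<Sum>i\<le>Suc n. (-1) ^ i * real (Suc n choose i) * f i) =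
         (\<Sum>i\<le>n. (-1) ^ i * real (n choose i) * f i) - (\<Sum>i\<le>n. (-1) ^ i * real (n choose i) * f (Suc i))"
proof -
  have "(\<Sum>i\<le>Suc n. (-1) ^ i * real (Suc n choose i) * f i) =
        f 0 + (\<Sum>i\<le>n. (-1) ^ Suc i * real (Suc n choose Suc i) * f (Suc i))"
    by (subst sum.atMost_Suc_shift) simp
  also have "\<dots> = f 0 + (\<Sum>i\<le>n. (-1) ^ Suc i * real (n choose Suc i) * f (Suc i))
                  - (\<Sum>i\<le>n. (-1) ^ i * real (n choose i) * f (Suc i))"
    by (simp add: sum_subtractf[symmetric] sum.distrib[symmetric] sum_negf[symmetric] algebra_simps)
  also have "f 0 + (\<Sum>i\<le>n. (-1) ^ Suc i * real (n choose Suc i) * f (Suc i)) =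
             (\<Sum>i\<le>Suc n. (-1) ^ i * real (n choose i) * f i)"
    by (subst sum.atMost_Suc_shift) simp
  also have "\<dots> = (\<Sum>i\<le>n. (-1) ^ i * real (n choose i) * f i)"
    by simp
  finally show ?thesis .
qed

lemma DERIV_shifted_power:
  "((\<lambda>x. (x - c) ^ Suc n) has_real_derivative real (Suc n) * (x - c) ^ n) (at (x :: real))"
  by (rule derivative_eq_intros refl | simp)+

text \<open>Induction on the degree. By hypothesis the n-fold difference \<open>G\<close> of the
  power n + 1 has the constant derivative (n + 1)!, so its increment over a unit step is (n + 1)!;
  by Pascal's rule this increment is the next difference.\<close>

lemma finite_difference_power:
  fixes y :: real
  shows "(\<Sum>i\<le>n. (-1) ^ i * real (n choose i) * (y - real i) ^ n) = fact n"
proof (induction n arbitrary: y)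
  case (Suc n)
  define G where "G y = (\<Sum>i\<le>n. (-1) ^ i * real (n choose i) * (y - real i) ^ Suc n)" for y :: real
  have G: "(G has_real_derivative fact (Suc n)) (at x)" for x
  proof -
    have "(G has_real_derivative
        (\<Sum>i\<le>n. (-1) ^ i * real (n choose i) * (real (Suc n) * (x - real i) ^ n))) (at x)"
      unfolding G_def by (intro DERIV_sum DERIV_cmult DERIV_shifted_power)
    also have "(\<Sum>i\<le>n. (-1) ^ i * real (n choose i) * (real (Suc n) * (x - real i) ^ n)) =
        real (Suc n) * (\<Sum>i\<le>n. (-1) ^ i * real (n choose i) * (x - real i) ^ n)"
      by (simp add: sum_distrib_left mult_ac)
    finally show ?thesis by (simp add: Suc)
  qed
  have "\<exists>z. y - 1 < z \<and> z < y \<and> G y - G (y - 1) = (y - (y - 1)) * fact (Suc n)"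
    by (rule MVT2) (use G in auto)
  then have "G y - G (y - 1) = fact (Suc n)" by auto
  then show ?case
    using sum_alternating_binomial_Suc[where n = n and f = "\<lambda>i. (y - real i) ^ Suc n"]
    by (simp add: G_def algebra_simps)
qed simp

text \<open>Obtained by differentiating the identity one degree higher, whose right-hand side is
  constant. This is the linear relation among the full powers that leaves the B-spline free to be
  added.\<close>

lemma finite_difference_power_less:
  fixes y :: real
  shows "(\<Sum>i\<le>Suc n. (-1) ^ i * real (Suc n choose i) * (y - real i) ^ n) = 0"
proof -
  define R where "R y = (\<Sum>i\<le>Suc n. (-1) ^ i * real (Suc n choose i) * (y - real i) ^ Suc n)" for y :: real
  have "(R has_real_derivative
        (\<Sum>i\<le>Suc n. (-1) ^ i * real (Suc n choose i) * (real (Suc n) * (y - real i) ^ n))) (at y)"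
    unfolding R_def by (intro DERIV_sum DERIV_cmult DERIV_shifted_power)
  moreover have "R = (\<lambda>_. fact (Suc n))"
    unfolding R_def using finite_difference_power[of "Suc n"] by auto
  then have "(R has_real_derivative 0) (at y)" by simp
  ultimately have "(\<Sum>i\<le>Suc n. (-1) ^ i * real (Suc n choose i) * (real (Suc n) * (y - real i) ^ n)) = 0"
    by (rule DERIV_unique)
  also have "(\<Sum>i\<le>Suc n. (-1) ^ i * real (Suc n choose i) * (real (Suc n) * (y - real i) ^ n)) =
      real (Suc n) * (\<Sum>i\<le>Suc n. (-1) ^ i * real (Suc n choose i) * (y - real i) ^ n)"
    by (subst sum_distrib_left) (simp add: mult_ac del: sum.atMost_Suc of_nat_Suc)
  finally show ?thesis by (simp del: sum.atMost_Suc)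
qed

text \<open>Induction by integration: an expansion of the power l - 1 in degree n integrates to one
  of the power l in degree n + 1 up to a constant, and the finite-difference identity writes
  constants as combinations of shifted powers.\<close>

lemma shifted_powers_span:
  fixes z :: real
  assumes "l \<le> n"
  shows "\<exists>c. \<forall>y. (y - z) ^ l = (\<Sum>i\<le>n. c i * (y - real i) ^ n)"
  using assms
proof (induction n arbitrary: l)
  case (Suc n)
  have one: "\<exists>c. \<forall>y. b = (\<Sum>i\<le>Suc n. c i * (y - real i) ^ Suc n)" for b :: real
  proof (intro exI allI)
    fix y
    show "b = (\<Sum>i\<le>Suc n. (b / fact (Suc n) * ((-1) ^ i * real (Suc n choose i))) * (y - real i) ^ Suc n)"
      unfolding mult.assoc sum_distrib_left[symmetric]
      using finite_difference_power[of "Suc n" y] by (simp only: mult.assoc) simp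
  qed
  show ?case
  proof (cases l)
    case (Suc k)
    then obtain c where c: "(y - z) ^ k = (\<Sum>i\<le>n. c i * (y - real i) ^ n)" for y
      using Suc.IH[of k] Suc.prems by auto
    define F where "F y = (y - z) ^ l - real l / real (Suc n) * (\<Sum>i\<le>n. c i * (y - real i) ^ Suc n)" for y
    have "(F has_real_derivative 0) (at y)" for y
    proof -
      have "(F has_real_derivative real (Suc k) * (y - z) ^ k -
          real l / real (Suc n) * (\<Sum>i\<le>n. c i * (real (Suc n) * (y - real i) ^ n))) (at y)"
        unfolding F_def Suc by (intro DERIV_diff DERIV_sum DERIV_cmult DERIV_shifted_power)
      also have "(\<Sum>i\<le>n. c i * (real (Suc n) * (y - real i) ^ n)) = real (Suc n) * (y - z) ^ k"
        unfolding c by (simp add: sum_distrib_left mult_ac)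
      finally show ?thesis using Suc by simp
    qed
    then have "F y = F 0" for y using DERIV_isconst_all by blast
    moreover obtain d where d: "F 0 = (\<Sum>i\<le>Suc n. d i * (y - real i) ^ Suc n)" for y
      using one by blast
    ultimately have "F y = (\<Sum>i\<le>Suc n. d i * (y - real i) ^ Suc n)" for y by metis
    then have eq: "(y - z) ^ l = real l / real (Suc n) * (\<Sum>i\<le>n. c i * (y - real i) ^ Suc n) +
        (\<Sum>i\<le>Suc n. d i * (y - real i) ^ Suc n)" for y
      unfolding F_def diff_eq_eq by (simp only: add.commute)
    show ?thesis
    proof (intro exI allI)
      fix y
      show "(y - z) ^ l = (\<Sum>i\<le>Suc n. (real l / real (Suc n) * (if i \<le> n then c i else 0) + d i) * (y - real i) ^ Suc n)"
        unfolding eq distrib_right sum.distrib mult.assoc sum_distrib_left[symmetric]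
        by (simp del: power_Suc of_nat_Suc)
    qed
  next
    case 0
    show ?thesis unfolding 0 power_0 by (rule one)
  qed
qed (simp add: exI[of _ "\<lambda>_. 1"])

section \<open>Cardinal B-splines\<close>

text \<open>This is n! times the cardinal B-spline with knots 0, ..., n + 1; without the
  normalisation its coefficients are signed binomials.\<close>

definition bspline :: "nat \<Rightarrow> real \<Rightarrow> real" where
  "bspline n y = (\<Sum>i\<le>Suc n. (-1) ^ i * real (Suc n choose i) * tp n (y - real i))"

text \<open>\<open>bspline (Suc n) y\<close> is the increment \<open>B y - B (y - 1)\<close> of a
  function whose derivative is (n + 1) times the B-spline of degree n, so nonnegativity passes from
  one degree to the next. Degree 1 is the hat function.\<close>

lemma bspline_nonneg: "0 < n \<Longrightarrow> 0 \<le> bspline n y"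
proof (induction n arbitrary: y rule: nat_induct_non_zero)
  case 1
  show ?case
    using atMost_Suc by (simp add: bspline_def tp_def max_def numeral_2_eq_2)
next
  case (Suc n)
  define B where "B y = (\<Sum>i\<le>Suc n. (-1) ^ i * real (Suc n choose i) * tp (Suc n) (y - real i))" for y
  have B: "(B has_real_derivative real (Suc n) * bspline n x) (at x)" for x
  proof -
    have "((\<lambda>x. tp (Suc n) (x - real i)) has_real_derivative real (Suc n) * tp n (x - real i)) (at x)" for i
      using DERIV_tp[OF Suc.hyps, of "x + - real i"] unfolding DERIV_shift by simp
    then have "(B has_real_derivative
        (\<Sum>i\<le>Suc n. (-1) ^ i * real (Suc n choose i) * (real (Suc n) * tp n (x - real i)))) (at x)"
      unfolding B_def by (intro DERIV_sum DERIV_cmult)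
    also have "(\<Sum>i\<le>Suc n. (-1) ^ i * real (Suc n choose i) * (real (Suc n) * tp n (x - real i))) =
        real (Suc n) * bspline n x"
      unfolding bspline_def by (subst sum_distrib_left) (simp add: mult_ac del: sum.atMost_Suc of_nat_Suc)
    finally show ?thesis .
  qed
  have "B (y - 1) \<le> B y"
    by (rule DERIV_nonneg_imp_nondecreasing[of "y - 1" y B])
       (use B Suc.IH in \<open>force intro!: mult_nonneg_nonneg\<close>)+
  also have "B (y - 1) = (\<Sum>i\<le>Suc n. (-1) ^ i * real (Suc n choose i) * tp (Suc n) (y - real (Suc i)))"
    unfolding B_def by (intro sum.cong refl) (simp add: algebra_simps)
  finally show ?case
    using sum_alternating_binomial_Suc[where n = "Suc n" and f = "\<lambda>i. tp (Suc n) (y - real i)"]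
    unfolding bspline_def B_def by linarith
qed

text \<open>Between the first two knots only the summand i = 0 is active. This piece alone will
  bound the mass of the bump from below.\<close>

lemma bspline_left: "0 < n \<Longrightarrow> 0 \<le> y \<Longrightarrow> y \<le> 1 \<Longrightarrow> bspline n y = y ^ n"
  unfolding bspline_def by (subst sum.atMost_Suc_shift) (simp add: tp_pos tp_neg)

section \<open>Taylor polynomials and Hoelder balls\<close>

text \<open>Going down from order k, each step integrates the bound along the segment from a and
  gains one power of |x - a|. Besides Taylor remainders it serves, with H = 0, as the statement that
  a polynomial is determined by its jet.\<close>

lemma iterated_derivative_bound:
  fixes E :: "nat \<Rightarrow> real \<Rightarrow> real"
  assumes "convex S" "a \<in> S" "0 \<le> H"
    and der: "\<And>p x. p < k \<Longrightarrow> x \<in> S \<Longrightarrow> (E p has_real_derivative E (Suc p) x) (at x within S)"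
    and zero: "\<And>p. p < k \<Longrightarrow> E p a = 0"
    and top: "\<And>x. x \<in> S \<Longrightarrow> \<bar>E k x\<bar> \<le> H * \<bar>x - a\<bar> powr \<sigma>" "0 \<le> \<sigma>"
    and "p \<le> k" "x \<in> S"
  shows "\<bar>E p x\<bar> \<le> H * \<bar>x - a\<bar> powr (\<sigma> + real (k - p))"
  using \<open>p \<le> k\<close> \<open>x \<in> S\<close>
proof (induction p arbitrary: x rule: inc_induct)
  case base
  then show ?case using top by simp
next
  case (step p)
  let ?T = "closed_segment a x"
  have T: "?T \<subseteq> S" using assms(1,2) step.prems by (simp add: closed_segment_subset)
  have "norm (E p x - E p a) \<le> H * \<bar>x - a\<bar> powr (\<sigma> + real (k - Suc p)) * norm (x - a)"
  proof (rule field_differentiable_bound)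
    show "(E p has_field_derivative E (Suc p) z) (at z within ?T)" if "z \<in> ?T" for z
      using der[of p z] that T step.hyps by (auto intro: DERIV_subset)
    show "norm (E (Suc p) z) \<le> H * \<bar>x - a\<bar> powr (\<sigma> + real (k - Suc p))" if "z \<in> ?T" for z
    proof -
      have "\<bar>z - a\<bar> \<le> \<bar>x - a\<bar>"
        using that by (auto simp: closed_segment_eq_real_ivl split: if_splits)
      then have "\<bar>z - a\<bar> powr (\<sigma> + real (k - Suc p)) \<le> \<bar>x - a\<bar> powr (\<sigma> + real (k - Suc p))"
        using top(2) by (intro powr_mono2) auto
      then have "H * \<bar>z - a\<bar> powr (\<sigma> + real (k - Suc p)) \<le>
          H * \<bar>x - a\<bar> powr (\<sigma> + real (k - Suc p))"
        by (rule mult_left_mono) (rule assms(3))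
      moreover have "\<bar>E (Suc p) z\<bar> \<le> H * \<bar>z - a\<bar> powr (\<sigma> + real (k - Suc p))"
        using step.IH[of z] that T by blast
      ultimately show ?thesis by simp
    qed
  qed auto
  also have "H * \<bar>x - a\<bar> powr (\<sigma> + real (k - Suc p)) * norm (x - a) =
      H * \<bar>x - a\<bar> powr (\<sigma> + real (k - p))"
  proof (cases "x = a")
    case False
    have "real (k - p) = real (k - Suc p) + 1"
      using step.hyps by auto
    then show ?thesis using False unfolding add.assoc[symmetric]
      by (simp only: powr_add powr_one_gt_zero_iff) simp
  qed simp
  finally show ?case using zero[of p] step.hyps by simp
qed

text \<open>The p-th derivative of the polynomial of degree k with jet c at a. Carrying the order p
  as a parameter gives an explicit tower of derivatives.\<close>

definition taylor :: "(nat \<Rightarrow> real) \<Rightarrow> nat \<Rightarrow> nat \<Rightarrow> real \<Rightarrow> real \<Rightarrow> real" where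
  "taylor c k p a x = (\<Sum>l\<le>k - p. c (l + p) * (x - a) ^ l / fact l)"

lemma DERIV_taylor:
  assumes "p < k"
  shows "(taylor c k p a has_real_derivative taylor c k (Suc p) a x) (at x)"
proof -
  have k: "k - p = Suc (k - Suc p)" using assms by simp
  have eq: "taylor c k p a = (\<lambda>x. c p + (\<Sum>l\<le>k - Suc p. c (l + Suc p) / fact (Suc l) * (x - a) ^ Suc l))"
    unfolding taylor_def k by (subst sum.atMost_Suc_shift) (simp add: mult_ac fun_eq_iff)
  have "(taylor c k p a has_real_derivative
      0 + (\<Sum>l\<le>k - Suc p. c (l + Suc p) / fact (Suc l) * (real (Suc l) * (x - a) ^ l))) (at x)"
    unfolding eq by (intro DERIV_add DERIV_const DERIV_sum DERIV_cmult DERIV_shifted_power)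
  also have "0 + (\<Sum>l\<le>k - Suc p. c (l + Suc p) / fact (Suc l) * (real (Suc l) * (x - a) ^ l)) =
      taylor c k (Suc p) a x"
    unfolding taylor_def by (simp add: field_simps del: of_nat_Suc)
  finally show ?thesis .
qed

lemma taylor_center: "p \<le> k \<Longrightarrow> taylor c k p a a = c p"
  unfolding taylor_def by (simp add: sum.atMost_shift)

lemma taylor_top: "taylor c k k a x = c k"
  by (simp add: taylor_def)

lemma taylor_diff: "taylor (\<lambda>l. c l - d l) k p a x = taylor c k p a x - taylor d k p a x"
  by (simp add: taylor_def sum_subtractf[symmetric] diff_divide_distrib left_diff_distrib)

text \<open>Both sides are polynomials of degree k with the same jet at b, so their difference has
  vanishing jet and zero top derivative.\<close>

lemma taylor_recenter:
  assumes "p \<le> k"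
  shows "taylor (\<lambda>l. taylor c k l a b) k p b x = taylor c k p a x"
proof -
  have "\<bar>taylor (\<lambda>l. taylor c k l a b) k p b x - taylor c k p a x\<bar> \<le> 0 * \<bar>x - b\<bar> powr (0 + real (k - p))"
  proof (rule iterated_derivative_bound[where S = UNIV and
        E = "\<lambda>p x. taylor (\<lambda>l. taylor c k l a b) k p b x - taylor c k p a x"])
    show "((\<lambda>x. taylor (\<lambda>l. taylor c k l a b) k p b x - taylor c k p a x) has_real_derivative
        taylor (\<lambda>l. taylor c k l a b) k (Suc p) b x - taylor c k (Suc p) a x) (at x)"
      if "p < k" for p x
      using that by (intro DERIV_diff DERIV_taylor)
  qed (use assms in \<open>auto simp: taylor_center taylor_top\<close>)
  then show ?thesis by simp
qed

lemma taylor_scale: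
  assumes "h \<noteq> 0"
  shows "taylor (\<lambda>l. \<delta> l * h ^ l) k p N y = h ^ p * taylor \<delta> k p b (b + h * (y - N))"
  unfolding taylor_def sum_distrib_left
  by (intro sum.cong refl) (simp add: power_add power_mult_distrib mult_ac)

lemma shifted_powers_taylor:
  assumes eq: "\<And>y. (\<Sum>i\<in>I. e i * (y - real i) ^ n) = taylor \<omega> k 0 N y"
    and "p \<le> k" "p \<le> n"
  shows "(\<Sum>i\<in>I. e i * (fact n / fact (n - p)) * (y - real i) ^ (n - p)) = taylor \<omega> k p N y"
  using assms(2,3)
proof (induction p arbitrary: y)
  case 0
  then show ?case using eq by simp
next
  case (Suc p)
  have np: "n - p = Suc (n - Suc p)" using Suc.prems by simp
  have "((\<lambda>y. \<Sum>i\<in>I. e i * (fact n / fact (n - p)) * (y - real i) ^ (n - p)) has_real_derivative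
     (\<Sum>i\<in>I. e i * (fact n / fact (n - p)) * (real (Suc (n - Suc p)) * (y - real i) ^ (n - Suc p)))) (at y)"
    unfolding np by (intro DERIV_sum DERIV_cmult DERIV_shifted_power)
  moreover have "(\<lambda>y. \<Sum>i\<in>I. e i * (fact n / fact (n - p)) * (y - real i) ^ (n - p)) = taylor \<omega> k p N"
    using Suc by auto
  ultimately have "(taylor \<omega> k p N has_real_derivative (\<Sum>i\<in>I. e i * (fact n / fact (n - p)) *
      (real (Suc (n - Suc p)) * (y - real i) ^ (n - Suc p)))) (at y)"
    by (simp only:)
  then have "(\<Sum>i\<in>I. e i * (fact n / fact (n - p)) *
      (real (Suc (n - Suc p)) * (y - real i) ^ (n - Suc p))) = taylor \<omega> k (Suc p) N y"
    by (rule DERIV_unique) (intro DERIV_taylor Suc_le_lessD Suc.prems(1))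
  moreover have "e i * (fact n / fact (n - Suc p)) * z =
      e i * (fact n / fact (n - p)) * (real (Suc (n - Suc p)) * z)" for i z
    unfolding np by (simp del: of_nat_Suc)
  ultimately show ?case by (simp only:)
qed

section \<open>Hoelder balls through towers of derivatives\<close>

lemma holder_order_bounds:
  assumes "1 < \<beta>"
  shows "1 \<le> holder_order \<beta>" "real (holder_order \<beta>) < \<beta>" "\<beta> \<le> real (holder_order \<beta>) + 1"
  using assms unfolding holder_order_def by linarith+

lemma deriv_on_0 [simp]: "deriv_on U 0 f = f"
  by (simp add: deriv_on_def)

lemma deriv_on_Suc: "deriv_on U (Suc p) f x = vector_derivative (deriv_on U p f) (at x within {0..U})"
  by (simp add: deriv_on_def)

lemma sup_norm_le_iff:
  "0 \<le> M \<Longrightarrow> sup_norm U f \<le> ennreal M \<longleftrightarrow> (\<forall>x\<in>{0..U}. \<bar>f x\<bar> \<le> M)"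
  by (simp add: sup_norm_def SUP_le_iff)

lemma holder_ballD:
  assumes f: "f \<in> holder_ball \<beta> U H" and "0 \<le> H"
  shows "p < holder_order \<beta> \<Longrightarrow> x \<in> {0..U} \<Longrightarrow>
           (deriv_on U p f has_real_derivative deriv_on U (Suc p) f x) (at x within {0..U})"
    and "p \<le> holder_order \<beta> \<Longrightarrow> x \<in> {0..U} \<Longrightarrow> \<bar>deriv_on U p f x\<bar> \<le> H"
    and "x \<in> {0..U} \<Longrightarrow> y \<in> {0..U} \<Longrightarrow>
           \<bar>deriv_on U (holder_order \<beta>) f x - deriv_on U (holder_order \<beta>) f y\<bar>
             \<le> H * \<bar>x - y\<bar> powr (\<beta> - real (holder_order \<beta>))"
proof -
  define k where "k = holder_order \<beta>"
  show "(deriv_on U p f has_real_derivative deriv_on U (Suc p) f x) (at x within {0..U})"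
    if "p < holder_order \<beta>" "x \<in> {0..U}"
    using f that unfolding holder_ball_def has_real_derivative_iff_has_vector_derivative deriv_on_Suc
    by (auto simp: vector_derivative_works)
  let ?S1 = "\<Sum>j\<le>k. sup_norm U (deriv_on U j f)"
  let ?q = "\<lambda>(x, y). ennreal (\<bar>deriv_on U k f x - deriv_on U k f y\<bar> / \<bar>x - y\<bar> powr (\<beta> - real k))"
  let ?S2 = "SUP p \<in> {(x, y). x \<in> {0..U} \<and> y \<in> {0..U} \<and> x \<noteq> y}. ?q p"
  have "?S1 + ?S2 \<le> ennreal H"
    using f unfolding holder_ball_def holder_norm_def k_def by simp
  then have S: "?S1 \<le> ennreal H" "?S2 \<le> ennreal H"
    by (meson add_increasing add_increasing2 order_trans zero_le le_iff_add order_refl)+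
  show "\<bar>deriv_on U p f x\<bar> \<le> H" if "p \<le> holder_order \<beta>" "x \<in> {0..U}"
  proof -
    have "sup_norm U (deriv_on U p f) \<le> ?S1"
      using that by (intro member_le_sum) (auto simp: k_def)
    then show ?thesis using S(1) that(2) sup_norm_le_iff[OF \<open>0 \<le> H\<close>] by (meson order_trans)
  qed
  show "\<bar>deriv_on U (holder_order \<beta>) f x - deriv_on U (holder_order \<beta>) f y\<bar>
      \<le> H * \<bar>x - y\<bar> powr (\<beta> - real (holder_order \<beta>))" if "x \<in> {0..U}" "y \<in> {0..U}"
  proof (cases "x = y")
    case False
    have "?q (x, y) \<le> ?S2" using that False by (intro SUP_upper) auto
    then have "?q (x, y) \<le> ennreal H" using S(2) by (rule order_trans)
    then show ?thesis using False \<open>0 \<le> H\<close> by (simp add: k_def divide_le_eq)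
  qed simp
qed

text \<open>The interval is nondegenerate, so derivatives within it are unique, and any explicit
  tower of derivatives of f is the one that \<open>deriv_on\<close> computes.\<close>

lemma deriv_on_eq:
  assumes "0 < U" and f: "\<And>x. x \<in> {0..U} \<Longrightarrow> D 0 x = f x"
    and D: "\<And>p x. p < k \<Longrightarrow> x \<in> {0..U} \<Longrightarrow> (D p has_real_derivative D (Suc p) x) (at x within {0..U})"
    and "p \<le> k" "x \<in> {0..U}"
  shows "deriv_on U p f x = D p x"
  using assms(4,5)
proof (induction p arbitrary: x)
  case (Suc p)
  have "(deriv_on U p f has_real_derivative D (Suc p) x) (at x within {0..U})"
    using D[of p x] Suc unfolding has_real_derivative_iff_has_vector_derivative
    by (intro has_vector_derivative_transform[of x "{0..U}" "deriv_on U p f" "D p"]) auto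
  then show ?case
    unfolding deriv_on_Suc has_real_derivative_iff_has_vector_derivative
    by (intro vector_derivative_within_cbox[of 0 U, simplified])
       (use assms(1) Suc.prems in auto)
qed (simp add: f)

text \<open>The k + 1 sup norms and the seminorm contribute at most M each, which gives the factor k
  + 2.\<close>

lemma holder_ballI:
  assumes "0 < U" "0 \<le> M" and f: "\<And>x. x \<in> {0..U} \<Longrightarrow> D 0 x = f x"
    and D: "\<And>p x. p < holder_order \<beta> \<Longrightarrow> x \<in> {0..U} \<Longrightarrow> (D p has_real_derivative D (Suc p) x) (at x within {0..U})"
    and cont: "continuous_on {0..U} (D (holder_order \<beta>))"
    and bound: "\<And>p x. p \<le> holder_order \<beta> \<Longrightarrow> x \<in> {0..U} \<Longrightarrow> \<bar>D p x\<bar> \<le> M"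
    and holder: "\<And>x y. x \<in> {0..U} \<Longrightarrow> y \<in> {0..U} \<Longrightarrow> x < y \<Longrightarrow>
      \<bar>D (holder_order \<beta>) x - D (holder_order \<beta>) y\<bar> \<le> M * \<bar>x - y\<bar> powr (\<beta> - real (holder_order \<beta>))"
  shows "f \<in> holder_ball \<beta> U (real (holder_order \<beta> + 2) * M)"
proof -
  define k where "k = holder_order \<beta>"
  have eq: "deriv_on U p f x = D p x" if "p \<le> k" "x \<in> {0..U}" for p x
    by (rule deriv_on_eq[where k = k]) (use that assms k_def in auto)
  have "deriv_on U p f differentiable (at x within {0..U})" if "p < k" "x \<in> {0..U}" for p x
  proof -
    have "(deriv_on U p f has_real_derivative D (Suc p) x) (at x within {0..U})"
      using D[of p x] that eq[of p] unfolding has_real_derivative_iff_has_vector_derivative k_def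
      by (intro has_vector_derivative_transform[of x "{0..U}" "deriv_on U p f" "D p"]) auto
    then show ?thesis by (metis real_differentiable_def)
  qed
  moreover have "continuous_on {0..U} (deriv_on U k f)"
    using cont continuous_on_cong[OF refl eq[of k], of "{0..U}"] by (simp add: k_def)
  moreover have "holder_norm \<beta> U f \<le> ennreal (real (k + 2) * M)"
  proof -
    have "(\<Sum>j\<le>k. sup_norm U (deriv_on U j f)) \<le> (\<Sum>j\<le>k. ennreal M)"
      by (intro sum_mono) (use eq bound \<open>0 \<le> M\<close> in \<open>auto simp: sup_norm_le_iff k_def\<close>)
    also have "\<dots> = ennreal (real (k + 1) * M)"
      using \<open>0 \<le> M\<close> by (simp add: ennreal_mult'' ennreal_of_nat_eq_real_of_nat algebra_simps)
    finally have 1: "(\<Sum>j\<le>k. sup_norm U (deriv_on U j f)) \<le> ennreal (real (k + 1) * M)" .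
    have "\<bar>D k x - D k y\<bar> / \<bar>x - y\<bar> powr (\<beta> - real k) \<le> M"
      if "x \<in> {0..U}" "y \<in> {0..U}" "x \<noteq> y" for x y
      using holder[of x y] holder[of y x] that 
      by (cases "x < y") (auto simp: divide_le_eq k_def abs_minus_commute)
    then have 2: "(SUP (x, y) \<in> {(x, y). x \<in> {0..U} \<and> y \<in> {0..U} \<and> x \<noteq> y}.
        ennreal (\<bar>deriv_on U k f x - deriv_on U k f y\<bar> / \<bar>x - y\<bar> powr (\<beta> - real k))) \<le> ennreal M"
      using eq by (intro SUP_least) (auto intro!: ennreal_leI)
    have "ennreal (real (k + 1) * M) + ennreal M = ennreal (real (k + 2) * M)"
      using \<open>0 \<le> M\<close> by (simp add: ennreal_plus[symmetric] algebra_simps del: ennreal_plus)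
    then show ?thesis
      using add_mono[OF 1 2] unfolding holder_norm_def k_def by simp
  qed
  ultimately show ?thesis unfolding holder_ball_def k_def by auto
qed

section \<open>Splines on a cell\<close>

text \<open>The \<open>p\<close>-th derivative of the combination, with coefficients \<open>e\<close>, of the truncated powers on the cell \<open>[a, b]\<close>.\<close>

definition cell :: "nat \<Rightarrow> (nat \<Rightarrow> real) \<Rightarrow> real \<Rightarrow> real \<Rightarrow> nat \<Rightarrow> real \<Rightarrow> real" where
  "cell n e a b p x = (\<Sum>i\<le>Suc n. e i * (fact n / fact (n - p)) * (real (Suc n) / (b - a)) ^ p *
      tp (n - p) (real (Suc n) * (x - a) / (b - a) - real i))"

text \<open>With p < n the exponent n - p stays positive; \<open>tp 0\<close> is constantly 1 and
  would not vanish on the left.\<close>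

lemma cell_left:
  assumes "a < b" "x \<le> a" "p < n"
  shows "cell n e a b p x = 0"
proof -
  have "real (Suc n) * (x - a) / (b - a) \<le> 0"
    using assms by (intro divide_nonpos_pos mult_nonneg_nonpos) auto
  then have "tp (n - p) (real (Suc n) * (x - a) / (b - a) - real i) = 0" for i
    using assms by (intro tp_neg) (auto simp: of_nat_0_le_iff diff_le_eq intro: order_trans)
  then show ?thesis by (simp add: cell_def)
qed

text \<open>Right of b the rescaled variable is at least n + 1, so no truncation is active and the
  polynomial identity for e applies. The p-th power of the scale from the chain rule cancels the one
  produced by rescaling the jet.\<close>

lemma cell_right:
  assumes "a < b" "b \<le> x" "p \<le> k" "p \<le> n"
    and e: "\<And>y. (\<Sum>i\<le>Suc n. e i * (y - real i) ^ n) =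
      taylor (\<lambda>l. \<delta> l * ((b - a) / real (Suc n)) ^ l) k 0 (real (Suc n)) y"
  shows "cell n e a b p x = taylor \<delta> k p b x"
proof -
  define N where "N = real (Suc n)"
  define y where "y = N * (x - a) / (b - a)"
  have N: "0 < N" by (simp add: N_def)
  have y: "N \<le> y"
    using assms N by (simp add: y_def pos_le_divide_eq)
  have "cell n e a b p x = (N / (b - a)) ^ p * (\<Sum>i\<le>Suc n. e i * (fact n / fact (n - p)) * (y - real i) ^ (n - p))"
    unfolding cell_def N_def[symmetric] y_def[symmetric] sum_distrib_left
    using y by (intro sum.cong refl) (auto simp: tp_pos N_def mult_ac)
  also have "(\<Sum>i\<le>Suc n. e i * (fact n / fact (n - p)) * (y - real i) ^ (n - p)) =
      taylor (\<lambda>l. \<delta> l * ((b - a) / N) ^ l) k p N y"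
    using assms by (intro shifted_powers_taylor e[folded N_def])
  also have "\<dots> = ((b - a) / N) ^ p * taylor \<delta> k p b (b + (b - a) / N * (y - N))"
    using assms N by (intro taylor_scale) auto
  also have "b + (b - a) / N * (y - N) = x"
    using assms N by (simp add: y_def field_simps)
  finally show ?thesis
    using assms N by (simp add: power_mult_distrib[symmetric])
qed

lemma DERIV_cell:
  assumes "a < b" "Suc p < n"
  shows "(cell n e a b p has_real_derivative cell n e a b (Suc p) x) (at x)"
proof -
  define c where "c = real (Suc n) / (b - a)"
  have np: "n - p = Suc (n - Suc p)" using assms by simp
  have tpc: "((\<lambda>x. tp (Suc (n - Suc p)) (real (Suc n) * (x - a) / (b - a) - real i)) has_real_derivative
      real (Suc (n - Suc p)) * tp (n - Suc p) (real (Suc n) * (x - a) / (b - a) - real i) * c) (at x)" for i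
    unfolding c_def
    by (rule DERIV_chain2[OF DERIV_tp]) (use assms in \<open>auto intro!: derivative_eq_intros\<close>)
  have "(cell n e a b p has_real_derivative (\<Sum>i\<le>Suc n. e i * (fact n / fact (n - p)) * c ^ p *
      (real (Suc (n - Suc p)) * tp (n - Suc p) (real (Suc n) * (x - a) / (b - a) - real i) * c))) (at x)"
    unfolding cell_def np c_def[symmetric] by (intro DERIV_sum DERIV_cmult tpc)
  also have "(\<Sum>i\<le>Suc n. e i * (fact n / fact (n - p)) * c ^ p *
      (real (Suc (n - Suc p)) * tp (n - Suc p) (real (Suc n) * (x - a) / (b - a) - real i) * c)) =
      cell n e a b (Suc p) x"
    unfolding cell_def np c_def[symmetric]
    by (intro sum.cong refl) (simp del: of_nat_Suc add: mult_ac)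
  finally show ?thesis .
qed

lemma continuous_on_cell: "continuous_on A (cell n e a b p)"
  unfolding cell_def divide_inverse by (intro continuous_intros)

lemma cell_bound:
  assumes "a < b" "a \<le> x" "x \<le> b" "p \<le> n" and e: "\<And>i. i \<le> Suc n \<Longrightarrow> \<bar>e i\<bar> \<le> E"
  shows "\<bar>cell n e a b p x\<bar> \<le> real (n + 2) * fact n * real (Suc n) ^ n * E / (b - a) ^ p"
proof -
  define N where "N = real (Suc n)"
  define y where "y = N * (x - a) / (b - a)"
  have N: "1 \<le> N" by (simp add: N_def)
  have y: "y \<le> N"
    using assms N by (simp add: y_def pos_divide_le_eq)
  have E: "0 \<le> E" using e[of 0] by simp
  have "\<bar>e i * (fact n / fact (n - p)) * (N / (b - a)) ^ p * tp (n - p) (y - real i)\<bar>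
      \<le> E * fact n * (N / (b - a)) ^ p * N ^ (n - p)" if "i \<le> Suc n" for i
  proof -
    have "tp (n - p) (y - real i) \<le> N ^ (n - p)"
      unfolding tp_def using y N by (intro power_mono) auto
    moreover have "fact n / fact (n - p) \<le> (fact n :: real)"
      by (simp add: divide_le_eq mult_left_mono[of 1, simplified] fact_ge_1)
    ultimately show ?thesis
      unfolding abs_mult using e[OF that] E N assms(1)
      by (intro mult_mono) (auto simp: tp_nonneg)
  qed
  then have "\<bar>cell n e a b p x\<bar> \<le> (\<Sum>i\<le>Suc n. E * fact n * (N / (b - a)) ^ p * N ^ (n - p))"
    unfolding cell_def N_def[symmetric] y_def[symmetric] by (intro order_trans[OF sum_abs] sum_mono) auto
  also have "\<dots> = real (n + 2) * (E * fact n * (N / (b - a)) ^ p * N ^ (n - p))"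
    by simp
  also have "(N / (b - a)) ^ p * N ^ (n - p) = N ^ n / (b - a) ^ p"
    using assms(4) by (simp add: power_divide power_add[symmetric])
  then have "real (n + 2) * (E * fact n * (N / (b - a)) ^ p * N ^ (n - p)) =
      real (n + 2) * (E * fact n * (N ^ n / (b - a) ^ p))"
    by (simp only: mult.assoc)
  finally show ?thesis by (simp add: N_def mult_ac)
qed

text \<open>One factor of the n-th power of the rescaled variable is kept, so the bound vanishes
  linearly at a. This is what compensates the weight 1 / u.\<close>

lemma cell_bound_left:
  assumes "a < b" "a \<le> x" "x \<le> b" "0 < n" and e: "\<And>i. i \<le> Suc n \<Longrightarrow> \<bar>e i\<bar> \<le> E"
  shows "\<bar>cell n e a b 0 x\<bar> \<le> real (n + 2) * real (Suc n) ^ n * E / (b - a) * (x - a)"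
proof -
  define N where "N = real (Suc n)"
  define y where "y = N * (x - a) / (b - a)"
  have N: "1 \<le> N" by (simp add: N_def)
  have y: "0 \<le> y" "y \<le> N"
    using assms N by (auto simp: y_def pos_divide_le_eq)
  have E: "0 \<le> E" using e[of 0] by simp
  have "\<bar>e i * tp n (y - real i)\<bar> \<le> E * (N ^ (n - 1) * y)" if "i \<le> Suc n" for i
  proof -
    have "tp n (y - real i) \<le> y ^ n"
      unfolding tp_def using y N by (intro power_mono) auto
    also have "y ^ n = y ^ (n - 1) * y"
      using \<open>0 < n\<close> by (metis power_minus_mult)
    also have "\<dots> \<le> N ^ (n - 1) * y"
      using y by (intro mult_right_mono power_mono) auto
    finally show ?thesis
      unfolding abs_mult using e[OF that] E by (intro mult_mono) (auto simp: tp_nonneg)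
  qed
  then have "\<bar>cell n e a b 0 x\<bar> \<le> (\<Sum>i\<le>Suc n. E * (N ^ (n - 1) * y))"
    unfolding cell_def N_def[symmetric] y_def[symmetric]
    by (intro order_trans[OF sum_abs] sum_mono) auto
  also have "\<dots> = real (n + 2) * (E * (N ^ (n - 1) * y))"
    by simp
  also have "N ^ (n - 1) * y = N ^ n * (x - a) / (b - a)"
    using \<open>0 < n\<close> by (simp add: y_def power_minus_mult[symmetric, of n N])
  finally show ?thesis by (simp add: N_def mult_ac)
qed

lemma cell_bspline:
  "cell n (\<lambda>i. (-1) ^ i * real (Suc n choose i)) a b 0 x = bspline n (real (Suc n) * (x - a) / (b - a))"
  by (simp add: cell_def bspline_def del: sum.atMost_Suc of_nat_Suc)

lemma cell_add: "cell n (\<lambda>i. d i + c * e i) a b p x = cell n d a b p x + c * cell n e a b p x"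
  unfolding cell_def sum_distrib_left sum.distrib[symmetric]
  by (intro sum.cong refl) (simp add: algebra_simps add_divide_distrib)

section \<open>Moments against the singular weight\<close>

lemma weighted_integral_bound:
  fixes f g :: "real \<Rightarrow> real"
  assumes "0 \<le> a" "a < b" "0 < \<kappa>" "continuous_on {a..b} g" "continuous_on {a..b} f"
    and f: "\<And>u. u \<in> {a..b} \<Longrightarrow> \<kappa> \<le> f u" and g: "\<And>u. u \<in> {a..b} \<Longrightarrow> \<bar>g u\<bar> \<le> M * (u - a)"
  shows "set_integrable lborel {a..b} (\<lambda>u. g u / (u * (f u)\<^sup>2))"
    and "x \<in> {a..b} \<Longrightarrow> \<bar>LBINT u:{a..x}. g u / (u * (f u)\<^sup>2)\<bar> \<le> M * (b - a)\<^sup>2 / (b * \<kappa>\<^sup>2)"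
proof -
  define F where "F u = g u / (u * (f u)\<^sup>2)" for u
  have "0 \<le> M * (b - a)"
    using abs_ge_zero[of "g b"] g[of b] \<open>a < b\<close> by auto
  then have M: "0 \<le> M"
    using \<open>a < b\<close> by (simp add: zero_le_mult_iff)
  \<comment> \<open>Since (u - a) / u is at most (b - a) / b, no singularity remains even for a = 0.
    At u = 0 itself the quotient is 0, as division by zero yields 0.\<close>
  have bound: "\<bar>F u\<bar> \<le> M * (b - a) / (b * \<kappa>\<^sup>2)" if "u \<in> {a..b}" for u
  proof (cases "u = 0")
    case False
    have u: "0 < u" using False that assms by auto
    have "(u - a) * b \<le> (b - a) * u"
      using that assms(1) by (simp add: algebra_simps mult_left_mono)
    then have "(u - a) / u \<le> (b - a) / b"
      using u that by (simp add: frac_le_eq pos_divide_le_eq divide_simps)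
    then have "M * ((u - a) / u) \<le> M * ((b - a) / b)"
      using M by (rule mult_left_mono)
    moreover have "\<bar>g u\<bar> / u \<le> M * ((u - a) / u)"
      using g[OF that] u by (simp add: divide_right_mono)
    ultimately have "\<bar>g u\<bar> / u \<le> M * ((b - a) / b)" by simp
    moreover have "\<kappa>\<^sup>2 \<le> (f u)\<^sup>2" using f[OF that] assms(3) by (intro power_mono) auto
    ultimately have "\<bar>g u\<bar> / u / (f u)\<^sup>2 \<le> (M * ((b - a) / b)) / \<kappa>\<^sup>2"
      using M assms by (intro frac_le) auto
    then show ?thesis using u by (simp add: F_def abs_mult)
  qed (use M assms in \<open>simp add: F_def\<close>)
  have "(\<lambda>u. indicator {a..b} u *\<^sub>R (g u / (f u)\<^sup>2)) \<in> borel_measurable borel"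
    using f assms(3,4,5) by (intro borel_measurable_continuous_on_indicator continuous_intros) force+
  then have "(\<lambda>u. indicator {a..b} u *\<^sub>R (g u / (f u)\<^sup>2) / u) \<in> borel_measurable borel"
    by measurable
  also have "(\<lambda>u. indicator {a..b} u *\<^sub>R (g u / (f u)\<^sup>2) / u) = (\<lambda>u. indicator {a..b} u *\<^sub>R F u)"
    by (simp add: F_def fun_eq_iff field_simps)
  finally have meas: "set_borel_measurable borel {a..b} F"
    by (simp add: set_borel_measurable_def)
  have int: "set_integrable lborel {a..b} F"
  proof (rule set_integrable_bound)
    show "set_integrable lborel {a..b} (\<lambda>_. M * (b - a) / (b * \<kappa>\<^sup>2))"
      by (rule borel_integrable_atLeastAtMost') (rule continuous_on_const)
    show "set_borel_measurable lborel {a..b} F"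
      using meas by (simp add: set_borel_measurable_def)
    show "AE x in lborel. x \<in> {a..b} \<longrightarrow> norm (F x) \<le> norm (M * (b - a) / (b * \<kappa>\<^sup>2))"
      unfolding real_norm_def by (intro AE_I2 impI order_trans[OF bound abs_ge_self])
  qed
  then show "set_integrable lborel {a..b} (\<lambda>u. g u / (u * (f u)\<^sup>2))" unfolding F_def[abs_def] .
  assume x: "x \<in> {a..b}"
  have int': "set_integrable lborel {a..x} F"
    by (rule set_integrable_subset[OF int]) (use x in auto)
  have "\<bar>LBINT u:{a..x}. F u\<bar> \<le> (LBINT u:{a..x}. M * (b - a) / (b * \<kappa>\<^sup>2))"
    unfolding set_lebesgue_integral_def real_norm_def[symmetric]
  proof (rule Bochner_Integration.integral_norm_bound_integral)
    show "integrable lborel (\<lambda>u. indicat_real {a..x} u *\<^sub>R F u)"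
      using int' by (simp add: set_integrable_def)
    show "integrable lborel (\<lambda>u. indicat_real {a..x} u *\<^sub>R (M * (b - a) / (b * \<kappa>\<^sup>2)))"
      using borel_integrable_atLeastAtMost'[OF continuous_on_const] by (simp only: set_integrable_def)
    show "norm (indicat_real {a..x} u *\<^sub>R F u) \<le> indicat_real {a..x} u *\<^sub>R (M * (b - a) / (b * \<kappa>\<^sup>2))" for u
      using bound[of u] x by (auto simp: indicator_def)
  qed
  also have "\<dots> = (x - a) * (M * (b - a) / (b * \<kappa>\<^sup>2))"
    using x by (simp add: set_lebesgue_integral_def measure_def)
  also have "\<dots> \<le> (b - a) * (M * (b - a) / (b * \<kappa>\<^sup>2))"
    using x M assms by (intro mult_right_mono) auto
  finally show "\<bar>LBINT u:{a..x}. g u / (u * (f u)\<^sup>2)\<bar> \<le> M * (b - a)\<^sup>2 / (b * \<kappa>\<^sup>2)"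
    by (simp add: F_def power2_eq_square mult_ac)
qed

text \<open>The expansions of the powers of y - N are fixed once and \<omega> enters linearly, so
  one \<Lambda> serves all \<omega>. The powers with i \<le> n suffice; the coefficient with index n
  + 1 is set to 0, and the redundancy that this index creates is the room for the B-spline.\<close>

lemma step_coefficients:
  assumes "k \<le> n"
  shows "\<exists>\<Lambda>\<ge>0. \<forall>\<omega> W. (\<forall>l\<le>k. \<bar>\<omega> l\<bar> \<le> W) \<longrightarrow>
    (\<exists>e. (\<forall>i\<le>Suc n. \<bar>e i\<bar> \<le> \<Lambda> * W) \<and> (\<forall>y. (\<Sum>i\<le>Suc n. e i * (y - real i) ^ n) = taylor \<omega> k 0 N y))"
proof -
  obtain lam where lam: "(y - N) ^ l = (\<Sum>i\<le>n. lam l i * (y - real i) ^ n)" if "l \<le> k" for l y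
    using shifted_powers_span[of _ n N] assms by (metis order_trans)
  define \<Lambda> where "\<Lambda> = (\<Sum>l\<le>k. \<Sum>i\<le>n. \<bar>lam l i\<bar>)"
  have \<Lambda>: "0 \<le> \<Lambda>" by (auto simp: \<Lambda>_def intro!: sum_nonneg)
  have "\<exists>e. (\<forall>i\<le>Suc n. \<bar>e i\<bar> \<le> \<Lambda> * W) \<and> (\<forall>y. (\<Sum>i\<le>Suc n. e i * (y - real i) ^ n) = taylor \<omega> k 0 N y)"
    if \<omega>: "\<forall>l\<le>k. \<bar>\<omega> l\<bar> \<le> W" for \<omega> W
  proof (intro exI conjI allI impI)
    let ?e = "\<lambda>i. if i \<le> n then \<Sum>l\<le>k. \<omega> l / fact l * lam l i else 0"
    have W: "0 \<le> W" using \<omega> by (metis abs_ge_zero le0 order_trans)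
    fix i
    have "\<bar>\<Sum>l\<le>k. \<omega> l / fact l * lam l i\<bar> \<le> (\<Sum>l\<le>k. W * (\<Sum>i\<le>n. \<bar>lam l i\<bar>))" if "i \<le> n"
    proof (intro order_trans[OF sum_abs] sum_mono)
      fix l assume l: "l \<in> {..k}"
      have "\<bar>\<omega> l\<bar> / fact l \<le> W / 1"
        using \<omega> l fact_ge_1[of l, where 'a = real] by (intro frac_le) auto
      moreover have "\<bar>lam l i\<bar> \<le> (\<Sum>i\<le>n. \<bar>lam l i\<bar>)"
        using that by (intro member_le_sum) auto
      ultimately show "\<bar>\<omega> l / fact l * lam l i\<bar> \<le> W * (\<Sum>i\<le>n. \<bar>lam l i\<bar>)"
        unfolding abs_mult using W by (intro mult_mono) auto
    qed
    then show "\<bar>?e i\<bar> \<le> \<Lambda> * W"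
      using \<Lambda> W by (auto simp: \<Lambda>_def sum_distrib_left mult.commute intro!: sum_nonneg)
  next
    fix y
    have "(\<Sum>i\<le>n. (\<Sum>l\<le>k. \<omega> l / fact l * lam l i) * (y - real i) ^ n) =
        (\<Sum>l\<le>k. \<omega> l / fact l * (\<Sum>i\<le>n. lam l i * (y - real i) ^ n))"
      unfolding sum_distrib_left sum_distrib_right by (subst sum.swap) (simp add: mult.assoc)
    also have "\<dots> = taylor \<omega> k 0 N y"
      unfolding taylor_def by (intro sum.cong) (auto simp: lam[symmetric])
    finally show "(\<Sum>i\<le>Suc n. (if i \<le> n then \<Sum>l\<le>k. \<omega> l / fact l * lam l i else 0) * (y - real i) ^ n) =
        taylor \<omega> k 0 N y"
      by simp
  qed
  then show ?thesis using \<Lambda> by blast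
qed

text \<open>The weight is not integrable on the first cell, where \<open>a = 0\<close>. Because \<open>g\<close> vanishes to first order at \<open>a\<close>
  and \<open>(u - a) / u \<le> (b - a) / b\<close>, both the moment of \<open>g\<close> and that of the bump scale with \<open>1 / b\<close>, and the bound
  on \<open>c\<close> holds uniformly in all cells.\<close>

lemma moment_correction:
  fixes n :: nat and a b :: real and f g :: "real \<Rightarrow> real"
  defines "B \<equiv> cell n (\<lambda>i. (-1) ^ i * real (Suc n choose i)) a b 0"
  assumes "0 \<le> a" "a < b" "0 < \<kappa>" "0 < n" and cont: "continuous_on {a..b} g" "continuous_on {a..b} f"
    and f: "\<And>u. u \<in> {a..b} \<Longrightarrow> \<kappa> \<le> f u \<and> f u \<le> K"
    and g: "\<And>u. u \<in> {a..b} \<Longrightarrow> \<bar>g u\<bar> \<le> M * (u - a)"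
  shows "\<exists>c. \<bar>c\<bar> \<le> M * (b - a) * (2 * real (Suc n) * 2 ^ n * K\<^sup>2 / \<kappa>\<^sup>2) \<and>
    (LBINT u:{a..b}. (g u + c * B u) / (u * (f u)\<^sup>2)) = 0"
proof -
  define N where "N = real (Suc n)"
  define h where "h = b - a"
  have N: "1 \<le> N" and h: "0 < h" and b: "0 < b" using assms by (auto simp: N_def h_def)
  have B: "B u = bspline n (N * (u - a) / h)" for u
    by (simp add: B_def cell_bspline N_def h_def)
  define w where "w u = 1 / (u * (f u)\<^sup>2)" for u
  have w: "1 / (b * K\<^sup>2) \<le> w u" if "u \<in> {a..b}" "0 < u" for u
  proof -
    have "(f u)\<^sup>2 \<le> K\<^sup>2" "0 < f u" using f[OF that(1)] assms(4) by (auto intro!: power_mono)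
    then show ?thesis using that b unfolding w_def by (intro frac_le mult_mono mult_pos_pos) auto
  qed
  have wnn: "0 \<le> w u" if "u \<in> {a..b}" for u
    using that assms(2) by (simp add: w_def)
  note gint = weighted_integral_bound[where f = f and M = M, OF assms(2-4) cont]
  \<comment> \<open>Used only for the integrability of the bump against the weight; its size does
    not enter the bound on c.\<close>
  obtain MB where MB: "\<bar>B u\<bar> \<le> MB * (u - a)" if "u \<in> {a..b}" for u
  proof -
    have "\<bar>(-1) ^ i * real (Suc n choose i)\<bar> \<le> 2 ^ Suc n" if "i \<le> Suc n" for i
      using binomial_le_pow2[of "Suc n" i] by (simp add: abs_mult del: binomial_Suc_Suc) (metis of_nat_le_iff of_nat_numeral of_nat_power power_Suc)
    then have "\<bar>B u\<bar> \<le> real (n + 2) * real (Suc n) ^ n * 2 ^ Suc n / (b - a) * (u - a)" if "u \<in> {a..b}" for u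
      unfolding B_def using that by (intro cell_bound_left \<open>a < b\<close> \<open>0 < n\<close>) auto
    then show ?thesis by (rule that)
  qed
  have "continuous_on {a..b} B" unfolding B_def by (rule continuous_on_cell)
  note Bint = weighted_integral_bound(1)[where f = f and M = MB, OF assms(2-4) this cont(2)]
  have gi: "set_integrable lborel {a..b} (\<lambda>u. g u / (u * (f u)\<^sup>2))"
    and gb: "\<bar>LBINT u:{a..b}. g u / (u * (f u)\<^sup>2)\<bar> \<le> M * h\<^sup>2 / (b * \<kappa>\<^sup>2)"
    using gint f g \<open>a < b\<close> by (auto simp: h_def)
  have Bi: "set_integrable lborel {a..b} (\<lambda>u. B u / (u * (f u)\<^sup>2))"
    using Bint f MB by auto
  \<comment> \<open>The second half of the first knot interval: there the rescaled variable lies in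
    [1/2, 1], so the bump is at least 2 to the power -n, and u is positive even if a = 0.\<close>
  define J where "J = {a + h / (2 * N)..a + h / N}"
  have J: "J \<subseteq> {a..b}"
  proof -
    have "h / N \<le> h" "0 \<le> h / (2 * N)" using h N by (simp_all add: divide_le_eq)
    then show ?thesis by (auto simp: J_def h_def)
  qed
  define \<gamma> where "\<gamma> = (1 / 2) ^ n / (b * K\<^sup>2)"
  have Bw: "\<gamma> * indicator J u \<le> indicator {a..b} u * (B u / (u * (f u)\<^sup>2))" for u
  proof (cases "u \<in> J")
    case True
    moreover have "0 < h / (2 * N)" using h N by simp
    ultimately have u: "u \<in> {a..b}" "0 < u" using J assms(2) by (auto simp: J_def)
    define y where "y = N * (u - a) / h"
    have y: "1 / 2 \<le> y" "y \<le> 1"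
      using True h N by (auto simp: y_def J_def field_simps)
    have "(1 / 2) ^ n * (1 / (b * K\<^sup>2)) \<le> y ^ n * w u"
      using y w u b by (intro mult_mono power_mono) auto
    also have "y ^ n = B u"
      using y \<open>0 < n\<close> by (simp add: B y_def[symmetric] bspline_left)
    finally show ?thesis using True u by (simp add: \<gamma>_def w_def)
  next
    case False
    then show ?thesis
      using bspline_nonneg[OF \<open>0 < n\<close>] assms(2) by (auto simp: B indicator_def)
  qed
  define IB where "IB = (LBINT u:{a..b}. B u / (u * (f u)\<^sup>2))"
  have K: "0 < K" using f[of a] assms(3,4) by auto
  have \<gamma>: "0 < \<gamma>" using b K by (simp add: \<gamma>_def)
  have "\<gamma> * (h / (2 * N)) = (LBINT u. \<gamma> * indicator J u)"
    using h N by (simp add: J_def measure_def field_simps)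
  also have "\<dots> \<le> IB"
    unfolding IB_def set_lebesgue_integral_def
  proof (rule integral_mono)
    show "integrable lborel (\<lambda>u. \<gamma> * indicator J u)"
      unfolding J_def by (intro integrable_mult_right integrable_real_indicator) (auto simp: emeasure_lborel_Icc_eq)
    show "integrable lborel (\<lambda>u. indicat_real {a..b} u *\<^sub>R (B u / (u * (f u)\<^sup>2)))"
      using Bi by (simp only: set_integrable_def)
  qed (use Bw in simp)
  finally have IB: "\<gamma> * (h / (2 * N)) \<le> IB" .
  moreover have "0 < \<gamma> * (h / (2 * N))" using \<gamma> h N by simp
  ultimately have IBpos: "0 < IB" by linarith
  define c where "c = - (LBINT u:{a..b}. g u / (u * (f u)\<^sup>2)) / IB"
  have M: "0 \<le> M * h\<^sup>2 / (b * \<kappa>\<^sup>2)" using gb by linarith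
  have "\<bar>c\<bar> = \<bar>LBINT u:{a..b}. g u / (u * (f u)\<^sup>2)\<bar> / IB"
    using IBpos by (simp add: c_def)
  also have "\<dots> \<le> M * h\<^sup>2 / (b * \<kappa>\<^sup>2) / (\<gamma> * (h / (2 * N)))"
    using gb IB IBpos M \<open>0 < \<gamma> * (h / (2 * N))\<close> by (intro frac_le) auto
  also have "\<dots> = M * h * (2 * N * 2 ^ n * K\<^sup>2 / \<kappa>\<^sup>2)"
    using h N b K assms(4) by (simp add: \<gamma>_def field_simps power2_eq_square)
  finally have c: "\<bar>c\<bar> \<le> M * h * (2 * N * 2 ^ n * K\<^sup>2 / \<kappa>\<^sup>2)" .
  have "(LBINT u:{a..b}. (g u + c * B u) / (u * (f u)\<^sup>2)) =
      (LBINT u:{a..b}. g u / (u * (f u)\<^sup>2) + c * (B u / (u * (f u)\<^sup>2)))"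
    by (simp add: add_divide_distrib)
  also have "\<dots> = (LBINT u:{a..b}. g u / (u * (f u)\<^sup>2)) + c * IB"
    unfolding IB_def
    by (subst set_integral_add(2)[OF gi set_integrable_mult_right[OF Bi]]) (simp only: set_integral_mult_right)
  also have "\<dots> = 0" using IBpos by (simp add: c_def)
  finally show ?thesis using c by (auto simp: h_def N_def)
qed


section \<open>Interpolation with vanishing moment on one cell\<close>

lemma powr_diff_nat_mult:
  assumes "0 < (h :: real)"
  shows "h powr (s - real l) * h ^ l = h powr s"
  using assms by (simp add: powr_diff powr_realpow)

text \<open>The remainders of all orders form a tower with vanishing jet at a, and its top is
  controlled by the Hoelder seminorm.\<close>

lemma holder_taylor_bound:
  assumes f: "f \<in> holder_ball \<beta> U H" and "0 \<le> H" "1 < \<beta>"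
    and "a \<in> {0..U}" "x \<in> {0..U}" "p \<le> holder_order \<beta>"
  shows "\<bar>deriv_on U p f x - taylor (\<lambda>l. deriv_on U l f a) (holder_order \<beta>) p a x\<bar>
    \<le> H * \<bar>x - a\<bar> powr (\<beta> - real p)"
proof -
  define k where "k = holder_order \<beta>"
  note D = holder_ballD[OF f \<open>0 \<le> H\<close>, folded k_def]
  have "\<bar>deriv_on U p f x - taylor (\<lambda>l. deriv_on U l f a) k p a x\<bar>
      \<le> H * \<bar>x - a\<bar> powr ((\<beta> - real k) + real (k - p))"
  proof (rule iterated_derivative_bound[where S = "{0..U}" and
        E = "\<lambda>p x. deriv_on U p f x - taylor (\<lambda>l. deriv_on U l f a) k p a x"])
    show "((\<lambda>x. deriv_on U p f x - taylor (\<lambda>l. deriv_on U l f a) k p a x) has_real_derivative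
        deriv_on U (Suc p) f x - taylor (\<lambda>l. deriv_on U l f a) k (Suc p) a x) (at x within {0..U})"
      if "p < k" "x \<in> {0..U}" for p x
      using that by (intro DERIV_diff D has_field_derivative_at_within[OF DERIV_taylor])
  qed (use assms D holder_order_bounds[OF \<open>1 < \<beta>\<close>] in \<open>auto simp: taylor_center taylor_top k_def\<close>)
  also have "(\<beta> - real k) + real (k - p) = \<beta> - real p"
    using assms by (simp add: k_def)
  finally show ?thesis by (simp add: k_def)
qed

lemma holder_ball_continuous:
  assumes "f \<in> holder_ball \<beta> U H" "0 \<le> H" "1 < \<beta>"
  shows "continuous_on {0..U} f"
  unfolding continuous_on_eq_continuous_within
proof
  fix x assume "x \<in> {0..U}"
  then have "(f has_real_derivative deriv_on U (Suc 0) f x) (at x within {0..U})"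
    using holder_ballD(1)[OF assms(1,2), of 0 x] holder_order_bounds(1)[OF assms(3)] by simp
  then show "continuous (at x within {0..U}) f" by (rule DERIV_continuous)
qed

text \<open>The error bound carries the factor x - a instead of the cell length because only an
  error vanishing at a can be integrated against the weight on the cell that starts at 0.\<close>

definition cell_interpolant ::
  "real \<Rightarrow> nat \<Rightarrow> real \<Rightarrow> real \<Rightarrow> (real \<Rightarrow> real) \<Rightarrow> real \<Rightarrow> real \<Rightarrow> (nat \<Rightarrow> real) \<Rightarrow> bool" where
  "cell_interpolant \<beta> n C U f a b e \<longleftrightarrow>
    (let k = holder_order \<beta>; N = real (Suc n); h = b - a; T = taylor (\<lambda>l. deriv_on U l f a) k;
         s = (\<lambda>x. T 0 a x + cell n e a b 0 x)
     in (\<forall>i\<le>Suc n. \<bar>e i\<bar> \<le> C * h powr \<beta>) \<and>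
        (\<forall>y. (\<Sum>i\<le>Suc n. e i * (y - real i) ^ n) =
           taylor (\<lambda>l. (deriv_on U l f b - T l a b) * (h / N) ^ l) k 0 N y) \<and>
        (\<forall>x\<in>{a..b}. \<bar>s x - f x\<bar> \<le> C * h powr (\<beta> - 1) * (x - a)) \<and>
        (LBINT x:{a..b}. (s x - f x) / (x * (f x)\<^sup>2)) = 0)"

lemma cell_approx:
  assumes "1 < \<beta>" "0 \<le> H" "0 < \<kappa>" "holder_order \<beta> \<le> n" "0 < n"
  shows "\<exists>C\<ge>0. \<forall>U f a b. f \<in> holder_ball \<beta> U H \<longrightarrow> (\<forall>x\<in>{0..U}. \<kappa> \<le> f x \<and> f x \<le> K) \<longrightarrow>
      0 \<le> a \<longrightarrow> a < b \<longrightarrow> b \<le> U \<longrightarrow> (\<exists>e. cell_interpolant \<beta> n C U f a b e)"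
proof -
  define k where "k = holder_order \<beta>"
  define N where "N = real (Suc n)"
  have N: "1 \<le> N" by (simp add: N_def)
  obtain \<Lambda> where \<Lambda>: "0 \<le> \<Lambda>" and step: "\<And>\<omega> W. \<forall>l\<le>k. \<bar>\<omega> l\<bar> \<le> W \<Longrightarrow>
      \<exists>e. (\<forall>i\<le>Suc n. \<bar>e i\<bar> \<le> \<Lambda> * W) \<and> (\<forall>y. (\<Sum>i\<le>Suc n. e i * (y - real i) ^ n) = taylor \<omega> k 0 N y)"
    using step_coefficients[of k n N] assms(4) by (auto simp: k_def)
  \<comment> \<open>\<open>G\<close> is the factor of \<open>cell_bound_left\<close>,
    \<open>C1\<close> bounds the error before the moment is corrected, \<open>C2\<close> is the
    factor of \<open>moment_correction\<close>, and in \<open>Ce\<close> the power of 2 bounds the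
    binomial coefficients of the added B-spline.\<close>
  define G where "G = real (n + 2) * N ^ n"
  define C1 where "C1 = H + G * (\<Lambda> * H)"
  define C2 where "C2 = 2 * N * 2 ^ n * K\<^sup>2 / \<kappa>\<^sup>2"
  define Ce where "Ce = \<Lambda> * H + C1 * C2 * 2 ^ Suc n"
  define C where "C = Ce + (H + G * Ce)"
  have nn: "0 \<le> G" "0 \<le> C1" "0 \<le> C2" "0 \<le> Ce" "Ce \<le> C" "H + G * Ce \<le> C" "0 \<le> C"
    using assms \<Lambda> N by (auto simp: G_def C1_def C2_def Ce_def C_def)
  have "\<exists>e. cell_interpolant \<beta> n C U f a b e"
    if f: "f \<in> holder_ball \<beta> U H" "\<forall>x\<in>{0..U}. \<kappa> \<le> f x \<and> f x \<le> K" and ab: "0 \<le> a" "a < b" "b \<le> U" for U f a b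
  proof -
    define h where "h = b - a"
    have h: "0 < h" using ab by (simp add: h_def)
    define T where "T = taylor (\<lambda>l. deriv_on U l f a) k"
    define \<delta> where "\<delta> l = deriv_on U l f b - T l a b" for l
    have sub: "{a..b} \<subseteq> {0..U}" using ab by auto
    have tb: "\<bar>deriv_on U p f x - T p a x\<bar> \<le> H * \<bar>x - a\<bar> powr (\<beta> - real p)" if "p \<le> k" "x \<in> {a..b}" for p x
      using holder_taylor_bound[OF f(1) \<open>0 \<le> H\<close> \<open>1 < \<beta>\<close>, of a x p] that ab by (auto simp: T_def k_def)
    have hl: "h powr (\<beta> - real l) * h ^ l = h powr \<beta>" for l
      using h by (rule powr_diff_nat_mult)
    have h1: "h powr \<beta> / h = h powr (\<beta> - 1)" "h powr (\<beta> - 1) * h = h powr \<beta>"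
      using h by (auto simp: powr_diff)
    have "\<bar>\<delta> l * (h / N) ^ l\<bar> \<le> H * h powr \<beta>" if "l \<le> k" for l
    proof -
      have "(h / N) ^ l \<le> h ^ l" using h N by (intro power_mono) (auto simp: divide_le_eq)
      then have "\<bar>\<delta> l * (h / N) ^ l\<bar> \<le> (H * h powr (\<beta> - real l)) * h ^ l"
        unfolding abs_mult using tb[OF that, of b] h N ab assms(2)
        by (intro mult_mono) (auto simp: \<delta>_def h_def)
      then show ?thesis by (simp only: mult.assoc hl)
    qed
    then obtain e1 where e1: "\<And>i. i \<le> Suc n \<Longrightarrow> \<bar>e1 i\<bar> \<le> \<Lambda> * (H * h powr \<beta>)"
      "\<And>y. (\<Sum>i\<le>Suc n. e1 i * (y - real i) ^ n) = taylor (\<lambda>l. \<delta> l * (h / N) ^ l) k 0 N y"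
      using step[of "\<lambda>l. \<delta> l * (h / N) ^ l" "H * h powr \<beta>"] by auto
    have fT: "\<bar>T 0 a u - f u\<bar> \<le> H * h powr (\<beta> - 1) * (u - a)" if u: "u \<in> {a..b}" for u
    proof -
      have "(u - a) powr \<beta> = (u - a) powr (\<beta> - 1) * (u - a)"
        using u by (cases "u = a") (auto simp: powr_diff)
      also have "\<dots> \<le> h powr (\<beta> - 1) * (u - a)"
        using u assms(1) by (intro mult_right_mono powr_mono2) (auto simp: h_def)
      finally have "H * (u - a) powr \<beta> \<le> H * (h powr (\<beta> - 1) * (u - a))"
        using assms(2) by (rule mult_left_mono)
      then show ?thesis using tb[of 0 u] u by (simp add: abs_minus_commute mult.assoc)
    qed
    have cb: "\<bar>cell n e a b 0 u\<bar> \<le> G * E * h powr (\<beta> - 1) * (u - a)"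
      if "u \<in> {a..b}" "\<And>i. i \<le> Suc n \<Longrightarrow> \<bar>e i\<bar> \<le> E * h powr \<beta>" for e u E
    proof -
      have "\<bar>cell n e a b 0 u\<bar> \<le> G * (E * h powr \<beta>) / h * (u - a)"
        unfolding G_def N_def h_def using that ab assms(5)
        by (intro cell_bound_left) (auto simp: h_def)
      also have "G * (E * h powr \<beta>) / h = G * E * (h powr \<beta> / h)" by simp
      finally show ?thesis by (simp only: h1)
    qed
    define g where "g u = T 0 a u + cell n e1 a b 0 u - f u" for u
    have g: "\<bar>g u\<bar> \<le> (C1 * h powr (\<beta> - 1)) * (u - a)" if "u \<in> {a..b}" for u
    proof -
      have "\<bar>cell n e1 a b 0 u\<bar> \<le> G * (\<Lambda> * H) * h powr (\<beta> - 1) * (u - a)"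
        using that e1 by (intro cb) (auto simp: mult.assoc)
      moreover have "\<bar>g u\<bar> \<le> \<bar>T 0 a u - f u\<bar> + \<bar>cell n e1 a b 0 u\<bar>"
        unfolding g_def by linarith
      ultimately show ?thesis using fT[OF that] by (simp add: C1_def distrib_right)
    qed
    have "continuous_on {0..U} f"
      by (rule holder_ball_continuous[OF f(1) \<open>0 \<le> H\<close> \<open>1 < \<beta>\<close>])
    then have cf: "continuous_on {a..b} f" using sub by (rule continuous_on_subset)
    have cT: "continuous_on {a..b} (T 0 a)"
      unfolding T_def taylor_def by (intro continuous_intros) auto
    have cg: "continuous_on {a..b} g"
      unfolding g_def by (intro continuous_intros cf cT continuous_on_cell)
    obtain c where c: "\<bar>c\<bar> \<le> (C1 * h powr (\<beta> - 1)) * (b - a) * C2"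
      "(LBINT u:{a..b}. (g u + c * cell n (\<lambda>i. (-1) ^ i * real (Suc n choose i)) a b 0 u) / (u * (f u)\<^sup>2)) = 0"
      using moment_correction[OF ab(1,2) assms(3,5) cg cf _ g, of K] f(2) sub unfolding C2_def N_def by blast
    have c': "\<bar>c\<bar> \<le> C1 * C2 * h powr \<beta>"
      using c(1) by (simp add: h_def[symmetric] h1(2)[symmetric] mult_ac)
    \<comment> \<open>The added multiple of the B-spline has full-power sum zero, so the moment is
      corrected without disturbing the matching of Taylor polynomials right of b.\<close>
    define e where "e i = e1 i + c * ((-1) ^ i * real (Suc n choose i))" for i
    have e: "\<bar>e i\<bar> \<le> Ce * h powr \<beta>" if "i \<le> Suc n" for i
    proof -
      have "real (Suc n choose i) \<le> 2 ^ Suc n"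
        using binomial_le_pow2[of "Suc n" i] by (metis of_nat_le_iff of_nat_numeral of_nat_power)
      then have "\<bar>c * ((-1) ^ i * real (Suc n choose i))\<bar> \<le> (C1 * C2 * h powr \<beta>) * 2 ^ Suc n"
        unfolding abs_mult using c' by (intro mult_mono) (auto simp: power_abs)
      with e1(1)[OF that] show ?thesis unfolding e_def Ce_def by (simp add: algebra_simps)
    qed
    have "cell_interpolant \<beta> n C U f a b e"
      unfolding cell_interpolant_def Let_def k_def[symmetric] N_def[symmetric]
    proof (intro conjI allI impI ballI)
      show "\<bar>e i\<bar> \<le> C * (b - a) powr \<beta>" if "i \<le> Suc n" for i
        using e[OF that] nn mult_right_mono[of Ce C "h powr \<beta>"] by (simp add: h_def)
      have "(\<Sum>i\<le>Suc n. e i * (y - real i) ^ n) = (\<Sum>i\<le>Suc n. e1 i * (y - real i) ^ n) +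
          c * (\<Sum>i\<le>Suc n. (-1) ^ i * real (Suc n choose i) * (y - real i) ^ n)" for y
        unfolding sum_distrib_left sum.distrib[symmetric]
        by (intro sum.cong refl) (simp add: e_def algebra_simps)
      then show "(\<Sum>i\<le>Suc n. e i * (y - real i) ^ n) = taylor (\<lambda>l. (deriv_on U l f b -
          taylor (\<lambda>l. deriv_on U l f a) k l a b) * ((b - a) / N) ^ l) k 0 N y" for y
        unfolding finite_difference_power_less e1(2) by (simp add: \<delta>_def T_def h_def)
      show "\<bar>taylor (\<lambda>l. deriv_on U l f a) k 0 a x + cell n e a b 0 x - f x\<bar>
         \<le> C * (b - a) powr (\<beta> - 1) * (x - a)" if "x \<in> {a..b}" for x
      proof -
        have "\<bar>T 0 a x + cell n e a b 0 x - f x\<bar> \<le> (H + G * Ce) * h powr (\<beta> - 1) * (x - a)"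
        proof -
          have "\<bar>cell n e a b 0 x\<bar> \<le> G * Ce * h powr (\<beta> - 1) * (x - a)"
            using that e by (rule cb)
          moreover have "\<bar>T 0 a x + cell n e a b 0 x - f x\<bar> \<le> \<bar>T 0 a x - f x\<bar> + \<bar>cell n e a b 0 x\<bar>"
            by linarith
          ultimately show ?thesis using fT[OF that] by (simp add: distrib_right)
        qed
        also have "\<dots> \<le> C * h powr (\<beta> - 1) * (x - a)"
          using nn that by (intro mult_right_mono) auto
        finally show ?thesis by (simp add: T_def h_def)
      qed
      have "cell n e a b 0 u = cell n e1 a b 0 u + c * cell n (\<lambda>i. (-1) ^ i * real (Suc n choose i)) a b 0 u" for u
        unfolding e_def by (rule cell_add)
      then show "(LBINT x:{a..b}. (taylor (\<lambda>l. deriv_on U l f a) k 0 a x + cell n e a b 0 x - f x) / (x * (f x)\<^sup>2)) = 0"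
        using c(2) by (simp add: g_def T_def algebra_simps)
    qed
    then show ?thesis by blast
  qed
  then show ?thesis using nn(7) by blast
qed

section \<open>Splines on a mesh\<close>

text \<open>The additional cell \<open>[-1, 0]\<close> carries the Taylor polynomial at \<open>0\<close>, so that no separate polynomial
  part is needed.\<close>

definition mesh_spline :: "nat \<Rightarrow> (nat \<Rightarrow> real) \<Rightarrow> (nat \<Rightarrow> nat \<Rightarrow> real) \<Rightarrow> (nat \<Rightarrow> real) \<Rightarrow> nat \<Rightarrow> nat \<Rightarrow> real \<Rightarrow> real" where
  "mesh_spline n e0 e r m p x = cell n e0 (-1) 0 p x + (\<Sum>j<m. cell n (e j) (r j) (r (Suc j)) p x)"

lemma mesh_mono:
  fixes r :: "nat \<Rightarrow> real"
  assumes "\<And>j. j < m \<Longrightarrow> r j < r (Suc j)" "i \<le> j" "j \<le> m"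
  shows "r i \<le> r j"
  using assms(2,3)
proof (induction j rule: dec_induct)
  case (step j)
  then show ?case using assms(1)[of j] by simp
qed simp

lemma mesh_cell_exists:
  fixes r :: "nat \<Rightarrow> real"
  assumes "r 0 \<le> x" "x \<le> r m" "0 < m"
  shows "\<exists>j<m. r j \<le> x \<and> x \<le> r (Suc j)"
  using assms(2,3)
proof (induction m)
  case (Suc m)
  show ?case
  proof (cases "r m \<le> x")
    case False
    then have "0 < m" using assms(1) by (cases m) auto
    then show ?thesis using Suc False by (meson less_SucI linorder_not_le order_less_imp_le)
  qed (use Suc in auto)
qed simp

definition mesh_interpolant ::
  "real \<Rightarrow> nat \<Rightarrow> real \<Rightarrow> real \<Rightarrow> (real \<Rightarrow> real) \<Rightarrow> nat \<Rightarrow> (nat \<Rightarrow> real) \<Rightarrow> (nat \<Rightarrow> real) \<Rightarrow> (nat \<Rightarrow> nat \<Rightarrow> real) \<Rightarrow> bool" where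
  "mesh_interpolant \<beta> n C U f m r e0 e \<longleftrightarrow>
    (let h = (\<lambda>j. r (Suc j) - r j); s = mesh_spline n e0 e r m 0
     in (\<forall>i\<le>Suc n. \<bar>e0 i\<bar> \<le> C) \<and>
        (\<forall>j<m. \<forall>i\<le>Suc n. \<bar>e j i\<bar> \<le> C * h j powr \<beta>) \<and>
        s \<in> holder_ball \<beta> U C \<and>
        (\<forall>j<m. \<forall>x\<in>{r j..r (Suc j)}. \<bar>s x - f x\<bar> \<le> C * h j powr (\<beta> - 1) * (x - r j)) \<and>
        (\<forall>j<m. (LBINT x:{r j..r (Suc j)}. (s x - f x) / (x * (f x)\<^sup>2)) = 0))"

text \<open>At the knots the k-th derivative of the spline is that of f. For points in different
  cells the Hoelder estimate passes through the knots next to them and costs two local terms plus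
  the seminorm of f, however many cells lie in between. The degree is at least k + 2 so that a cell
  term has a derivative of order k + 1 to bound the local differences.\<close>

lemma mesh_spline_approx:
  assumes "1 < \<beta>" "0 \<le> H" "0 < \<kappa>" "holder_order \<beta> + 2 \<le> n" "0 < U"
  shows "\<exists>C\<ge>0. \<forall>f m r. f \<in> holder_ball \<beta> U H \<longrightarrow> (\<forall>x\<in>{0..U}. \<kappa> \<le> f x \<and> f x \<le> K) \<longrightarrow>
      0 < m \<longrightarrow> r 0 = 0 \<longrightarrow> r m = U \<longrightarrow> (\<forall>j<m. r j < r (Suc j)) \<longrightarrow>
    (\<exists>e0 e. mesh_interpolant \<beta> n C U f m r e0 e)"
proof -
  define k where "k = holder_order \<beta>"
  have k: "1 \<le> k" "real k < \<beta>" "\<beta> \<le> real k + 1" "Suc k < n" "0 < n" "k \<le> n"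
    using holder_order_bounds[OF assms(1)] assms(4) by (auto simp: k_def)
  define N where "N = real (Suc n)"
  have N: "1 \<le> N" by (simp add: N_def)
  obtain C0 where C0: "0 \<le> C0" and cell: "\<forall>U f a b. f \<in> holder_ball \<beta> U H \<longrightarrow>
      (\<forall>x\<in>{0..U}. \<kappa> \<le> f x \<and> f x \<le> K) \<longrightarrow> 0 \<le> a \<longrightarrow> a < b \<longrightarrow> b \<le> U \<longrightarrow>
      (\<exists>e. cell_interpolant \<beta> n C0 U f a b e)"
    using cell_approx[OF assms(1-3) k(6)[unfolded k_def] k(5), of K] by blast
  obtain \<Lambda> where \<Lambda>: "0 \<le> \<Lambda>" and step: "\<And>\<omega> W. \<forall>l\<le>k. \<bar>\<omega> l\<bar> \<le> W \<Longrightarrow>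
      \<exists>e. (\<forall>i\<le>Suc n. \<bar>e i\<bar> \<le> \<Lambda> * W) \<and> (\<forall>y. (\<Sum>i\<le>Suc n. e i * (y - real i) ^ n) = taylor \<omega> k 0 N y)"
    using step_coefficients[OF k(6), of N] by auto
  \<comment> \<open>\<open>G\<close> comes from \<open>cell_bound\<close> with coefficients of order
    h to the power \<beta>; \<open>UU\<close> bounds the powers \<beta> - p of all cell lengths for
    all p \<le> k at once. In \<open>M\<close>, the part 2 * G + H serves the seminorm and the
    remaining combination the sup norms.\<close>
  define G where "G = real (n + 2) * fact n * N ^ n * C0"
  define UU where "UU = max 1 U powr \<beta>"
  define M where "M = 2 * G + H + H * UU + G * UU"
  define C where "C = real (k + 2) * M + C0 + \<Lambda> * H"
  have UU: "0 < UU" by (simp add: UU_def)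
  have G: "0 \<le> G" using C0 N by (simp add: G_def)
  have M: "0 \<le> M" "2 * G + H \<le> M" "H + H * UU + G * UU \<le> M"
    using G UU assms(2) by (auto simp: M_def)
  have C: "0 \<le> C" "C0 \<le> C" "\<Lambda> * H \<le> C" "real (k + 2) * M \<le> C"
    using M C0 \<Lambda> assms(2) by (auto simp: C_def)
  have "\<exists>e0 e. mesh_interpolant \<beta> n C U f m r e0 e"
    if f: "f \<in> holder_ball \<beta> U H" "\<forall>x\<in>{0..U}. \<kappa> \<le> f x \<and> f x \<le> K"
      and m: "0 < m" "r 0 = 0" "r m = U" "\<forall>j<m. r j < r (Suc j)" for f m r
  proof -
    define D where "D p = deriv_on U p f" for p
    note fD = holder_ballD[OF f(1) assms(2), folded k_def D_def]
    define T where "T a = taylor (\<lambda>l. D l a) k" for a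
    define h where "h j = r (Suc j) - r j" for j
    have rlt: "r j < r (Suc j)" if "j < m" for j using that m(4) by auto
    have rmono: "r i \<le> r j" if "i \<le> j" "j \<le> m" for i j
      using mesh_mono[of m r, OF rlt that] by simp
    have r0: "0 \<le> r j" "r j \<le> U" if "j \<le> m" for j
      using rmono[of 0 j] rmono[of j m] that m by auto
    have h: "0 < h j" "h j \<le> U" if "j < m" for j
      using rlt[OF that] r0[of j] r0[of "Suc j"] that by (auto simp: h_def)
    have "\<forall>j<m. \<exists>e. cell_interpolant \<beta> n C0 U f (r j) (r (Suc j)) e"
      by (intro allI impI cell[rule_format]) (use f rlt r0 in \<open>auto simp: Suc_leI\<close>)
    then obtain e where "\<forall>j<m. cell_interpolant \<beta> n C0 U f (r j) (r (Suc j)) (e j)"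
      by metis
    note e' = this[unfolded cell_interpolant_def Let_def, folded k_def N_def D_def, folded T_def h_def, rule_format]
    have e: "\<bar>e j i\<bar> \<le> C0 * h j powr \<beta>" if "j < m" "i \<le> Suc n" for j i
      using e'[OF that(1), THEN conjunct1] that(2) by blast
    note e2 = e'[THEN conjunct2, THEN conjunct1, THEN spec]
    note e3 = e'[THEN conjunct2, THEN conjunct2, THEN conjunct1, THEN bspec]
    note e4 = e'[THEN conjunct2, THEN conjunct2, THEN conjunct2]
    have "\<bar>D l 0 * (1 / N) ^ l\<bar> \<le> H" if "l \<le> k" for l
    proof -
      have "\<bar>D l 0\<bar> * \<bar>(1 / N) ^ l\<bar> \<le> H * 1"
        using fD(2)[OF that, of 0] N assms(2,5)
        by (intro mult_mono) (auto simp: power_le_one)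
      then show ?thesis by (simp add: abs_mult)
    qed
    then obtain e0 where e0: "\<And>i. i \<le> Suc n \<Longrightarrow> \<bar>e0 i\<bar> \<le> \<Lambda> * H"
      "\<And>y. (\<Sum>i\<le>Suc n. e0 i * (y - real i) ^ n) = taylor (\<lambda>l. D l 0 * (1 / N) ^ l) k 0 N y"
      using step[of "\<lambda>l. D l 0 * (1 / N) ^ l" H] by auto
    define S where "S = mesh_spline n e0 e r m"
    \<comment> \<open>A telescoping sum: right of its cell, term J is the difference of the Taylor
      polynomials at \<open>r (Suc J)\<close> and \<open>r J\<close>, and the extra cell starts the
      sum with the one at 0.\<close>
    have left: "cell n e0 (-1) 0 p x + (\<Sum>j<J. cell n (e j) (r j) (r (Suc j)) p x) = T (r J) p (r J) x"
      if "J \<le> m" "r J \<le> x" "p \<le> k" for J p x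
      using that
    proof (induction J)
      case 0
      then show ?case unfolding T_def m(2)
        by (simp, intro cell_right) (use k(6) e0(2) m(2) in \<open>auto simp: N_def\<close>)
    next
      case (Suc J)
      have "cell n (e J) (r J) (r (Suc J)) p x =
          taylor (\<lambda>l. D l (r (Suc J)) - T (r J) l (r J) (r (Suc J))) k p (r (Suc J)) x"
        using Suc.prems k(6) e2[of J] rlt[of J] by (intro cell_right) (auto simp: h_def N_def)
      also have "\<dots> = T (r (Suc J)) p (r (Suc J)) x - T (r J) p (r J) x"
        unfolding taylor_diff using taylor_recenter[OF Suc.prems(3)] by (simp add: T_def)
      finally show ?case using Suc rmono[of J "Suc J"] by simp
    qed
    have S: "S p x = T (r j) p (r j) x + cell n (e j) (r j) (r (Suc j)) p x"
      if "j < m" "x \<in> {r j..r (Suc j)}" "p \<le> k" for j p x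
    proof -
      have "cell n (e i) (r i) (r (Suc i)) p x = 0" if "i \<in> {..<m} - {..<Suc j}" for i
        using that rlt[of i] rmono[of "Suc j" i] \<open>x \<in> _\<close> \<open>p \<le> k\<close> k by (intro cell_left) auto
      then have "(\<Sum>i<m. cell n (e i) (r i) (r (Suc i)) p x) = (\<Sum>i<Suc j. cell n (e i) (r i) (r (Suc i)) p x)"
        using that by (intro sum.mono_neutral_right) auto
      then show ?thesis
        using left[of j x p] that by (simp add: S_def mesh_spline_def)
    qed
    have knot: "S k (r j) = D k (r j)" if "j \<le> m" for j
    proof (cases "j = m")
      case True
      then show ?thesis
        using left[of m "r m" k] by (simp add: S_def mesh_spline_def T_def taylor_top)
    next
      case False
      then show ?thesis
        using S[of j "r j" k] that rlt[of j] k by (simp add: cell_left T_def taylor_top)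
    qed
    have hpow: "h j powr \<beta> / h j ^ p = h j powr (\<beta> - real p)" if "j < m" for j p
      using h[OF that] by (simp add: powr_diff powr_realpow)
    have hUU: "h j powr (\<beta> - real p) \<le> UU" if "j < m" "p \<le> k" for j p
    proof -
      have "h j powr (\<beta> - real p) \<le> max 1 U powr (\<beta> - real p)"
        using h[OF that(1)] that(2) k by (intro powr_mono2) auto
      also have "\<dots> \<le> UU"
        unfolding UU_def by (intro powr_mono) auto
      finally show ?thesis .
    qed
    have cellb: "\<bar>cell n (e j) (r j) (r (Suc j)) p x\<bar> \<le> G * h j powr (\<beta> - real p)"
      if "j < m" "x \<in> {r j..r (Suc j)}" "p \<le> n" for j p x
    proof -
      have "\<bar>cell n (e j) (r j) (r (Suc j)) p x\<bar> \<le>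
          real (n + 2) * fact n * N ^ n * (C0 * h j powr \<beta>) / h j ^ p"
        unfolding N_def h_def using that rlt e by (intro cell_bound) (auto simp: h_def)
      also have "\<dots> = G * (h j powr \<beta> / h j ^ p)" by (simp add: G_def)
      finally show ?thesis by (simp only: hpow[OF that(1)])
    qed
    \<comment> \<open>Within a cell the k-th derivative of the Taylor part is constant. The
      derivative of order k + 1 of the rest is of order h to the power \<beta> - k - 1; as this
      exponent is at most 0 and |x - y| \<le> h, the length h may be replaced by |x - y|.\<close>
    have loc: "\<bar>S k x - S k y\<bar> \<le> G * \<bar>x - y\<bar> powr (\<beta> - real k)"
      if j: "j < m" and xy: "x \<in> {r j..r (Suc j)}" "y \<in> {r j..r (Suc j)}" for j x y
    proof (cases "x = y")
      case False
      have "norm (cell n (e j) (r j) (r (Suc j)) k x - cell n (e j) (r j) (r (Suc j)) k y)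
          \<le> G * h j powr (\<beta> - real (Suc k)) * norm (x - y)"
      proof (rule field_differentiable_bound[of "{r j..r (Suc j)}"])
        show "(cell n (e j) (r j) (r (Suc j)) k has_field_derivative cell n (e j) (r j) (r (Suc j)) (Suc k) z)
            (at z within {r j..r (Suc j)})" for z
          using rlt[OF j] k by (intro has_field_derivative_at_within[OF DERIV_cell]) auto
        show "norm (cell n (e j) (r j) (r (Suc j)) (Suc k) z) \<le> G * h j powr (\<beta> - real (Suc k))"
          if "z \<in> {r j..r (Suc j)}" for z
          using cellb[OF j that, of "Suc k"] k by simp
      qed (use xy in auto)
      also have "\<dots> \<le> G * \<bar>x - y\<bar> powr (\<beta> - real (Suc k)) * norm (x - y)"
        using False k xy G
        by (intro mult_left_mono mult_right_mono powr_mono2') (auto simp: h_def)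
      also have "\<dots> = G * \<bar>x - y\<bar> powr (\<beta> - real k)"
        using False by (simp add: powr_diff powr_add)
      finally show ?thesis
        using S[OF j xy(1), of k] S[OF j xy(2), of k] by (simp add: T_def taylor_top)
    qed simp
    have hold: "\<bar>S k x - S k y\<bar> \<le> M * \<bar>x - y\<bar> powr (\<beta> - real k)"
      if xy: "x \<in> {0..U}" "y \<in> {0..U}" "x < y" for x y
    proof -
      define Q where "Q = \<bar>x - y\<bar> powr (\<beta> - real k)"
      have Q: "\<bar>u - v\<bar> powr (\<beta> - real k) \<le> Q" if "x \<le> u" "u \<le> v" "v \<le> y" for u v
        unfolding Q_def using that k by (intro powr_mono2) auto
      have Q0: "0 \<le> Q" by (simp add: Q_def)
      obtain i j where i: "i < m" "r i \<le> x" "x \<le> r (Suc i)" and j: "j < m" "r j \<le> y" "y \<le> r (Suc j)"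
        using mesh_cell_exists[of r x m] mesh_cell_exists[of r y m] xy m by auto
      have "i \<le> j"
        using rmono[of "Suc j" i] i j xy by (cases "i \<le> j") auto
      have "\<bar>S k x - S k y\<bar> \<le> (2 * G + H) * Q"
      proof (cases "i = j")
        case True
        have "\<bar>S k x - S k y\<bar> \<le> G * Q"
          unfolding Q_def using i j True by (intro loc) auto
        also have "\<dots> \<le> (2 * G + H) * Q"
          using Q0 G assms(2) by (intro mult_right_mono) auto
        finally show ?thesis .
      next
        case False
        then have o: "r (Suc i) \<le> r j" using \<open>i \<le> j\<close> j by (intro rmono) auto
        have "\<bar>S k x - S k (r (Suc i))\<bar> \<le> G * \<bar>x - r (Suc i)\<bar> powr (\<beta> - real k)"
          using i by (intro loc[of i]) auto
        also have "\<dots> \<le> G * Q"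
          using G o i j by (intro mult_left_mono Q) auto
        finally have 1: "\<bar>S k x - S k (r (Suc i))\<bar> \<le> G * Q" .
        have "\<bar>S k (r j) - S k y\<bar> \<le> G * \<bar>r j - y\<bar> powr (\<beta> - real k)"
          using j by (intro loc[of j]) auto
        also have "\<dots> \<le> G * Q"
          using G o i j by (intro mult_left_mono Q) auto
        finally have 2: "\<bar>S k (r j) - S k y\<bar> \<le> G * Q" .
        have "\<bar>D k (r (Suc i)) - D k (r j)\<bar> \<le> H * \<bar>r (Suc i) - r j\<bar> powr (\<beta> - real k)"
          using r0[of "Suc i"] r0[of j] i j by (intro fD(3)) auto
        also have "\<dots> \<le> H * Q"
          using assms(2) o i j by (intro mult_left_mono Q) auto
        finally have "\<bar>S k (r (Suc i)) - S k (r j)\<bar> \<le> H * Q"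
          using knot[of "Suc i"] knot[of j] i j by simp
        with 1 2 show ?thesis by (simp add: distrib_right) 
      qed
      also have "\<dots> \<le> M * Q" using M Q0 by (intro mult_right_mono) auto
      finally show ?thesis by (simp add: Q_def)
    qed
    have bound: "\<bar>S p x\<bar> \<le> M" if "p \<le> k" "x \<in> {0..U}" for p x
    proof -
      obtain j where j: "j < m" "r j \<le> x" "x \<le> r (Suc j)"
        using mesh_cell_exists[of r x m] \<open>x \<in> {0..U}\<close> m(1-3) by auto
      have "\<bar>D p x - T (r j) p (r j) x\<bar> \<le> H * \<bar>x - r j\<bar> powr (\<beta> - real p)"
        unfolding D_def T_def k_def
        using that j r0[of j] f(1) assms by (intro holder_taylor_bound) (auto simp: k_def)
      also have "\<dots> \<le> H * h j powr (\<beta> - real p)"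
        using assms(2) j that(1) k by (intro mult_left_mono powr_mono2) (auto simp: h_def)
      also have "\<dots> \<le> H * UU"
        using hUU[OF j(1) that(1)] assms(2) by (intro mult_left_mono) auto
      finally have "\<bar>T (r j) p (r j) x\<bar> \<le> H + H * UU"
        using fD(2)[OF that] by linarith
      moreover have "\<bar>cell n (e j) (r j) (r (Suc j)) p x\<bar> \<le> G * UU"
        using cellb[of j x p] j that k mult_left_mono[OF hUU[OF j(1) that(1)] G] by simp
      ultimately show ?thesis using S[of j x p] j that M by simp
    qed
    have "S 0 \<in> holder_ball \<beta> U (real (holder_order \<beta> + 2) * M)"
    proof (rule holder_ballI[where D = S])
      show "(S p has_real_derivative S (Suc p) x) (at x within {0..U})" if "p < holder_order \<beta>" for p x
        unfolding S_def mesh_spline_def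
        using that k rlt by (intro DERIV_add DERIV_sum has_field_derivative_at_within[OF DERIV_cell]) (auto simp: k_def)
      show "continuous_on {0..U} (S (holder_order \<beta>))"
        unfolding S_def mesh_spline_def by (intro continuous_intros continuous_on_cell)
    qed (use assms M bound hold in \<open>auto simp: k_def\<close>)
    then have ball: "S 0 \<in> holder_ball \<beta> U C"
      using C(4) unfolding holder_ball_def k_def by (auto intro: order_trans ennreal_leI)
    have S0: "mesh_spline n e0 e r m 0 x = T (r j) 0 (r j) x + cell n (e j) (r j) (r (Suc j)) 0 x"
      if "j < m" "x \<in> {r j..r (Suc j)}" for j x
      using S[OF that, of 0] by (simp add: S_def)
    have "mesh_interpolant \<beta> n C U f m r e0 e"
      unfolding mesh_interpolant_def Let_def
    proof (intro conjI allI impI ballI)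
      show "\<bar>e0 i\<bar> \<le> C" if "i \<le> Suc n" for i using e0(1)[OF that] C by linarith
      show "\<bar>e j i\<bar> \<le> C * (r (Suc j) - r j) powr \<beta>" if "j < m" "i \<le> Suc n" for i j
        using e[OF that] mult_right_mono[OF C(2), of "h j powr \<beta>"] by (simp add: h_def)
      show "mesh_spline n e0 e r m 0 \<in> holder_ball \<beta> U C" using ball by (simp add: S_def)
      fix j assume j: "j < m"
      show "\<bar>mesh_spline n e0 e r m 0 x - f x\<bar> \<le> C * (r (Suc j) - r j) powr (\<beta> - 1) * (x - r j)"
        if x: "x \<in> {r j..r (Suc j)}" for x
      proof -
        have "C0 * (h j powr (\<beta> - 1) * (x - r j)) \<le> C * (h j powr (\<beta> - 1) * (x - r j))"
          using C(2) x by (intro mult_right_mono) auto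
        then show ?thesis using e3[OF j x] S0[OF j x] by (simp add: h_def mult.assoc)
      qed
      have "(LBINT x:{r j..r (Suc j)}. (mesh_spline n e0 e r m 0 x - f x) / (x * (f x)\<^sup>2)) =
          (LBINT x:{r j..r (Suc j)}. (T (r j) 0 (r j) x + cell n (e j) (r j) (r (Suc j)) 0 x - f x) / (x * (f x)\<^sup>2))"
        by (intro set_lebesgue_integral_cong) (use S0[OF j] in auto)
      then show "(LBINT x:{r j..r (Suc j)}. (mesh_spline n e0 e r m 0 x - f x) / (x * (f x)\<^sup>2)) = 0"
        using e4[OF j] by simp
    qed
    then show ?thesis by blast
  qed
  then show ?thesis using C(1) by blast
qed

section \<open>Splines as networks\<close>

lemma tp_scale: "0 \<le> c \<Longrightarrow> tp n (c * z) = c ^ n * tp n z"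
proof -
  assume "0 \<le> c"
  then have "max (c * z) 0 = c * max z 0"
    by (auto simp: max_def mult_le_0_iff)
  then show ?thesis by (simp add: tp_def power_mult_distrib)
qed

lemma requ_tp: "requ (tp (2 ^ l) z) = tp (2 ^ Suc l) z"
proof -
  have "requ (tp (2 ^ l) z) = (tp (2 ^ l) z)\<^sup>2"
    by (simp add: requ_def tp_nonneg)
  then show ?thesis by (simp add: tp_def power_mult[symmetric] mult.commute)
qed

lemma sum_kronecker:
  fixes F :: "nat \<Rightarrow> real"
  assumes "i < M"
  shows "(\<Sum>j<M. (if i = j then 1 else 0) * F j) = F i"
proof -
  have "(\<Sum>j<M. (if i = j then 1 else 0) * F j) = (\<Sum>j<M. if i = j then F j else 0)"
    by (intro sum.cong) auto
  then show ?thesis using assms by simp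
qed

text \<open>Unit i of the hidden layers 1, ..., q holds the truncated power of x - t i with exponent
  2, 4, ..., 2 ^ q, and between hidden layers the wiring is diagonal. So each of the q + 1 affine
  maps has at most M nonzero weights; with M biases for the shifts and one at the output the total
  is (q + 2) * M + 1.\<close>

lemma truncated_powers_in_NN:
  fixes t e :: "nat \<Rightarrow> real"
  defines "p \<equiv> \<lambda>q M l. if l = 0 \<or> l = Suc q then 1 else M :: nat"
  assumes "1 \<le> q" "1 \<le> B" and t: "\<And>i. i < M \<Longrightarrow> \<bar>t i\<bar> \<le> B" and e: "\<And>i. i < M \<Longrightarrow> \<bar>e i\<bar> \<le> B"
    and "\<bar>c\<bar> \<le> B" and s: "(q + 2) * M + 1 \<le> s"
  shows "(\<lambda>x. (\<Sum>i<M. e i * tp (2 ^ q) (x - t i)) + c) \<in> NN q (p q M) s B"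
proof -
  define W where "W l i j = (if l = 0 then 1 else if l = q then e j else if i = j then 1 else 0)" for l i j :: nat
  define b where "b l i = (if l = 0 then - t i else if l = q then c else 0)" for l i :: nat
  have hid: "hidden (p q M) W b x (Suc l) i = tp (2 ^ Suc l) (x - t i)" if "l < q" "i < M" for l i x
    using that
  proof (induction l arbitrary: i)
    case 0
    then show ?case
      by (simp add: p_def W_def b_def requ_def tp_def)
  next
    case (Suc l)
    have "hidden (p q M) W b x (Suc (Suc l)) i =
        requ ((\<Sum>j<M. (if i = j then 1 else 0) * hidden (p q M) W b x (Suc l) j) + 0)"
      using Suc.prems by (simp add: p_def W_def b_def del: hidden.simps(2)) (simp add: p_def W_def b_def)
    also have "(\<Sum>j<M. (if i = j then 1 else 0) * hidden (p q M) W b x (Suc l) j) = hidden (p q M) W b x (Suc l) i"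
      using Suc.prems by (intro sum_kronecker)
    also have "hidden (p q M) W b x (Suc l) i = tp (2 ^ Suc l) (x - t i)"
      using Suc by simp
    finally show ?case by (simp only: add_0_right requ_tp)
  qed
  have "network q (p q M) W b x = (\<Sum>i<M. e i * tp (2 ^ q) (x - t i)) + c" for x
  proof -
    obtain q' where q: "q = Suc q'" using assms(2) by (cases q) auto
    have "network q (p q M) W b x = (\<Sum>j<M. e j * hidden (p q M) W b x q j) + c"
      using assms(2) by (simp add: network_def p_def W_def b_def)
    also have "(\<Sum>j<M. e j * hidden (p q M) W b x q j) = (\<Sum>i<M. e i * tp (2 ^ q) (x - t i))"
      unfolding q by (intro sum.cong refl) (simp add: hid[unfolded q] del: hidden.simps)
    finally show ?thesis .
  qed
  then have net: "network q (p q M) W b = (\<lambda>x. (\<Sum>i<M. e i * tp (2 ^ q) (x - t i)) + c)"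
    by auto
  \<comment> \<open>An enumeration, by layer and unit, of the positions that can carry a nonzero
    weight; it replaces counting the support layer by layer.\<close>
  define w :: "nat \<times> nat \<Rightarrow> nat \<times> nat \<times> nat"
    where "w = (\<lambda>(l, a). if l = 0 then (0, a, 0) else if l = q then (q, 0, a) else (l, a, a))"
  have "{(l, i, j). l \<le> q \<and> i < p q M (l + 1) \<and> j < p q M l \<and> W l i j \<noteq> 0} \<subseteq> w ` ({..q} \<times> {..<M})"
  proof (clarify)
    fix l i j assume *: "l \<le> q" "i < p q M (l + 1)" "j < p q M l" "W l i j \<noteq> 0"
    consider "l = 0" | "l = q" "l \<noteq> 0" | "l \<noteq> 0" "l < q" using * by linarith
    then show "(l, i, j) \<in> w ` ({..q} \<times> {..<M})"
    proof cases
      case 1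
      then show ?thesis using * assms(2) by (intro image_eqI[of _ _ "(0, i)"]) (auto simp: w_def p_def)
    next
      case 2
      then show ?thesis using * by (intro image_eqI[of _ _ "(q, j)"]) (auto simp: w_def p_def)
    next
      case 3
      then show ?thesis using * by (intro image_eqI[of _ _ "(l, i)"]) (auto simp: w_def p_def W_def split: if_splits)
    qed
  qed
  then have "card {(l, i, j). l \<le> q \<and> i < p q M (l + 1) \<and> j < p q M l \<and> W l i j \<noteq> 0}
      \<le> card (w ` ({..q} \<times> {..<M}))"
    by (intro card_mono) auto
  also have "\<dots> \<le> Suc q * M"
    using card_image_le[of "{..q} \<times> {..<M}" w] by simp
  finally have cW: "card {(l, i, j). l \<le> q \<and> i < p q M (l + 1) \<and> j < p q M l \<and> W l i j \<noteq> 0} \<le> Suc q * M" .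
  have "{(l, i). l \<le> q \<and> i < p q M (l + 1) \<and> b l i \<noteq> 0} \<subseteq> insert (q, 0) (Pair 0 ` {..<M})"
    using assms(2) by (auto simp: b_def p_def split: if_splits)
  then have "card {(l, i). l \<le> q \<and> i < p q M (l + 1) \<and> b l i \<noteq> 0} \<le> card (insert (q, 0 :: nat) (Pair 0 ` {..<M}))"
    by (intro card_mono) auto
  also have "\<dots> \<le> Suc M"
    using card_insert_le_m1[of "Suc M"] card_image_le[of "{..<M}" "Pair (0 :: nat)"]
    by (metis (no_types, lifting) card_insert_if card_lessThan finite_imageI finite_lessThan le_SucI not_less_eq_eq)
  finally have cb: "card {(l, i). l \<le> q \<and> i < p q M (l + 1) \<and> b l i \<noteq> 0} \<le> Suc M" .
  have "\<bar>W l i j\<bar> \<le> B" "\<bar>b l i\<bar> \<le> B" if "l \<le> q" "i < p q M (l + 1)" "j < p q M l" for l i j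
    using that assms t e by (auto simp: W_def b_def p_def split: if_splits)
  moreover have "\<bar>b l i\<bar> \<le> B" if "l \<le> q" "i < p q M (l + 1)" for l i
    using that assms t e by (auto simp: b_def p_def split: if_splits)
  moreover have "Suc q * M + Suc M \<le> s" using s by simp
  ultimately show ?thesis
    unfolding NN_def mem_Collect_eq net[symmetric]
    using cW cb by (intro exI[of _ W] exI[of _ b]) (auto simp: p_def)
qed

lemma cell_as_truncated_powers:
  assumes "a < b"
  shows "cell n e a b 0 x = (\<Sum>i<n + 2. e i * (real (Suc n) / (b - a)) ^ n *
    tp n (x - (a + real i * (b - a) / real (Suc n))))"
proof -
  define N where "N = real (Suc n)"
  have N: "0 < N" by (simp add: N_def)
  have "N * (x - a) / (b - a) - real i = N / (b - a) * (x - (a + real i * (b - a) / N))" for i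
    using assms N by (simp add: field_simps)
  moreover have "0 \<le> N / (b - a)" using assms N by simp
  ultimately have "tp n (N * (x - a) / (b - a) - real i) =
      (N / (b - a)) ^ n * tp n (x - (a + real i * (b - a) / N))" for i
    by (metis tp_scale)
  moreover have "{..<n + 2} = {..Suc n}" by auto
  ultimately show ?thesis by (simp add: cell_def N_def mult.assoc del: sum.atMost_Suc of_nat_Suc)
qed

text \<open>The pair of cell j and power i becomes the single index j * (n + 2) + i, and cell number
  m is the extra cell [-1, 0]. The length 1 of that cell explains \<delta> \<le> 1, and its shifts,
  which may be negative but not below -1, explain 1 \<le> U. Undoing the rescaling of a cell
  produces the n-th power of (n + 1) / \<delta>.\<close>

lemma mesh_spline_as_truncated_powers:
  assumes "0 < n" "1 \<le> U" "\<And>j. j \<le> m \<Longrightarrow> 0 \<le> r j \<and> r j \<le> U"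
    and "0 < \<delta>" "\<delta> \<le> 1" and \<delta>: "\<And>j. j < m \<Longrightarrow> \<delta> \<le> r (Suc j) - r j"
    and e0: "\<And>i. i \<le> Suc n \<Longrightarrow> \<bar>e0 i\<bar> \<le> E" and e: "\<And>j i. j < m \<Longrightarrow> i \<le> Suc n \<Longrightarrow> \<bar>e j i\<bar> \<le> E"
  shows "\<exists>t d. (\<forall>i<(m + 1) * (n + 2). \<bar>t i\<bar> \<le> U \<and> \<bar>d i\<bar> \<le> E * (real (Suc n) / \<delta>) ^ n) \<and>
    (\<forall>x. mesh_spline n e0 e r m 0 x = (\<Sum>i<(m + 1) * (n + 2). d i * tp n (x - t i)))"
proof -
  define a where "a j = (if j = m then -1 else r j)" for j
  define b where "b j = (if j = m then 0 else r (Suc j))" for j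
  define e' where "e' j = (if j = m then e0 else e j)" for j
  define t where "t u = (let j = u div (n + 2); i = u mod (n + 2)
      in a j + real i * (b j - a j) / real (Suc n))" for u
  define d where "d u = (let j = u div (n + 2); i = u mod (n + 2)
      in e' j i * (real (Suc n) / (b j - a j)) ^ n)" for u
  have ab: "\<delta> \<le> b j - a j" if "j \<le> m" for j
    using \<delta> assms(5) that by (auto simp: a_def b_def)
  have E: "0 \<le> E" using e0[of 0] by simp
  show ?thesis
  proof (rule exI[of _ t], rule exI[of _ d], intro conjI allI impI)
    fix u assume u: "u < (m + 1) * (n + 2)"
    define j where "j = u div (n + 2)"
    define i where "i = u mod (n + 2)"
    have j: "j \<le> m" using u unfolding j_def by (metis Suc_eq_plus1 less_Suc_eq_le less_mult_imp_div_less)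
    have i: "i \<le> Suc n" unfolding i_def by (metis Suc_eq_plus1 add_2_eq_Suc' less_Suc_eq_le mod_less_divisor zero_less_Suc)
    have ab': "-1 \<le> a j" "b j \<le> U" "\<bar>e' j i\<bar> \<le> E"
      using j i assms(2) assms(3)[of j] assms(3)[of "Suc j"] e0 e by (auto simp: a_def b_def e'_def)
    have "real i * (b j - a j) / real (Suc n) \<le> b j - a j"
      using i ab[OF j] assms(4) by (simp add: divide_le_eq mult_right_mono mult.commute)
    moreover have "0 \<le> real i * (b j - a j) / real (Suc n)"
      using ab[OF j] assms(4) by simp
    ultimately show "\<bar>t u\<bar> \<le> U"
      using ab' assms(2) unfolding t_def Let_def j_def[symmetric] i_def[symmetric] abs_le_iff by auto
    have "real (Suc n) / (b j - a j) \<le> real (Suc n) / \<delta>"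
      using ab[OF j] assms(4) by (intro divide_left_mono) auto
    then have "(real (Suc n) / (b j - a j)) ^ n \<le> (real (Suc n) / \<delta>) ^ n"
      using ab[OF j] assms(4) by (intro power_mono) auto
    then have "\<bar>e' j i * (real (Suc n) / (b j - a j)) ^ n\<bar> \<le> E * (real (Suc n) / \<delta>) ^ n"
      unfolding abs_mult using ab' E ab[OF j] assms(4) by (intro mult_mono) (auto simp: power_abs)
    then show "\<bar>d u\<bar> \<le> E * (real (Suc n) / \<delta>) ^ n"
      by (simp add: d_def Let_def j_def i_def)
  next
    fix x
    have "mesh_spline n e0 e r m 0 x = (\<Sum>j<m + 1. cell n (e' j) (a j) (b j) 0 x)"
      by (simp add: mesh_spline_def e'_def a_def b_def)
    also have "\<dots> = (\<Sum>j<m + 1. \<Sum>u\<in>{j * (n + 2)..<j * (n + 2) + (n + 2)}. d u * tp n (x - t u))"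
    proof (intro sum.cong refl)
      fix j assume j: "j \<in> {..<m + 1}"
      then have "a j < b j" using ab[of j] assms(4) by auto
      then have "cell n (e' j) (a j) (b j) 0 x = (\<Sum>i<n + 2. e' j i * (real (Suc n) / (b j - a j)) ^ n *
          tp n (x - (a j + real i * (b j - a j) / real (Suc n))))"
        by (rule cell_as_truncated_powers)
      also have "\<dots> = (\<Sum>i<n + 2. d (j * (n + 2) + i) * tp n (x - t (j * (n + 2) + i)))"
      proof (intro sum.cong refl)
        fix i assume "i \<in> {..<n + 2}"
        moreover have "(j * k + i) div k = j" "(j * k + i) mod k = i" if "i < k" for k
          using that by auto
        ultimately have "(j * (n + 2) + i) div (n + 2) = j" "(j * (n + 2) + i) mod (n + 2) = i"
          by blast+
        then show "e' j i * (real (Suc n) / (b j - a j)) ^ n * tp n (x - (a j + real i * (b j - a j) / real (Suc n))) =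
            d (j * (n + 2) + i) * tp n (x - t (j * (n + 2) + i))"
          unfolding d_def t_def Let_def by (simp only:)
      qed
      also have "\<dots> = (\<Sum>u\<in>{j * (n + 2)..<j * (n + 2) + (n + 2)}. d u * tp n (x - t u))"
        using sum.shift_bounds_nat_ivl[of "\<lambda>u. d u * tp n (x - t u)" 0 "j * (n + 2)" "n + 2"]
        by (simp only: add_0_right add.commute[of _ "j * (n + 2)"] lessThan_atLeast0)
      finally show "cell n (e' j) (a j) (b j) 0 x =
          (\<Sum>u\<in>{j * (n + 2)..<j * (n + 2) + (n + 2)}. d u * tp n (x - t u))" .
    qed
    also have "\<dots> = (\<Sum>i<(m + 1) * (n + 2). d i * tp n (x - t i))"
      by (rule sum.nat_group)
    finally show "mesh_spline n e0 e r m 0 x = (\<Sum>i<(m + 1) * (n + 2). d i * tp n (x - t i))" .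
  qed
qed

section \<open>Graded meshes\<close>

lemma powr_diff_upper:
  fixes x y :: real
  assumes "1 \<le> \<theta>" "0 \<le> y" "y \<le> x"
  shows "x powr \<theta> - y powr \<theta> \<le> \<theta> * x powr (\<theta> - 1) * (x - y)"
proof (cases "y = 0 \<or> y = x")
  case True
  have "x powr \<theta> = x powr (\<theta> - 1) * x"
    using assms by (cases "x = 0") (auto simp: powr_diff)
  moreover have "x powr (\<theta> - 1) * x \<le> \<theta> * (x powr (\<theta> - 1) * x)"
    using assms mult_right_mono[of 1 \<theta> "x powr (\<theta> - 1) * x"] by simp
  ultimately show ?thesis using True assms by auto
next
  case False
  then have "0 < y" "y < x" using assms by auto
  then have "\<exists>z>y. z < x \<and> x powr \<theta> - y powr \<theta> = (x - y) * (\<theta> * z powr (\<theta> - 1))"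
    by (intro MVT2) (auto intro!: derivative_eq_intros simp: powr_diff)
  then obtain z where z: "y < z" "z < x" "x powr \<theta> - y powr \<theta> = (x - y) * (\<theta> * z powr (\<theta> - 1))"
    by blast
  have "(x - y) * (\<theta> * z powr (\<theta> - 1)) \<le> (x - y) * (\<theta> * x powr (\<theta> - 1))"
    using z assms by (intro mult_left_mono powr_mono2) auto
  then show ?thesis using z by (simp add: mult_ac)
qed

lemma powr_diff_lower:
  fixes a :: real
  assumes "1 \<le> \<theta>" "0 \<le> a"
  shows "1 \<le> (a + 1) powr \<theta> - a powr \<theta>"
proof -
  have e: "x powr \<theta> = x * x powr (\<theta> - 1)" if "0 \<le> x" for x :: real
    using that by (cases "x = 0") (auto simp: powr_diff)
  have "a * a powr (\<theta> - 1) \<le> a * (a + 1) powr (\<theta> - 1)"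
    using assms by (intro mult_left_mono powr_mono2) auto
  moreover have "1 \<le> (a + 1) powr (\<theta> - 1)"
    using assms by (intro ge_one_powr_ge_zero) auto
  moreover have "(a + 1) * (a + 1) powr (\<theta> - 1) = a * (a + 1) powr (\<theta> - 1) + (a + 1) powr (\<theta> - 1)"
    by (simp add: distrib_right)
  ultimately show ?thesis using assms by (simp add: e)
qed

text \<open>The knot nearest to 1 is at distance at most h from 1. Moving it therefore lengthens an
  adjacent cell to at most 2 * h, and, since its neighbour is no nearer to 1, leaves at least half
  of that cell. Large m makes h < 1 and, for U > 1, also h < U - 1, so neither end point of the mesh
  is moved.\<close>

lemma graded_mesh_bounds:
  assumes "1 \<le> U" "1 < \<theta>"
  shows "\<exists>m0\<ge>2. \<forall>m\<ge>m0. \<forall>r. graded_mesh U \<theta> m r \<longrightarrow>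
    r 0 = 0 \<and> r m = U \<and> (\<exists>i\<le>m. r i = 1) \<and>
    (\<forall>j<m. r j < r (Suc j) \<and> r (Suc j) - r j \<le> 2 * \<theta> * U\<^sup>2 * r (Suc j) powr (1 - 1 / \<theta>) / real m \<and>
       real m powr (- \<theta>) / 2 \<le> r (Suc j) - r j)"
proof -
  obtain m0 :: nat where m0: "max 2 (max (\<theta> * U\<^sup>2) (if U = 1 then 0 else \<theta> * U\<^sup>2 / (U - 1))) < real m0"
    using reals_Archimedean2 by blast
  have "r 0 = 0 \<and> r m = U \<and> (\<exists>i\<le>m. r i = 1) \<and>
    (\<forall>j<m. r j < r (Suc j) \<and> r (Suc j) - r j \<le> 2 * \<theta> * U\<^sup>2 * r (Suc j) powr (1 - 1 / \<theta>) / real m \<and>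
       real m powr (- \<theta>) / 2 \<le> r (Suc j) - r j)"
    if m: "m0 \<le> m" and r: "graded_mesh U \<theta> m r" for m r
  proof -
    define h where "h = \<theta> * U\<^sup>2 / real m"
    have m': "2 < real m" "\<theta> * U\<^sup>2 < real m" "U \<noteq> 1 \<Longrightarrow> \<theta> * U\<^sup>2 / (U - 1) < real m"
      using m0 m by (auto split: if_splits)
    have small: "h < 1" using m' by (simp add: h_def divide_less_eq)
    have small': "h < U - 1" if "U \<noteq> 1"
      using m'(3)[OF that] that assms(1) m'(1) by (simp add: h_def field_simps)
    define t where "t j = U * (real j / real m) powr \<theta>" for j
    obtain i where i: "i \<le> m" "\<And>j. j \<le> m \<Longrightarrow> \<bar>t i - 1\<bar> \<le> \<bar>t j - 1\<bar>" and r: "r = t(i := 1)"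
      using r unfolding graded_mesh_def Let_def t_def by blast
    have t0: "t 0 = 0" and tm: "t m = U" using m' by (auto simp: t_def)
    have tU: "t j \<le> U" if "j \<le> m" for j
    proof -
      have "(real j / real m) powr \<theta> \<le> 1 powr \<theta>"
        using that m' assms by (intro powr_mono2) (auto simp: divide_le_eq)
      then show ?thesis using assms by (simp add: t_def mult_left_le)
    qed
    have up: "t (Suc j) - t j \<le> \<theta> * U * (t (Suc j) powr (1 - 1 / \<theta>)) / real m" for j
    proof -
      have pos: "0 < real (Suc j) / real m" using m' by simp
      have "(real (Suc j) / real m) powr \<theta> - (real j / real m) powr \<theta> \<le>
          \<theta> * (real (Suc j) / real m) powr (\<theta> - 1) * (real (Suc j) / real m - real j / real m)"
        using assms m' by (intro powr_diff_upper) (auto simp: divide_right_mono)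
      also have "real (Suc j) / real m - real j / real m = 1 / real m"
        by (simp add: diff_divide_distrib[symmetric])
      finally have "U * ((real (Suc j) / real m) powr \<theta> - (real j / real m) powr \<theta>) \<le>
          U * (\<theta> * (real (Suc j) / real m) powr (\<theta> - 1) * (1 / real m))"
        using assms by (intro mult_left_mono) auto
      moreover have "(real (Suc j) / real m) powr (\<theta> - 1) \<le> t (Suc j) powr (1 - 1 / \<theta>)"
      proof -
        have "\<theta> * (1 - 1 / \<theta>) = \<theta> - 1" using assms by (simp add: right_diff_distrib)
        then have "(real (Suc j) / real m) powr (\<theta> - 1) = ((real (Suc j) / real m) powr \<theta>) powr (1 - 1 / \<theta>)"
          by (simp add: powr_powr)
        also have "\<dots> \<le> t (Suc j) powr (1 - 1 / \<theta>)"
          using assms unfolding t_def by (intro powr_mono2) (auto simp: mult_le_cancel_right1)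
        finally show ?thesis .
      qed
      then have "U * (\<theta> * (real (Suc j) / real m) powr (\<theta> - 1) * (1 / real m)) \<le>
          U * (\<theta> * t (Suc j) powr (1 - 1 / \<theta>) * (1 / real m))"
        using assms by (intro mult_left_mono mult_right_mono) auto
      ultimately show ?thesis by (simp add: t_def right_diff_distrib mult_ac)
    qed
    have low: "real m powr (- \<theta>) \<le> t (Suc j) - t j" for j
    proof -
      have "1 \<le> U * ((real j + 1) powr \<theta> - real j powr \<theta>)"
        using powr_diff_lower[of \<theta> "real j"] assms mult_mono[of 1 U 1 "(real j + 1) powr \<theta> - real j powr \<theta>"] by simp
      then have "real m powr (- \<theta>) * 1 \<le> real m powr (- \<theta>) * (U * ((real j + 1) powr \<theta> - real j powr \<theta>))"
        by (intro mult_left_mono) auto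
      moreover have "(x / real m) powr \<theta> = real m powr (- \<theta>) * x powr \<theta>" if "0 \<le> x" for x
        using that m' by (simp add: powr_divide powr_minus_divide)
      ultimately show ?thesis by (simp add: t_def algebra_simps)
    qed
    have mpos: "0 < real m powr (- \<theta>)" using m' by simp
    have tlt: "t j < t (Suc j)" for j using low[of j] mpos by linarith
    have tnn: "0 \<le> t j" for j using assms by (simp add: t_def)
    have uph: "t (Suc j) - t j \<le> h" if "j < m" for j
    proof -
      have "t (Suc j) powr (1 - 1 / \<theta>) \<le> U powr (1 - 1 / \<theta>)"
        using tU[of "Suc j"] tnn that assms by (intro powr_mono2) auto
      also have "\<dots> \<le> U powr 1"
        using assms by (intro powr_mono) auto
      finally have "\<theta> * U * t (Suc j) powr (1 - 1 / \<theta>) / real m \<le> \<theta> * U * U / real m"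
        using assms by (intro divide_right_mono mult_left_mono) auto
      then show ?thesis using up[of j] by (simp add: h_def power2_eq_square mult.assoc)
    qed
    obtain l where l: "l < m" "t l \<le> 1" "1 \<le> t (Suc l)"
      using mesh_cell_exists[of t 1 m] t0 tm assms m' by auto
    have near: "\<bar>t i - 1\<bar> \<le> h"
      using i(2)[of l] l uph[OF l(1)] by linarith
    have "i \<noteq> 0" using near small t0 by (cases "i = 0") auto
    then obtain i' where i': "i = Suc i'" by (cases i) auto
    have left: "t i' < 1" "1 - t i' \<le> 2 * h" "real m powr (- \<theta>) / 2 \<le> 1 - t i'"
    proof -
      show "t i' < 1" using i(2)[of i'] tlt[of i'] i(1) unfolding i' by linarith
      then show "1 - t i' \<le> 2 * h" "real m powr (- \<theta>) / 2 \<le> 1 - t i'"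
        using near uph[of i'] low[of i'] i(1) i(2)[of i'] unfolding i' by auto
    qed
    have right: "1 < t (Suc i)" "t (Suc i) - 1 \<le> 2 * h" "real m powr (- \<theta>) / 2 \<le> t (Suc i) - 1" if "i < m"
    proof -
      show "1 < t (Suc i)" using i(2)[of "Suc i"] tlt[of i] that by auto
      then show "t (Suc i) - 1 \<le> 2 * h" "real m powr (- \<theta>) / 2 \<le> t (Suc i) - 1"
        using near uph[OF that] low[of i] i(2)[of "Suc i"] that by auto
    qed
    \<comment> \<open>Both cells adjacent to the moved knot have a right end point of at least 1, so
      the uniform bound 2 * h already has the graded form. This is where the constant gets its
      factors 2 and U squared.\<close>
    have big: "2 * h \<le> 2 * \<theta> * U\<^sup>2 * x powr (1 - 1 / \<theta>) / real m" if "1 \<le> x" for x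
    proof -
      have "1 \<le> x powr (1 - 1 / \<theta>)" using that assms by (intro ge_one_powr_ge_zero) auto
      then have "2 * \<theta> * U\<^sup>2 * 1 / real m \<le> 2 * \<theta> * U\<^sup>2 * x powr (1 - 1 / \<theta>) / real m"
        using assms by (intro divide_right_mono mult_left_mono) auto
      then show ?thesis by (simp add: h_def)
    qed
    \<comment> \<open>If the last knot is the one replaced, then U = 1 and the replacement leaves it
      in place.\<close>
    have um: "U = 1" if "i = m" using that near small' tm assms by (cases "U = 1") auto
    show ?thesis
    proof (intro conjI allI impI)
      show "r 0 = 0" using \<open>i \<noteq> 0\<close> t0 by (simp add: r)
      show "r m = U" using um tm by (simp add: r)
      show "\<exists>i\<le>m. r i = 1" using i(1) by (intro exI[of _ i]) (simp add: r)
      fix j assume j: "j < m"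
      consider "j = i'" | "j = i" | "j \<noteq> i" "Suc j \<noteq> i" using i' by auto
      then have *: "r (Suc j) - r j \<le> 2 * \<theta> * U\<^sup>2 * r (Suc j) powr (1 - 1 / \<theta>) / real m \<and>
          real m powr (- \<theta>) / 2 \<le> r (Suc j) - r j"
      proof cases
        case 1
        then show ?thesis using left big[of 1] by (auto simp: r i')
      next
        case 2
        then show ?thesis using right j big[of "t (Suc i)"] by (auto simp: r)
      next
        case 3
        have "\<theta> * U * t (Suc j) powr (1 - 1 / \<theta>) / real m \<le> 2 * \<theta> * U\<^sup>2 * t (Suc j) powr (1 - 1 / \<theta>) / real m"
          using assms mult_mono[of 1 2 U "U\<^sup>2"]
          by (intro divide_right_mono mult_right_mono) (auto simp: power2_eq_square mult_le_cancel_left1)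
        then show ?thesis using 3 up[of j] low[of j] tlt[of j] by (auto simp: r)
      qed
      then show "r (Suc j) - r j \<le> 2 * \<theta> * U\<^sup>2 * r (Suc j) powr (1 - 1 / \<theta>) / real m"
        "real m powr (- \<theta>) / 2 \<le> r (Suc j) - r j" by auto
      show "r j < r (Suc j)" using * mpos by linarith
    qed
  qed
  moreover have "2 \<le> m0" using m0 by auto
  ultimately show ?thesis by blast
qed

section \<open>Entropy of the sieve\<close>

text \<open>The bias of unit \<open>i\<close> in layer \<open>l + 1\<close> is stored at index \<open>(l, i, 0)\<close>, the weight
  \<open>W l i j\<close> at \<open>(l, i, Suc j)\<close>.\<close>

definition param_index :: "nat \<Rightarrow> (nat \<Rightarrow> nat) \<Rightarrow> (nat \<times> nat \<times> nat) set" where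
  "param_index L p = {(l, i, j). l \<le> L \<and> i < p (l + 1) \<and> j \<le> p l}"

definition param_net :: "nat \<Rightarrow> (nat \<Rightarrow> nat) \<Rightarrow> (nat \<times> nat \<times> nat \<Rightarrow> real) \<Rightarrow> real \<Rightarrow> real" where
  "param_net L p \<phi> = network L p (\<lambda>l i j. \<phi> (l, i, Suc j)) (\<lambda>l i. \<phi> (l, i, 0))"

definition params :: "nat \<Rightarrow> (nat \<Rightarrow> nat) \<Rightarrow> nat \<Rightarrow> real \<Rightarrow> (nat \<times> nat \<times> nat \<Rightarrow> real) set" where
  "params L p s B = {\<phi>. card {v \<in> param_index L p. \<phi> v \<noteq> 0} \<le> s \<and> (\<forall>v\<in>param_index L p. \<bar>\<phi> v\<bar> \<le> B)}"

lemma finite_param_index: "finite (param_index L p)"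
proof -
  have "param_index L p \<subseteq> (SIGMA l:{..L}. {..<p (l + 1)} \<times> {..p l})"
    by (auto simp: param_index_def)
  then show ?thesis by (rule finite_subset) auto
qed

lemma card_param_index:
  assumes "\<And>l. l \<le> L + 1 \<Longrightarrow> real (p l) \<le> P"
  shows "real (card (param_index L p)) \<le> real (L + 1) * (P * (P + 1))"
proof -
  have P: "0 \<le> P" using assms[of 0] by simp
  have "param_index L p \<subseteq> (SIGMA l:{..L}. {..<p (l + 1)} \<times> {..p l})"
    by (auto simp: param_index_def)
  then have "card (param_index L p) \<le> card (SIGMA l:{..L}. {..<p (l + 1)} \<times> {..p l})"
    by (intro card_mono) auto
  also have "\<dots> = (\<Sum>l\<le>L. p (l + 1) * (p l + 1))" by simp
  finally have "real (card (param_index L p)) \<le> (\<Sum>l\<le>L. real (p (l + 1)) * (real (p l) + 1))"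
    by (metis (mono_tags, lifting) of_nat_1 of_nat_add of_nat_le_iff of_nat_mult of_nat_sum sum.cong)
  also have "\<dots> \<le> (\<Sum>l\<le>L. P * (P + 1))"
    using assms P by (intro sum_mono mult_mono add_mono) auto
  finally show ?thesis by simp
qed

lemma NN_params:
  assumes "N \<in> NN L p s B"
  shows "\<exists>\<phi>\<in>params L p s B. N = param_net L p \<phi>"
proof -
  obtain W b where N: "N = network L p W b"
    and card: "card {(l, i, j). l \<le> L \<and> i < p (l + 1) \<and> j < p l \<and> W l i j \<noteq> 0} +
       card {(l, i). l \<le> L \<and> i < p (l + 1) \<and> b l i \<noteq> 0} \<le> s"
    and B: "\<And>l i. l \<le> L \<Longrightarrow> i < p (l + 1) \<Longrightarrow> \<bar>b l i\<bar> \<le> B \<and> (\<forall>j<p l. \<bar>W l i j\<bar> \<le> B)"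
    using assms unfolding NN_def by blast
  define \<phi> where "\<phi> = (\<lambda>(l, i, j). case j of 0 \<Rightarrow> b l i | Suc j' \<Rightarrow> W l i j')"
  let ?A = "{(l, i, j). l \<le> L \<and> i < p (l + 1) \<and> j < p l \<and> W l i j \<noteq> 0}"
  let ?C = "{(l, i). l \<le> L \<and> i < p (l + 1) \<and> b l i \<noteq> 0}"
  have fin: "finite ?A" "finite ?C"
  proof -
    have "?A \<subseteq> param_index L p" "(\<lambda>(l, i). (l, i, 0)) ` ?C \<subseteq> param_index L p"
      by (auto simp: param_index_def)
    then show "finite ?A" "finite ?C"
      using finite_param_index by (auto dest!: finite_subset elim!: finite_imageD simp: inj_on_def)
  qed
  have "{v \<in> param_index L p. \<phi> v \<noteq> 0} \<subseteq> (\<lambda>(l, i, j). (l, i, Suc j)) ` ?A \<union> (\<lambda>(l, i). (l, i, 0)) ` ?C"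
  proof
    fix v assume v: "v \<in> {v \<in> param_index L p. \<phi> v \<noteq> 0}"
    obtain l i j where [simp]: "v = (l, i, j)" by (cases v) auto
    show "v \<in> (\<lambda>(l, i, j). (l, i, Suc j)) ` ?A \<union> (\<lambda>(l, i). (l, i, 0)) ` ?C"
    proof (cases j)
      case 0
      then show ?thesis using v by (auto simp: \<phi>_def param_index_def image_iff)
    next
      case (Suc j')
      then have "v = (\<lambda>(l, i, j). (l, i, Suc j)) (l, i, j')" "(l, i, j') \<in> ?A"
        using v by (auto simp: \<phi>_def param_index_def)
      then show ?thesis by blast
    qed
  qed
  then have "card {v \<in> param_index L p. \<phi> v \<noteq> 0} \<le>
      card ((\<lambda>(l, i, j). (l, i, Suc j)) ` ?A \<union> (\<lambda>(l, i). (l, i, 0 :: nat)) ` ?C)"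
    using fin by (intro card_mono) auto
  also have "\<dots> \<le> card ((\<lambda>(l, i, j). (l, i, Suc j)) ` ?A) + card ((\<lambda>(l, i). (l, i, 0 :: nat)) ` ?C)"
    by (rule card_Un_le)
  also have "\<dots> \<le> card ?A + card ?C"
    using fin by (intro add_mono card_image_le)
  finally have "card {v \<in> param_index L p. \<phi> v \<noteq> 0} \<le> s" using card by linarith
  moreover have "\<bar>\<phi> v\<bar> \<le> B" if "v \<in> param_index L p" for v
    using that B by (auto simp: \<phi>_def param_index_def split: nat.split)
  ultimately have "\<phi> \<in> params L p s B" by (simp add: params_def)
  moreover have "N = param_net L p \<phi>"
    unfolding N param_net_def by (simp add: \<phi>_def)
  ultimately show ?thesis by blast
qed

section \<open>Dependence of a network on its parameters\<close>

lemma affine_perturbation: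
  assumes "real n \<le> P" "0 \<le> Y" "1 \<le> Y" "0 \<le> B" "0 \<le> \<delta>" "0 \<le> \<Delta>"
    and w: "\<And>j. j \<le> n \<Longrightarrow> \<bar>w j\<bar> \<le> B \<and> \<bar>w' j\<bar> \<le> B \<and> \<bar>w j - w' j\<bar> \<le> \<delta>"
    and y: "\<And>j. j < n \<Longrightarrow> \<bar>y j\<bar> \<le> Y \<and> \<bar>y' j\<bar> \<le> Y \<and> \<bar>y j - y' j\<bar> \<le> \<Delta>"
  shows "\<bar>(\<Sum>j<n. w (Suc j) * y j) + w 0\<bar> \<le> (P + 1) * (B * Y)"
    and "\<bar>((\<Sum>j<n. w (Suc j) * y j) + w 0) - ((\<Sum>j<n. w' (Suc j) * y' j) + w' 0)\<bar> \<le> (P + 1) * (\<delta> * Y + B * \<Delta>)"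
proof -
  have "\<bar>\<Sum>j<n. w (Suc j) * y j\<bar> \<le> (\<Sum>j<n. B * Y)"
    using w y assms(2,4)
    by (intro order_trans[OF sum_abs] sum_mono) (auto simp: abs_mult intro!: mult_mono)
  also have "\<dots> \<le> P * (B * Y)"
    using assms by (simp add: mult_right_mono)
  finally have "\<bar>\<Sum>j<n. w (Suc j) * y j\<bar> \<le> P * (B * Y)" .
  moreover have "\<bar>w 0\<bar> \<le> B * Y"
    using w[of 0] mult_left_mono[OF assms(3,4)] by simp
  ultimately show "\<bar>(\<Sum>j<n. w (Suc j) * y j) + w 0\<bar> \<le> (P + 1) * (B * Y)"
    by (simp add: distrib_right)
  have "\<bar>w (Suc j) * y j - w' (Suc j) * y' j\<bar> \<le> \<delta> * Y + B * \<Delta>" if "j < n" for j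
  proof -
    have "w (Suc j) * y j - w' (Suc j) * y' j = (w (Suc j) - w' (Suc j)) * y j + w' (Suc j) * (y j - y' j)"
      by (simp add: algebra_simps)
    moreover have "\<bar>(w (Suc j) - w' (Suc j)) * y j\<bar> \<le> \<delta> * Y"
      unfolding abs_mult using w[of "Suc j"] y[of j] that assms by (intro mult_mono) auto
    moreover have "\<bar>w' (Suc j) * (y j - y' j)\<bar> \<le> B * \<Delta>"
      unfolding abs_mult using w[of "Suc j"] y[of j] that assms by (intro mult_mono) auto
    ultimately show ?thesis by linarith
  qed
  then have "(\<Sum>j<n. \<bar>w (Suc j) * y j - w' (Suc j) * y' j\<bar>) \<le> (\<Sum>j<n. \<delta> * Y + B * \<Delta>)"
    by (intro sum_mono) auto
  also have "\<dots> \<le> P * (\<delta> * Y + B * \<Delta>)"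
    using assms by (simp add: mult_right_mono)
  finally have "\<bar>(\<Sum>j<n. w (Suc j) * y j) - (\<Sum>j<n. w' (Suc j) * y' j)\<bar> \<le> P * (\<delta> * Y + B * \<Delta>)"
    unfolding sum_subtractf[symmetric] by (intro order_trans[OF sum_abs])
  moreover have "\<bar>w 0 - w' 0\<bar> \<le> \<delta> * Y + B * \<Delta>"
    using w[of 0] mult_left_mono[OF assms(3,5)] mult_nonneg_nonneg[OF assms(4,6)] by simp
  ultimately show "\<bar>((\<Sum>j<n. w (Suc j) * y j) + w 0) - ((\<Sum>j<n. w' (Suc j) * y' j) + w' 0)\<bar>
      \<le> (P + 1) * (\<delta> * Y + B * \<Delta>)"
    by (simp add: distrib_right)
qed

lemma requ_bound: "\<bar>z\<bar> \<le> Z \<Longrightarrow> \<bar>requ z\<bar> \<le> Z\<^sup>2"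
  by (auto simp: requ_def max_def intro: power2_mono order_trans abs_le_square_iff[THEN iffD1])

lemma requ_diff:
  assumes "\<bar>z\<bar> \<le> Z" "\<bar>z'\<bar> \<le> Z"
  shows "\<bar>requ z - requ z'\<bar> \<le> 2 * Z * \<bar>z - z'\<bar>"
proof -
  have "requ z - requ z' = (max z 0 + max z' 0) * (max z 0 - max z' 0)"
    by (simp add: requ_def power2_eq_square algebra_simps)
  moreover have "\<bar>max z 0 + max z' 0\<bar> * \<bar>max z 0 - max z' 0\<bar> \<le> (2 * Z) * \<bar>z - z'\<bar>"
    using assms by (intro mult_mono) (auto simp: max_def)
  ultimately show ?thesis by (simp add: abs_mult)
qed

text \<open>Invariant for layer l, with X = A to the power 8 ^ l: activations are at most X and
  differ by at most \<delta> * X. An affine map multiplies both by at most A \<le> X; squaring then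
  gives at most the fourth power of X for the size and, with 2 \<le> X, \<delta> times the fifth
  power for the difference. The eighth power covers both with room to spare.\<close>

lemma param_net_perturbation:
  assumes p: "\<And>l. l \<le> L \<Longrightarrow> real (p l) \<le> P" and "1 \<le> B" "1 \<le> U" "0 \<le> \<delta>" "\<bar>x\<bar> \<le> U"
    and A: "A = 4 * (P + 1) * B * U"
    and "p (L + 1) = 1"
    and \<phi>: "\<And>v. v \<in> param_index L p \<Longrightarrow> \<bar>\<phi> v\<bar> \<le> B \<and> \<bar>\<phi>' v\<bar> \<le> B \<and> \<bar>\<phi> v - \<phi>' v\<bar> \<le> \<delta>"
  shows "\<bar>param_net L p \<phi> x - param_net L p \<phi>' x\<bar> \<le> \<delta> * A ^ 8 ^ Suc L"
proof -
  have P: "0 \<le> P" using p[of 0] by simp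
  have "1 * 1 * 1 \<le> (P + 1) * B * U" using P assms by (intro mult_mono) auto
  moreover have "A = 4 * ((P + 1) * B * U)" unfolding A by (simp only: mult.assoc)
  ultimately have A4: "4 \<le> A" by linarith
  have "(P + 1) * B * 1 \<le> (P + 1) * B * U" "(P + 1) * 1 \<le> (P + 1) * B"
    using P assms by (auto intro!: mult_left_mono)
  then have "(P + 1) * B \<le> (P + 1) * B * U" "P + 1 \<le> (P + 1) * B"
    by (simp_all only: mult_1_right)
  moreover have "A / 4 = (P + 1) * B * U"
    using \<open>A = 4 * ((P + 1) * B * U)\<close> by (simp only: nonzero_mult_div_cancel_left)
  \<comment> \<open>The factor 4 in A leaves room for the sum of these two terms, which appears when
    perturbed weights and perturbed inputs are combined.\<close>
  ultimately have PB: "(P + 1) * B \<le> A / 4" and P1: "P + 1 \<le> A / 4"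
    by (auto intro: order_trans)
  have UA: "U \<le> A"
  proof -
    have "1 * U \<le> (4 * (P + 1) * B) * U"
      using P assms mult_mono[of 1 "4 * (P + 1)" 1 B] by (intro mult_right_mono) auto
    then show ?thesis unfolding A by simp
  qed
  define h where "h = hidden p (\<lambda>l i j. \<phi> (l, i, Suc j)) (\<lambda>l i. \<phi> (l, i, 0)) x"
  define h' where "h' = hidden p (\<lambda>l i j. \<phi>' (l, i, Suc j)) (\<lambda>l i. \<phi>' (l, i, 0)) x"
  have aff: "\<bar>(\<Sum>j<p l. \<phi> (l, i, Suc j) * h l j) + \<phi> (l, i, 0)\<bar> \<le> A * A ^ 8 ^ l"
       "\<bar>(\<Sum>j<p l. \<phi>' (l, i, Suc j) * h' l j) + \<phi>' (l, i, 0)\<bar> \<le> A * A ^ 8 ^ l"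
       "\<bar>((\<Sum>j<p l. \<phi> (l, i, Suc j) * h l j) + \<phi> (l, i, 0)) - ((\<Sum>j<p l. \<phi>' (l, i, Suc j) * h' l j) + \<phi>' (l, i, 0))\<bar>
          \<le> \<delta> * (A * A ^ 8 ^ l)"
    if l: "l \<le> L" "i < p (l + 1)" and
       hyp: "\<And>j. j < p l \<Longrightarrow> \<bar>h l j\<bar> \<le> A ^ 8 ^ l \<and> \<bar>h' l j\<bar> \<le> A ^ 8 ^ l \<and> \<bar>h l j - h' l j\<bar> \<le> \<delta> * A ^ 8 ^ l" for l i
  proof -
    define Y where "Y = A ^ 8 ^ l"
    have Y: "1 \<le> Y" unfolding Y_def using A4 by (intro one_le_power) auto
    have w: "\<bar>\<phi> (l, i, j)\<bar> \<le> B \<and> \<bar>\<phi>' (l, i, j)\<bar> \<le> B \<and> \<bar>\<phi> (l, i, j) - \<phi>' (l, i, j)\<bar> \<le> \<delta>" if "j \<le> p l" for j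
      using \<phi>[of "(l, i, j)"] l that by (auto simp: param_index_def)
    have w': "\<bar>\<phi>' (l, i, j)\<bar> \<le> B \<and> \<bar>\<phi> (l, i, j)\<bar> \<le> B \<and> \<bar>\<phi>' (l, i, j) - \<phi> (l, i, j)\<bar> \<le> \<delta>" if "j \<le> p l" for j
      using w[OF that] by (simp add: abs_minus_commute)
    have hyp': "\<bar>h' l j\<bar> \<le> Y \<and> \<bar>h l j\<bar> \<le> Y \<and> \<bar>h' l j - h l j\<bar> \<le> \<delta> * Y" if "j < p l" for j
      using hyp[OF that] by (simp add: abs_minus_commute Y_def)
    have nn: "0 \<le> Y" "0 \<le> B" "0 \<le> \<delta> * Y" using Y assms by auto
    have le: "(P + 1) * (B * Y) \<le> A * Y"
    proof -
      have "(P + 1) * B \<le> A" using PB A4 by linarith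
      then have "(P + 1) * B * Y \<le> A * Y" using nn(1) by (rule mult_right_mono)
      then show ?thesis by (simp only: mult.assoc)
    qed
    note ap = affine_perturbation[OF p[OF l(1)] nn(1) Y nn(2) assms(4) nn(3)]
    show "\<bar>(\<Sum>j<p l. \<phi> (l, i, Suc j) * h l j) + \<phi> (l, i, 0)\<bar> \<le> A * A ^ 8 ^ l"
      using ap(1)[of "\<lambda>j. \<phi> (l, i, j)" "\<lambda>j. \<phi>' (l, i, j)" "h l" "h' l", OF w hyp[folded Y_def]] le by (simp add: Y_def)
    show "\<bar>(\<Sum>j<p l. \<phi>' (l, i, Suc j) * h' l j) + \<phi>' (l, i, 0)\<bar> \<le> A * A ^ 8 ^ l"
      using ap(1)[of "\<lambda>j. \<phi>' (l, i, j)" "\<lambda>j. \<phi> (l, i, j)" "h' l" "h l", OF w' hyp'] le by (simp add: Y_def)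
    have "(P + 1) * (\<delta> * Y + B * (\<delta> * Y)) = \<delta> * Y * ((P + 1) + (P + 1) * B)"
      by (simp add: algebra_simps)
    also have "\<dots> \<le> \<delta> * Y * A"
      using P1 PB A4 nn(3) by (intro mult_left_mono) auto
    finally have "(P + 1) * (\<delta> * Y + B * (\<delta> * Y)) \<le> \<delta> * (A * Y)" by (simp add: mult_ac)
    then show "\<bar>((\<Sum>j<p l. \<phi> (l, i, Suc j) * h l j) + \<phi> (l, i, 0)) - ((\<Sum>j<p l. \<phi>' (l, i, Suc j) * h' l j) + \<phi>' (l, i, 0))\<bar>
          \<le> \<delta> * (A * A ^ 8 ^ l)"
      using ap(2)[of "\<lambda>j. \<phi> (l, i, j)" "\<lambda>j. \<phi>' (l, i, j)" "h l" "h' l", OF w hyp[folded Y_def]] by (simp add: Y_def)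
  qed
  have hyp: "\<bar>h l i\<bar> \<le> A ^ 8 ^ l \<and> \<bar>h' l i\<bar> \<le> A ^ 8 ^ l \<and> \<bar>h l i - h' l i\<bar> \<le> \<delta> * A ^ 8 ^ l"
    if "l \<le> L" "i < p l" for l i
    using that
  proof (induction l arbitrary: i)
    case 0
    then show ?case using UA assms(4,5) A4 by (simp add: h_def h'_def)
  next
    case (Suc l)
    define X where "X = A ^ 8 ^ l"
    have X: "4 \<le> A" "A \<le> X" 
      unfolding X_def using A4 by (auto intro: self_le_power)
    note IH = aff[of l i, OF _ _ Suc.IH, folded X_def]
    have 8: "A ^ 8 ^ Suc l = X ^ 8" by (simp add: X_def power_mult[symmetric] mult.commute)
    define z where "z = (\<Sum>j<p l. \<phi> (l, i, Suc j) * h l j) + \<phi> (l, i, 0)"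
    define z' where "z' = (\<Sum>j<p l. \<phi>' (l, i, Suc j) * h' l j) + \<phi>' (l, i, 0)"
    have z: "\<bar>z\<bar> \<le> A * X" "\<bar>z'\<bar> \<le> A * X" "\<bar>z - z'\<bar> \<le> \<delta> * (A * X)"
      using IH Suc.prems by (auto simp: z_def z'_def)
    have hz: "h (Suc l) i = requ z" "h' (Suc l) i = requ z'"
      by (simp_all add: h_def h'_def z_def z'_def)
    have AX: "A * X \<le> X\<^sup>2" using X by (simp add: power2_eq_square mult_right_mono)
    have X1: "1 \<le> X" using X by linarith
    have "(A * X)\<^sup>2 \<le> (X\<^sup>2)\<^sup>2" using AX X by (intro power_mono) auto
    also have "\<dots> \<le> X ^ 8" using X1 by (simp add: power_mult[symmetric] power_increasing)
    finally have sq: "(A * X)\<^sup>2 \<le> X ^ 8" .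
    have "2 * (A * X) * (\<delta> * (A * X)) = \<delta> * (2 * (A * X)\<^sup>2)" by (simp add: power2_eq_square)
    also have "\<dots> \<le> \<delta> * (X * (X\<^sup>2)\<^sup>2)"
      using AX X assms(4) by (intro mult_left_mono mult_mono power_mono) auto
    also have "X * (X\<^sup>2)\<^sup>2 = X ^ 5" by (simp add: power_mult[symmetric] power_Suc[symmetric] del: power_Suc)
    also have "\<delta> * X ^ 5 \<le> \<delta> * X ^ 8" using X1 assms(4) by (intro mult_left_mono power_increasing) auto
    finally have df: "2 * (A * X) * (\<delta> * (A * X)) \<le> \<delta> * X ^ 8" .
    have "\<bar>requ z - requ z'\<bar> \<le> 2 * (A * X) * \<bar>z - z'\<bar>" using z by (intro requ_diff)
    also have "\<dots> \<le> 2 * (A * X) * (\<delta> * (A * X))" using z X by (intro mult_left_mono) auto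
    finally show ?case
      unfolding hz 8 using requ_bound[OF z(1)] requ_bound[OF z(2)] sq df by linarith
  qed
  have "\<bar>param_net L p \<phi> x - param_net L p \<phi>' x\<bar> \<le> \<delta> * (A * A ^ 8 ^ L)"
    unfolding param_net_def network_def h_def[symmetric] h'_def[symmetric]
    using aff(3)[of L 0] hyp assms(7) by simp
  also have "\<dots> \<le> \<delta> * A ^ 8 ^ Suc L"
  proof -
    have "A * A ^ 8 ^ L = A ^ Suc (8 ^ L)" by simp
    also have "\<dots> \<le> A ^ 8 ^ Suc L"
      using A4 by (intro power_increasing) (auto simp: Suc_le_eq)
    finally show ?thesis using assms(4) by (intro mult_left_mono)
  qed
  finally show ?thesis .
qed

section \<open>Covering by quantised parameters\<close>

text \<open>A network with rounded parameters may leave the sieve, while the centres of a cover must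
  belong to it. So every class of functions with equal key is represented by one of its own
  members.\<close>

lemma covering_number_le_card:
  assumes "finite Q" "key ` F \<subseteq> Q"
    and close: "\<And>f g. f \<in> F \<Longrightarrow> g \<in> F \<Longrightarrow> key f = key g \<Longrightarrow> sup_norm U (\<lambda>r. f r - g r) \<le> ennreal \<epsilon>"
  shows "covering_number U \<epsilon> F \<le> enat (card Q)"
proof -
  define rep where "rep v = (SOME f. f \<in> F \<and> key f = v)" for v
  have rep: "rep (key f) \<in> F \<and> key (rep (key f)) = key f" if "f \<in> F" for f
    unfolding rep_def using that by (intro someI[of "\<lambda>g. g \<in> F \<and> key g = key f" f]) auto
  define C where "C = rep ` key ` F"
  have fin: "finite (key ` F)" using assms by (rule_tac finite_subset)
  have "C \<in> {C. finite C \<and> C \<subseteq> F \<and> (\<forall>f\<in>F. \<exists>c\<in>C. sup_norm U (\<lambda>r. f r - c r) \<le> ennreal \<epsilon>)}"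
    using fin rep close unfolding C_def by fastforce
  then have "covering_number U \<epsilon> F \<le> enat (card C)"
    unfolding covering_number_def by (rule INF_lower)
  also have "card C \<le> card Q"
    unfolding C_def using card_image_le[OF fin] card_mono[OF assms(1,2)] by (rule order_trans)
  finally show ?thesis by simp
qed

text \<open>A function with at most s nonzero values on I is decoded from an association list of
  length exactly s, a shorter list being padded with the true value at v0. Counting lists avoids a
  separate count of the supports.\<close>

lemma card_sparse_functions:
  fixes I :: "'a set" and Z :: "'b :: zero set" and s :: nat
  assumes "finite I" "finite Z" "v0 \<in> I"
  defines "Q \<equiv> {k. (\<forall>v. v \<notin> I \<longrightarrow> k v = 0) \<and> card {v \<in> I. k v \<noteq> 0} \<le> s \<and> (\<forall>v\<in>I. k v \<in> Z)}"
  shows "finite Q" "card Q \<le> (card I * card Z) ^ s"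
proof -
  define dec where "dec xs = (\<lambda>v. case map_of xs v of None \<Rightarrow> 0 | Some z \<Rightarrow> z)" for xs :: "('a \<times> 'b) list"
  define X where "X = {xs. set xs \<subseteq> I \<times> Z \<and> length xs = s}"
  have "Q \<subseteq> dec ` X"
  proof
    fix k assume k: "k \<in> Q"
    define supp where "supp = {v \<in> I. k v \<noteq> 0}"
    obtain vs where vs: "set vs = supp" "distinct vs"
      using finite_distinct_list[of supp] assms(1) by (auto simp: supp_def)
    have len: "length vs \<le> s"
      using k distinct_card[OF vs(2)] by (simp add: Q_def vs(1) supp_def)
    define xs where "xs = map (\<lambda>v. (v, k v)) (vs @ replicate (s - length vs) v0)"
    have "xs \<in> X"
      using vs(1) k assms(3) len by (auto simp: X_def xs_def Q_def supp_def)
    moreover have "dec xs v = k v" for v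
    proof (cases "map_of xs v")
      case None
      moreover have "fst ` set xs = set (vs @ replicate (s - length vs) v0)"
        unfolding xs_def by (simp only: set_map image_comp comp_def fst_conv image_ident)
      ultimately have "v \<notin> supp" using vs(1) by (simp add: map_of_eq_None_iff)
      then show ?thesis using k None by (auto simp: dec_def supp_def Q_def)
    next
      case (Some z)
      then have "(v, z) \<in> set xs" by (rule map_of_SomeD)
      then show ?thesis using Some by (auto simp: dec_def xs_def)
    qed
    then have "k = dec xs" by auto
    ultimately show "k \<in> dec ` X" by blast
  qed
  moreover have X: "finite X" "card X = (card I * card Z) ^ s"
    unfolding X_def using assms by (auto simp: finite_lists_length_eq card_lists_length_eq card_cartesian_product)
  ultimately show "finite Q" "card Q \<le> (card I * card Z) ^ s"
    using finite_surj surj_card_le by (metis finite_surj, metis surj_card_le)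
qed

text \<open>Parameters are rounded down to multiples of \<delta>; this sends 0 to 0, so keys inherit
  the sparsity. The resolution \<delta> is \<epsilon> divided by the amplification \<open>E\<close>
  of the network and the factor \<Lambda> of the outer map. The base T counts positions times
  rounded values.\<close>

lemma covering_number_sieve:
  assumes p: "\<And>l. l \<le> L + 1 \<Longrightarrow> real (p l) \<le> P" and "B' \<le> B" "1 \<le> B" "1 \<le> U" "\<kappa> < K"
    and S: "\<And>y z. \<bar>S y - S z\<bar> \<le> Lt * \<bar>y - z\<bar>" and \<epsilon>: "0 < \<epsilon>" "\<epsilon> \<le> 1"
    and \<Lambda>: "\<Lambda> = (K - \<kappa> + 1) * (\<bar>Lt\<bar> + 1)" and A: "A = 4 * (P + 1) * B * U"
  shows "\<exists>T. covering_number U \<epsilon> (sieve \<beta> U \<kappa> K S H1 L p s B') \<le> enat (T ^ s) \<and>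
    real T \<le> real (L + 1) * (P * (P + 1)) * (7 * B * (\<Lambda> * A ^ 8 ^ Suc L) / \<epsilon>)"
proof (cases "p (L + 1) = 1")
  case False
  then have "sieve \<beta> U \<kappa> K S H1 L p s B' = {}"
    unfolding sieve_def NN_def by simp
  then have "covering_number U \<epsilon> (sieve \<beta> U \<kappa> K S H1 L p s B') \<le> enat (card ({} :: unit set))"
    by (intro covering_number_le_card[where key = "\<lambda>_. ()"]) auto
  moreover have "0 \<le> real (L + 1) * (P * (P + 1)) * (7 * B * (\<Lambda> * A ^ 8 ^ Suc L) / \<epsilon>)"
  proof -
    have "0 \<le> P" using order_trans[OF of_nat_0_le_iff p[of 0]] by simp
    then show ?thesis
      using assms(3-5) \<epsilon> unfolding A \<Lambda> by (intro mult_nonneg_nonneg divide_nonneg_nonneg zero_le_power) auto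
  qed
  ultimately show ?thesis by (intro exI[of _ 0]) (auto intro: order_trans)
next
  case True
  define I where "I = param_index L p"
  have P: "1 \<le> P" using p[of "L + 1"] True by simp
  have "1 * 1 * 1 \<le> (P + 1) * B * U" using P assms by (intro mult_mono) auto
  moreover have "A = 4 * ((P + 1) * B * U)" unfolding A by (simp only: mult.assoc)
  ultimately have A1: "1 \<le> A" by linarith
  define E where "E = A ^ 8 ^ Suc L"
  have E1: "1 \<le> E" unfolding E_def using A1 by (rule one_le_power)
  have \<Lambda>1: "1 \<le> \<Lambda>" unfolding \<Lambda> using assms(5) mult_mono[of 1 "K - \<kappa> + 1" 1 "\<bar>Lt\<bar> + 1"] by simp
  have LE: "1 \<le> \<Lambda> * E" using \<Lambda>1 E1 mult_mono[of 1 \<Lambda> 1 E] by simp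
  define \<delta> where "\<delta> = \<epsilon> / (\<Lambda> * E)"
  have \<delta>: "0 < \<delta>" "\<delta> \<le> 1"
    using \<epsilon> LE by (auto simp: \<delta>_def divide_le_eq)
  define R where "R = \<lceil>B / \<delta>\<rceil> + 1"
  define Z where "Z = {-R..R}"
  define Q where "Q = {k :: nat \<times> nat \<times> nat \<Rightarrow> int. (\<forall>v. v \<notin> I \<longrightarrow> k v = 0) \<and> card {v \<in> I. k v \<noteq> 0} \<le> s \<and> (\<forall>v\<in>I. k v \<in> Z)}"
  have v0: "(L, 0, 0) \<in> I" using True by (simp add: I_def param_index_def)
  have Q: "finite Q" "card Q \<le> (card I * card Z) ^ s"
    unfolding Q_def by (rule card_sparse_functions[OF _ _ v0]; simp add: I_def finite_param_index Z_def)+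
  define F where "F = sieve \<beta> U \<kappa> K S H1 L p s B'"
  have "\<forall>f\<in>F. \<exists>\<phi>. \<phi> \<in> params L p s B \<and> f = (\<lambda>r. \<kappa> + (K - \<kappa>) * S (param_net L p \<phi> (min r U)))"
  proof
    fix f assume "f \<in> F"
    then obtain N where N: "N \<in> NN L p s B'" "f = (\<lambda>r. \<kappa> + (K - \<kappa>) * S (N (min r U)))"
      by (auto simp: F_def sieve_def)
    then obtain \<phi> where \<phi>: "\<phi> \<in> params L p s B'" "N = param_net L p \<phi>" using NN_params by blast
    then have "\<phi> \<in> params L p s B" using assms(2) unfolding params_def by force
    with N \<phi> show "\<exists>\<phi>. \<phi> \<in> params L p s B \<and> f = (\<lambda>r. \<kappa> + (K - \<kappa>) * S (param_net L p \<phi> (min r U)))" by blast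
  qed
  then obtain \<Phi> where \<Phi>: "\<And>f. f \<in> F \<Longrightarrow> \<Phi> f \<in> params L p s B"
      "\<And>f. f \<in> F \<Longrightarrow> f = (\<lambda>r. \<kappa> + (K - \<kappa>) * S (param_net L p (\<Phi> f) (min r U)))"
    unfolding bchoice_iff by blast
  define key where "key f = (\<lambda>v. if v \<in> I then \<lfloor>\<Phi> f v / \<delta>\<rfloor> else 0)" for f
  have bound: "\<bar>\<Phi> f v\<bar> \<le> B" if "f \<in> F" "v \<in> I" for f v
    using \<Phi>(1)[OF that(1)] that(2) by (simp add: params_def I_def)
  have "key f \<in> Q" if f: "f \<in> F" for f
  proof -
    have "{v \<in> I. key f v \<noteq> 0} \<subseteq> {v \<in> I. \<Phi> f v \<noteq> 0}" by (auto simp: key_def)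
    then have "card {v \<in> I. key f v \<noteq> 0} \<le> card {v \<in> I. \<Phi> f v \<noteq> 0}"
      by (intro card_mono) (auto simp: I_def finite_param_index)
    also have "\<dots> \<le> s" using \<Phi>(1)[OF f] by (simp add: params_def I_def)
    finally have "card {v \<in> I. key f v \<noteq> 0} \<le> s" .
    moreover have "key f v \<in> Z" if "v \<in> I" for v
    proof -
      have "- (B / \<delta>) \<le> \<Phi> f v / \<delta>" "\<Phi> f v / \<delta> \<le> B / \<delta>"
        using bound[OF f that] \<delta> divide_right_mono[of "- B" "\<Phi> f v" \<delta>] by (auto simp: divide_right_mono abs_le_iff)
      then show ?thesis using that unfolding Z_def R_def key_def by simp linarith
    qed
    ultimately show ?thesis by (auto simp: Q_def key_def)
  qed
  then have "key ` F \<subseteq> Q" by blast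
  moreover have "sup_norm U (\<lambda>r. f r - g r) \<le> ennreal \<epsilon>" if f: "f \<in> F" and g: "g \<in> F" and eq: "key f = key g" for f g
  proof -
    have close: "\<bar>\<Phi> f v - \<Phi> g v\<bar> \<le> \<delta>" if "v \<in> I" for v
    proof -
      have "\<lfloor>\<Phi> f v / \<delta>\<rfloor> = \<lfloor>\<Phi> g v / \<delta>\<rfloor>" using fun_cong[OF eq, of v] that by (simp add: key_def)
      then have "\<bar>\<Phi> f v / \<delta> - \<Phi> g v / \<delta>\<bar> \<le> 1" by linarith
      then show ?thesis using \<delta> by (simp add: diff_divide_distrib[symmetric])
    qed
    have "\<bar>f r - g r\<bar> \<le> \<epsilon>" if r: "r \<in> {0..U}" for r
    proof -
      define x where "x = param_net L p (\<Phi> f) r"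
      define y where "y = param_net L p (\<Phi> g) r"
      have xy: "\<bar>x - y\<bar> \<le> \<delta> * E"
        unfolding x_def y_def E_def
        by (rule param_net_perturbation[where p = p and P = P and B = B and U = U])
           (use p \<delta> r bound f g close assms(3,4) A True in \<open>auto simp: I_def\<close>)
      have "f r = \<kappa> + (K - \<kappa>) * S x" "g r = \<kappa> + (K - \<kappa>) * S y"
        using fun_cong[OF \<Phi>(2)[OF f], of r] fun_cong[OF \<Phi>(2)[OF g], of r] r by (auto simp: x_def y_def)
      then have "\<bar>f r - g r\<bar> = (K - \<kappa>) * \<bar>S x - S y\<bar>"
        using assms(5) by (simp add: right_diff_distrib[symmetric] abs_mult)
      also have "\<dots> \<le> (K - \<kappa> + 1) * ((\<bar>Lt\<bar> + 1) * (\<delta> * E))"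
      proof (intro mult_mono)
        have "\<bar>S x - S y\<bar> \<le> Lt * \<bar>x - y\<bar>" by (rule S)
        also have "\<dots> \<le> (\<bar>Lt\<bar> + 1) * (\<delta> * E)" using xy by (intro mult_mono) auto
        finally show "\<bar>S x - S y\<bar> \<le> (\<bar>Lt\<bar> + 1) * (\<delta> * E)" .
      qed (use assms(5) in auto)
      also have "\<dots> = \<Lambda> * E * \<delta>" by (simp add: \<Lambda> mult_ac)
      also have "\<dots> = \<epsilon>" using LE by (simp add: \<delta>_def del: mult_eq_0_iff) auto
      finally show ?thesis .
    qed
    then show ?thesis using \<epsilon> by (simp add: sup_norm_le_iff)
  qed
  ultimately have "covering_number U \<epsilon> F \<le> enat (card Q)"
    by (intro covering_number_le_card Q(1))
  also have "\<dots> \<le> enat ((card I * card Z) ^ s)" using Q(2) by simp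
  finally have "covering_number U \<epsilon> F \<le> enat ((card I * card Z) ^ s)" .
  moreover have "real (card I * card Z) \<le> real (L + 1) * (P * (P + 1)) * (7 * B * (\<Lambda> * E) / \<epsilon>)"
  proof -
    have "1 * 1 \<le> B / \<delta>" using \<delta> assms(3) by (simp add: le_divide_eq)
    have "real (card Z) = real_of_int (2 * R + 1)"
      using \<open>1 * 1 \<le> B / \<delta>\<close> unfolding Z_def R_def by simp
    \<comment> \<open>The number of rounded values is 2 * (B / \<delta>) up to an additive 5, which
      B / \<delta> \<ge> 1 absorbs into the factor 7.\<close>
    also have "\<dots> \<le> 2 * (B / \<delta>) + 5" unfolding R_def by simp linarith
    also have "\<dots> \<le> 7 * (B / \<delta>)" using \<open>1 * 1 \<le> B / \<delta>\<close> by simp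
    also have "\<dots> = 7 * B * (\<Lambda> * E) / \<epsilon>" by (simp add: \<delta>_def)
    finally have "real (card Z) \<le> 7 * B * (\<Lambda> * E) / \<epsilon>" .
    moreover have "real (card I) \<le> real (L + 1) * (P * (P + 1))"
      unfolding I_def using p by (rule card_param_index)
    ultimately show ?thesis
      unfolding of_nat_mult using P by (intro mult_mono) auto
  qed
  ultimately show ?thesis unfolding F_def E_def by blast
qed

text \<open>The natural number \<open>2 + c + (1 + c) * 8 ^ Suc L\<close> is the exponent of m in
  the base of the covering bound, and the last summand is the factor free of m. Their sum serves
  both in front of and inside the logarithm. The maximum, the absolute values and the added ones
  make the estimates valid for arbitrary real architecture constants.\<close>

definition entropy_const :: "nat \<Rightarrow> real \<Rightarrow> real \<Rightarrow> real \<Rightarrow> real \<Rightarrow> real \<Rightarrow> real \<Rightarrow> real \<Rightarrow> real" where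
  "entropy_const L Cp Cs CB U \<kappa> K Lt =
    (let P = max 1 Cp; c = nat \<lceil>CB\<rceil>
     in (\<bar>Cs\<bar> + 1) * real (2 + c + (1 + c) * 8 ^ Suc L) +
        14 * real (L + 1) * P\<^sup>2 * ((K - \<kappa> + 1) * (\<bar>Lt\<bar> + 1)) * (8 * P * U) ^ 8 ^ Suc L)"

lemma sieve_entropy:
  fixes \<beta> H1 Cs :: real
  assumes "1 \<le> m" and p: "\<And>j. j \<le> L + 1 \<Longrightarrow> real (p j) \<le> Cp * real m" and B: "B \<le> real m powr CB"
    and "1 \<le> U" "\<kappa> < K" and S: "\<And>y z. \<bar>S y - S z\<bar> \<le> Lt * \<bar>y - z\<bar>" and \<epsilon>: "0 < \<epsilon>" "\<epsilon> \<le> 1"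
  defines "N \<equiv> covering_number U \<epsilon> (sieve \<beta> U \<kappa> K S H1 L p (nat \<lceil>Cs * real m\<rceil>) B)"
    and "C \<equiv> entropy_const L Cp Cs CB U \<kappa> K Lt"
  shows "0 < C" "N \<noteq> \<infinity>" "ln (real (the_enat N)) \<le> C * real m * ln (C * real m / \<epsilon>)"
proof -
  define P where "P = max 1 Cp"
  define c where "c = nat \<lceil>CB\<rceil>"
  define M where "M = real m"
  define E :: nat where "E = 8 ^ Suc L"
  define D where "D = 2 + c + (1 + c) * E"
  define \<Lambda> where "\<Lambda> = (K - \<kappa> + 1) * (\<bar>Lt\<bar> + 1)"
  define c0 where "c0 = 14 * real (L + 1) * P\<^sup>2 * \<Lambda> * (8 * P * U) ^ E"
  define s where "s = nat \<lceil>Cs * M\<rceil>"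
  have M: "1 \<le> M" using assms(1) by (simp add: M_def)
  have P: "1 \<le> P" by (simp add: P_def)
  have \<Lambda>1: "1 \<le> \<Lambda>" unfolding \<Lambda>_def using assms(5) mult_mono[of 1 "K - \<kappa> + 1" 1 "\<bar>Lt\<bar> + 1"] by simp
  have C: "C = (\<bar>Cs\<bar> + 1) * real D + c0"
    unfolding C_def entropy_const_def Let_def P_def c_def D_def E_def c0_def \<Lambda>_def ..
  have PU: "1 \<le> 8 * P * U" using P assms(4) mult_mono[of 1 "8 * P" 1 U] by simp
  have "1 * 1 * 1 * 1 * 1 \<le> 14 * real (L + 1) * P\<^sup>2 * \<Lambda> * (8 * P * U) ^ E"
    using P \<Lambda>1 PU by (intro mult_mono one_le_power) auto
  then have c0: "1 \<le> c0" by (simp add: c0_def)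
  have D: "1 \<le> D" by (simp add: D_def)
  have sD: "0 \<le> (\<bar>Cs\<bar> + 1) * real D" by simp
  show "0 < C" using C c0 sD by linarith
  have pP: "real (p l) \<le> P * M" if "l \<le> L + 1" for l
  proof -
    have "Cp * M \<le> P * M" using M by (intro mult_right_mono) (auto simp: P_def)
    then show ?thesis using p[OF that] by (simp add: M_def)
  qed
  have "real m powr CB \<le> real m powr real c"
    using M unfolding c_def M_def by (intro powr_mono) linarith+
  also have "\<dots> = M ^ c" using M by (simp add: powr_realpow M_def)
  finally have BM: "B \<le> M ^ c" using B by simp
  have Mc: "1 \<le> M ^ c" using M by (rule one_le_power)
  obtain T where T: "N \<le> enat (T ^ s)" "real T \<le> real (L + 1) * (P * M * (P * M + 1)) *
      (7 * M ^ c * (\<Lambda> * (4 * (P * M + 1) * M ^ c * U) ^ 8 ^ Suc L) / \<epsilon>)"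
    using covering_number_sieve[where p = p and L = L and P = "P * M", OF pP BM Mc assms(4,5) S \<epsilon> \<Lambda>_def refl, where \<beta> = \<beta> and ?H1.0 = H1 and s = s]
    unfolding N_def s_def M_def by blast
  have "1 \<le> P * M" using P M mult_mono[of 1 P 1 M] by simp
  then have "P * M + 1 \<le> 2 * P * M" unfolding mult.assoc by linarith
  then have PM: "P * M * (P * M + 1) \<le> P * M * (2 * P * M)" "4 * (P * M + 1) * M ^ c * U \<le> 4 * (2 * P * M) * M ^ c * U"
    using P M Mc assms(4) by (intro mult_left_mono mult_right_mono; simp)+
  have "real T \<le> real (L + 1) * (P * M * (2 * P * M)) * (7 * M ^ c * (\<Lambda> * (4 * (2 * P * M) * M ^ c * U) ^ E) / \<epsilon>)"
    unfolding E_def using P M Mc \<Lambda>1 \<epsilon> assms(4)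
    by (intro order_trans[OF T(2)] mult_mono divide_right_mono mult_left_mono power_mono PM) auto
  also have "\<dots> = c0 * M ^ D / \<epsilon>"
    by (simp add: c0_def D_def power_add add_mult_distrib power_mult_distrib power2_eq_square
        power_mult[symmetric] field_simps)
  \<comment> \<open>As c0 and 1 / \<epsilon> are at least 1, their D-th powers dominate them; the
    whole bound becomes a D-th power and D leaves the logarithm as a factor.\<close>
  also have "\<dots> \<le> (c0 * M / \<epsilon>) ^ D"
  proof -
    have "c0 \<le> c0 ^ D" using c0 D by (simp add: self_le_power)
    moreover have "1 / \<epsilon> \<le> (1 / \<epsilon>) ^ D" using \<epsilon> D by (intro self_le_power) auto
    ultimately have "c0 * (1 / \<epsilon>) * M ^ D \<le> c0 ^ D * (1 / \<epsilon>) ^ D * M ^ D"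
      using c0 \<epsilon> M by (intro mult_mono) auto
    then show ?thesis by (simp add: power_mult_distrib power_divide mult_ac)
  qed
  finally have TD: "real T \<le> (c0 * M / \<epsilon>) ^ D" .
  have base: "1 \<le> c0 * M / \<epsilon>" using c0 M \<epsilon> mult_mono[of 1 c0 1 M] by (simp add: le_divide_eq)
  obtain n where n: "N = enat n" "n \<le> T ^ s"
    using T(1) by (cases N) auto
  show "N \<noteq> \<infinity>" using n by simp
  have C0: "c0 \<le> C" using C sD by linarith
  have baseC: "c0 * M / \<epsilon> \<le> C * M / \<epsilon>"
    using C0 M \<epsilon> by (intro divide_right_mono mult_right_mono) auto
  have lnC: "0 \<le> ln (c0 * M / \<epsilon>)" "ln (c0 * M / \<epsilon>) \<le> ln (C * M / \<epsilon>)"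
    using base baseC by auto
  have sM: "real s \<le> (\<bar>Cs\<bar> + 1) * M"
  proof -
    have "Cs * M \<le> \<bar>Cs\<bar> * M" using M by (intro mult_right_mono) auto
    moreover have "0 \<le> \<bar>Cs\<bar> * M" using M by simp
    ultimately show ?thesis unfolding s_def distrib_right using M by linarith
  qed
  have "ln (real n) \<le> (\<bar>Cs\<bar> + 1) * M * (real D * ln (c0 * M / \<epsilon>))"
  proof (cases "n = 0")
    \<comment> \<open>An empty sieve has covering number 0, and \<open>ln 0\<close> is 0.\<close>
    case True
    then show ?thesis using lnC M by simp
  next
    case False
    have "real n \<le> real T ^ s" using n(2) by (metis of_nat_le_iff of_nat_power)
    also have "\<dots> \<le> ((c0 * M / \<epsilon>) ^ D) ^ s" using TD by (intro power_mono) auto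
    finally have "ln (real n) \<le> ln (((c0 * M / \<epsilon>) ^ D) ^ s)"
      using False by (intro ln_mono) auto
    also have "\<dots> = real s * (real D * ln (c0 * M / \<epsilon>))"
      using base by (simp add: ln_realpow)
    also have "\<dots> \<le> (\<bar>Cs\<bar> + 1) * M * (real D * ln (c0 * M / \<epsilon>))"
      using sM lnC by (intro mult_right_mono) auto
    finally show ?thesis .
  qed
  also have "\<dots> = (\<bar>Cs\<bar> + 1) * real D * (M * ln (c0 * M / \<epsilon>))" by (simp add: mult_ac)
  also have "\<dots> \<le> C * (M * ln (C * M / \<epsilon>))"
    using lnC M sD C c0 by (intro mult_mono) auto
  finally show "ln (real (the_enat N)) \<le> C * real m * ln (C * real m / \<epsilon>)"
    by (simp add: n(1) M_def mult.assoc)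
qed

section \<open>Stationary model\<close>

lemma interval_integral_increment:
  fixes f :: "real \<Rightarrow> real"
  assumes f: "continuous_on {0<..} f" and "0 < a" "a \<le> b"
  shows "(LBINT u=1..b. f u) - (LBINT u=1..a. f u) = (LBINT u:{a..b}. f u)"
proof -
  have i: "interval_lebesgue_integrable lborel (ereal (min 1 a)) (ereal (max 1 b)) f"
    using assms by (intro interval_integrable_continuous_on continuous_on_subset[OF f]) auto
  have "interval_lebesgue_integrable lborel (min (ereal 1) (min (ereal a) (ereal b))) (max (ereal 1) (max (ereal a) (ereal b))) f"
    using i assms by (simp add: min_def max_def split: if_splits)
  from interval_integral_sum[OF this]
  have "(LBINT u=1..a. f u) + (LBINT u=a..b. f u) = (LBINT u=1..b. f u)"
    by (simp add: one_ereal_def)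
  then show ?thesis
    using assms(3) by (simp add: interval_integral_Icc)
qed

section \<open>The function \<open>g_fun\<close>, its inverse and their growth\<close>

context
  fixes \<kappa> K L :: real and \<xi> :: "real \<Rightarrow> real"
  assumes C: "cond_C \<kappa> K L \<xi>"
begin

lemma cond_C_bounds: "0 < \<kappa>" "\<kappa> < K" "0 \<le> r \<Longrightarrow> \<kappa> \<le> \<xi> r" "0 \<le> r \<Longrightarrow> \<xi> r \<le> K"
  using C by (auto simp: cond_C_def)

lemma cond_C_pos: "0 \<le> r \<Longrightarrow> 0 < \<xi> r"
  using cond_C_bounds(1) cond_C_bounds(3)[of r] by linarith

lemma cond_C_continuous: "continuous_on {0..} \<xi>"
proof (rule lipschitz_on_continuous_on)
  show "\<bar>L\<bar>-lipschitz_on {0..} \<xi>"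
  proof (rule lipschitz_onI)
    fix x y :: real assume "x \<in> {0..}" "y \<in> {0..}"
    then have "\<bar>\<xi> x - \<xi> y\<bar> \<le> L * \<bar>x - y\<bar>" using C by (auto simp: cond_C_def)
    also have "\<dots> \<le> \<bar>L\<bar> * \<bar>x - y\<bar>" by (intro mult_right_mono) auto
    finally show "dist (\<xi> x) (\<xi> y) \<le> \<bar>L\<bar> * dist x y" by (simp add: dist_real_def)
  qed simp
qed

lemma continuous_on_g_integrand: "continuous_on {0<..} (\<lambda>u. 1 / (u * \<xi> u))"
proof (intro continuous_intros continuous_on_subset[OF cond_C_continuous] ballI)
  show "u * \<xi> u \<noteq> 0" if "u \<in> {0<..}" for u
    using cond_C_pos[of u] that by simp
qed auto

text \<open>The bounds on \<xi> compare the integrand with multiples of 1 / u, so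
  \<open>g_fun\<close> is a logarithm up to factors between 1 / K and 1 / \<kappa>. All growth and
  decay estimates of the model rest on this.\<close>

lemma g_fun_increment:
  assumes "0 < a" "a \<le> b"
  shows "ln (b / a) / K \<le> g_fun \<xi> b - g_fun \<xi> a" "g_fun \<xi> b - g_fun \<xi> a \<le> ln (b / a) / \<kappa>"
proof -
  have sub: "{a..b} \<subseteq> {0<..}" using assms by auto
  have i: "set_integrable lborel {a..b} (\<lambda>u. 1 / (u * \<xi> u))"
    by (rule borel_integrable_atLeastAtMost'[OF continuous_on_subset[OF continuous_on_g_integrand sub]])
  have iu: "set_integrable lborel {a..b} (\<lambda>u. 1 / u)"
    using assms by (intro borel_integrable_atLeastAtMost' continuous_intros) auto
  have lnint: "(LBINT u:{a..b}. 1 / u) = ln (b / a)"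
  proof -
    have "((\<lambda>u. 1 / u) has_integral (ln b - ln a)) {a..b}"
      using assms by (intro fundamental_theorem_of_calculus)
        (auto intro!: derivative_eq_intros simp: has_real_derivative_iff_has_vector_derivative[symmetric])
    then show ?thesis
      using set_borel_integral_eq_integral(2)[OF iu] assms by (simp add: integral_unique ln_div)
  qed
  have "ln (b / a) / K = (LBINT u:{a..b}. (1 / K) * (1 / u))"
    by (subst set_integral_mult_right) (simp add: lnint)
  also have "\<dots> \<le> (LBINT u:{a..b}. 1 / (u * \<xi> u))"
  proof (rule set_integral_mono[OF set_integrable_mult_right[OF iu] i])
    fix u assume "u \<in> {a..b}"
    then have "0 < u" using assms by auto
    then show "1 / K * (1 / u) \<le> 1 / (u * \<xi> u)"
      using cond_C_bounds(4)[of u] cond_C_pos[of u] by (simp add: frac_le mult_left_mono mult.commute)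
  qed
  also have eq: "(LBINT u:{a..b}. 1 / (u * \<xi> u)) = g_fun \<xi> b - g_fun \<xi> a"
    unfolding g_fun_def using interval_integral_increment[OF continuous_on_g_integrand assms] by simp
  finally show "ln (b / a) / K \<le> g_fun \<xi> b - g_fun \<xi> a" .
  have "g_fun \<xi> b - g_fun \<xi> a = (LBINT u:{a..b}. 1 / (u * \<xi> u))" by (rule eq[symmetric])
  also have "\<dots> \<le> (LBINT u:{a..b}. (1 / \<kappa>) * (1 / u))"
  proof (rule set_integral_mono[OF i set_integrable_mult_right[OF iu]])
    fix u assume "u \<in> {a..b}"
    then have "0 < u" using assms by auto
    then show "1 / (u * \<xi> u) \<le> 1 / \<kappa> * (1 / u)"
      using cond_C_bounds(1) cond_C_bounds(3)[of u] by (simp add: frac_le mult_left_mono mult.commute)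
  qed
  also have "\<dots> = ln (b / a) / \<kappa>"
    by (subst set_integral_mult_right) (simp add: lnint)
  finally show "g_fun \<xi> b - g_fun \<xi> a \<le> ln (b / a) / \<kappa>" .
qed

lemma g_fun_strict_mono:
  assumes "0 < a" "a < b"
  shows "g_fun \<xi> a < g_fun \<xi> b"
proof -
  have "0 < ln (b / a) / K" using assms cond_C_bounds(1,2) by simp
  then show ?thesis using g_fun_increment(1)[of a b] assms by linarith
qed

lemma g_fun_inj: "inj_on (g_fun \<xi>) {0<..}"
proof (rule inj_onI)
  show "x = y" if "x \<in> {0<..}" "y \<in> {0<..}" "g_fun \<xi> x = g_fun \<xi> y" for x y
    using g_fun_strict_mono[of x y] g_fun_strict_mono[of y x] that by (cases x y rule: linorder_cases) auto
qed

lemma g_fun_1: "g_fun \<xi> 1 = 0"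
  by (simp add: g_fun_def one_ereal_def)

lemma g_fun_surj: "g_fun \<xi> ` {0<..} = UNIV"
proof -
  have "y \<in> g_fun \<xi> ` {0<..}" for y
  proof -
    \<comment> \<open>Chosen so that ln b / K = |y|; the values of \<open>g_fun\<close> at 1 / b and
      b then enclose y.\<close>
    define b where "b = exp (K * \<bar>y\<bar>)"
    have b: "1 \<le> b" "0 < b" using cond_C_bounds(1,2) by (auto simp: b_def)
    have Kpos: "0 < K" using cond_C_bounds(1,2) by simp
    have "\<bar>y\<bar> \<le> g_fun \<xi> b"
      using g_fun_increment(1)[of 1 b] b Kpos by (simp add: g_fun_1 b_def)
    moreover have "g_fun \<xi> (1 / b) \<le> - \<bar>y\<bar>"
      using g_fun_increment(1)[of "1 / b" 1] b Kpos by (simp add: g_fun_1 b_def)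
    moreover have "continuous_on {1 / b..b} (g_fun \<xi>)"
    proof (rule lipschitz_on_continuous_on)
      show "(b / \<kappa>)-lipschitz_on {1 / b..b} (g_fun \<xi>)"
      proof (rule lipschitz_on_leI)
        fix x z assume xz: "x \<in> {1 / b..b}" "z \<in> {1 / b..b}" "x \<le> z"
        have x: "0 < x" using xz b by (auto intro: less_le_trans[of 0 "1 / b"])
        have "ln (z / x) \<le> z / x - 1" using x xz by (intro ln_le_minus_one) auto
        also have "\<dots> = (z - x) * (1 / x)" using x by (simp add: field_simps)
        also have "\<dots> \<le> (z - x) * b"
          using xz x b by (intro mult_left_mono) (auto simp: divide_le_eq mult.commute)
        finally have "ln (z / x) / \<kappa> \<le> (z - x) * b / \<kappa>"
          using cond_C_bounds(1) by (intro divide_right_mono) auto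
        moreover have "0 \<le> g_fun \<xi> z - g_fun \<xi> x"
          using g_fun_strict_mono[OF x, of z] xz by (cases "x = z") auto
        ultimately show "dist (g_fun \<xi> x) (g_fun \<xi> z) \<le> b / \<kappa> * dist x z"
          using g_fun_increment(2)[of x z] x xz by (simp add: dist_real_def mult.commute)
      qed (use b cond_C_bounds(1) in auto)
    qed
    moreover have "1 / b \<le> 1" using b by (simp add: divide_le_eq)
    then have "1 / b \<le> b" using b by linarith
    moreover have "- \<bar>y\<bar> \<le> y" "y \<le> \<bar>y\<bar>" by auto
    ultimately have "\<exists>x\<ge>1 / b. x \<le> b \<and> g_fun \<xi> x = y"
      by (intro IVT') (auto intro: order_trans)
    then obtain x where "1 / b \<le> x" "x \<le> b" "g_fun \<xi> x = y" by blast
    moreover from this have "0 < x" using b by (auto intro: less_le_trans[of 0 "1 / b"])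
    ultimately show ?thesis by auto
  qed
  then show ?thesis by auto
qed

lemma g_inv_pos: "0 < g_inv \<xi> y"
  and g_fun_g_inv: "g_fun \<xi> (g_inv \<xi> y) = y"
  using the_inv_into_into[OF g_fun_inj, of y "{0<..}"] f_the_inv_into_f[OF g_fun_inj, of y]
  unfolding g_inv_def g_fun_surj by auto

text \<open>The logarithmic comparison, inverted: a shift of the argument acts as an exponential
  factor with rate between \<kappa> and K.\<close>

lemma g_inv_increment:
  assumes "y \<le> z"
  shows "g_inv \<xi> y * exp (\<kappa> * (z - y)) \<le> g_inv \<xi> z" "g_inv \<xi> z \<le> g_inv \<xi> y * exp (K * (z - y))"
proof -
  have le: "g_inv \<xi> y \<le> g_inv \<xi> z"
    using g_fun_strict_mono[OF g_inv_pos, of z "g_inv \<xi> y"] assms unfolding g_fun_g_inv by linarith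
  have p: "0 < g_inv \<xi> y" "0 < g_inv \<xi> z" by (rule g_inv_pos)+
  note inc = g_fun_increment[OF g_inv_pos le, unfolded g_fun_g_inv]
  have "\<kappa> * (z - y) \<le> ln (g_inv \<xi> z / g_inv \<xi> y)"
    using inc(2) cond_C_bounds(1) by (simp add: le_divide_eq mult.commute)
  then have "exp (\<kappa> * (z - y)) \<le> g_inv \<xi> z / g_inv \<xi> y"
    using p by (subst (asm) exp_le_cancel_iff[symmetric]) simp
  then show "g_inv \<xi> y * exp (\<kappa> * (z - y)) \<le> g_inv \<xi> z"
    using p by (simp add: le_divide_eq mult.commute)
  have "ln (g_inv \<xi> z / g_inv \<xi> y) \<le> K * (z - y)"
    using inc(1) cond_C_bounds(1,2) by (simp add: divide_le_eq mult.commute)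
  then have "g_inv \<xi> z / g_inv \<xi> y \<le> exp (K * (z - y))"
    using p by (subst (asm) exp_le_cancel_iff[symmetric]) simp
  then show "g_inv \<xi> z \<le> g_inv \<xi> y * exp (K * (z - y))"
    using p by (simp add: divide_le_eq mult.commute)
qed

lemma g_inv_strict_mono: "y < z \<Longrightarrow> g_inv \<xi> y < g_inv \<xi> z"
  using g_fun_strict_mono[OF g_inv_pos, of z "g_inv \<xi> y"] g_fun_g_inv
  by (metis linorder_less_linear order_less_asym)

lemma g_inv_mono: "y \<le> z \<Longrightarrow> g_inv \<xi> y \<le> g_inv \<xi> z"
  using g_inv_strict_mono[of y z] by (cases "y = z") auto

lemma g_inv_measurable: "g_inv \<xi> \<in> borel_measurable borel"
  by (intro borel_measurable_mono monoI g_inv_mono)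

end

text \<open>To be applied to the logarithm of the total mass as a function of \<mu>.\<close>

lemma bi_lipschitz_zero:
  fixes f :: "real \<Rightarrow> real"
  assumes "0 < \<kappa>" and f: "\<And>x y. x \<le> y \<Longrightarrow> \<kappa> * (y - x) \<le> f y - f x \<and> f y - f x \<le> K * (y - x)"
  shows "\<exists>!x. f x = 0"
proof -
  have "\<bar>K\<bar>-lipschitz_on UNIV f"
  proof (rule lipschitz_on_leI)
    fix x y :: real assume "x \<le> y"
    moreover have "K * (y - x) \<le> \<bar>K\<bar> * (y - x)" using \<open>x \<le> y\<close> by (intro mult_right_mono) auto
    moreover have "0 \<le> \<kappa> * (y - x)" using \<open>x \<le> y\<close> assms(1) by simp
    ultimately show "dist (f x) (f y) \<le> \<bar>K\<bar> * dist x y"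
      using f[of x y] by (simp add: dist_real_def)
  qed simp
  then have cont: "continuous_on A f" for A
    by (rule continuous_on_subset[OF lipschitz_on_continuous_on]) simp
  define b where "b = \<bar>f 0\<bar> / \<kappa>"
  have b: "0 \<le> b" "\<kappa> * b = \<bar>f 0\<bar>" using assms(1) by (auto simp: b_def)
  have "f (- b) \<le> 0" "0 \<le> f b" using f[of "- b" 0] f[of 0 b] b by auto
  then obtain x where "f x = 0" using IVT'[of f "- b" 0 b] b cont by auto
  moreover have "x = y" if "f x = 0" "f y = 0" for x y
  proof (rule ccontr)
    assume "x \<noteq> y"
    then have "0 < \<kappa> * \<bar>x - y\<bar>" using assms(1) by simp
    moreover have "\<kappa> * \<bar>x - y\<bar> \<le> 0" using f[of x y] f[of y x] that by (cases "x \<le> y") auto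
    ultimately show False by simp
  qed
  ultimately show ?thesis by blast
qed

section \<open>Normalisation, decay of the profile and integrals over levels\<close>

lemma lebesgue_measurable: "f \<in> borel_measurable borel \<Longrightarrow> f \<in> borel_measurable lebesgue"
  by (intro measurable_completion) simp

lemma lebesgue_ident: "(\<lambda>x. x :: real) \<in> borel_measurable lebesgue"
  by (rule lebesgue_measurable) simp

lemma space_leb: "space (leb d) = euc d"
  by (simp add: leb_def euc_def space_PiM)

lemma emeasure_leb_nonzero: "emeasure (leb d) (space (leb d)) \<noteq> 0"
proof -
  interpret product_sigma_finite "\<lambda>_ :: nat. lborel :: real measure"
    by (simp add: product_sigma_finite_def sigma_finite_lborel)
  have "emeasure (leb d) (PiE {..<d} (\<lambda>_. {0..1})) = (\<Prod>i<d. emeasure lborel {0..1 :: real})"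
    unfolding leb_def by (rule emeasure_PiM) auto
  then have "emeasure (leb d) (PiE {..<d} (\<lambda>_. {0..1})) = 1" by simp
  moreover have "emeasure (leb d) (PiE {..<d} (\<lambda>_. {0..1})) \<le> emeasure (leb d) (space (leb d))"
    by (rule emeasure_space)
  ultimately show ?thesis by auto
qed

lemma nn_integral_leb_pos:
  assumes "f \<in> borel_measurable (leb d)" "\<And>x. 0 < f x"
  shows "(\<integral>\<^sup>+ x. f x \<partial>leb d) \<noteq> 0"
proof
  assume "(\<integral>\<^sup>+ x. f x \<partial>leb d) = 0"
  then have "AE x in leb d. f x = 0" using assms(1) by (simp add: nn_integral_0_iff_AE)
  then have "AE x in leb d. False" by eventually_elim (use assms(2) in \<open>simp add: less_le\<close>)
  then show False using emeasure_leb_nonzero[of d] by (simp add: AE_iff_measurable[OF sets.top])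
qed

context
  fixes d :: nat and V :: "(nat \<Rightarrow> real) \<Rightarrow> real" and vs \<kappa> K L :: real and \<xi> :: "real \<Rightarrow> real"
  assumes P: "cond_P d V vs" and C: "cond_C \<kappa> K L \<xi>"
begin

lemma level_set_integral:
  "\<phi> \<in> borel_measurable borel \<Longrightarrow>
     (\<integral>\<^sup>+ x. \<phi> (V x) \<partial>leb d) = (\<integral>\<^sup>+ s\<in>{vs<..}. \<phi> s * m_V d V s \<partial>lebesgue)"
  using P unfolding cond_P_def by blast

lemma exp_V_integrable: "0 < a \<Longrightarrow> integrable (leb d) (\<lambda>x. exp (- a * V x))"
  using P unfolding cond_P_def by blast

lemma V_ge_min: "x \<in> space (leb d) \<Longrightarrow> vs \<le> V x"
  using P unfolding cond_P_def space_leb by blast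

lemma m_V_measurable: "m_V d V \<in> borel_measurable lebesgue"
  using P unfolding cond_P_def by blast

text \<open>Integrability of exp (- V) includes measurability, and the logarithm carries it over to
  V.\<close>

lemma V_measurable: "V \<in> borel_measurable (leb d)"
proof -
  have "(\<lambda>x. exp (- 1 * V x)) \<in> borel_measurable (leb d)"
    by (rule borel_measurable_integrable[OF exp_V_integrable]) simp
  then have "(\<lambda>x. - ln (exp (- 1 * V x))) \<in> borel_measurable (leb d)" by measurable
  then show ?thesis by simp
qed

lemma total_mass_growth:
  defines "\<Phi> \<equiv> \<lambda>\<mu>. \<integral>\<^sup>+ x. ennreal (g_inv \<xi> (\<mu> - V x)) \<partial>leb d"
  shows "\<Phi> \<mu> < \<infinity>" "\<Phi> \<mu> \<noteq> 0"
    "\<mu> \<le> \<mu>' \<Longrightarrow> \<Phi> \<mu> * ennreal (exp (\<kappa> * (\<mu>' - \<mu>))) \<le> \<Phi> \<mu>'"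
    "\<mu> \<le> \<mu>' \<Longrightarrow> \<Phi> \<mu>' \<le> \<Phi> \<mu> * ennreal (exp (K * (\<mu>' - \<mu>)))"
proof -
  note V_measurable[measurable] g_inv_measurable[OF C, measurable]
  have g0: "g_inv \<xi> 0 = 1"
    using g_fun_1[OF C] the_inv_into_f_f[OF g_fun_inj[OF C], of 1] by (simp add: g_inv_def)
  \<comment> \<open>\<open>g_inv\<close> is 1 at 0, so the first exponential dominates for y \<ge> 0
    and the second for y < 0. Finiteness of the mass follows from the integrability of exp (- a * V)
    for a = K and a = \<kappa>.\<close>
  have gb: "g_inv \<xi> y \<le> exp (K * y) + exp (\<kappa> * y)" for y
  proof (cases "0 \<le> y")
    case True
    then show ?thesis using g_inv_increment(2)[OF C True] g0 by (simp add: add_increasing2)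
  next
    case False
    then have "g_inv \<xi> y * exp (\<kappa> * (0 - y)) \<le> 1" using g_inv_increment(1)[OF C, of y 0] g0 by simp
    then have "g_inv \<xi> y \<le> exp (\<kappa> * y)" by (simp add: exp_minus field_simps)
    then show ?thesis by (simp add: add_increasing)
  qed
  have "integrable (leb d) (\<lambda>x. exp (K * \<mu>) * exp (- K * V x) + exp (\<kappa> * \<mu>) * exp (- \<kappa> * V x))"
    using cond_C_bounds(1,2)[OF C] by (intro Bochner_Integration.integrable_add integrable_mult_right exp_V_integrable) auto
  then have "(\<integral>\<^sup>+ x. ennreal (exp (K * \<mu>) * exp (- K * V x) + exp (\<kappa> * \<mu>) * exp (- \<kappa> * V x)) \<partial>leb d) < \<infinity>"
    by (subst nn_integral_eq_integral) auto
  moreover have "\<Phi> \<mu> \<le> (\<integral>\<^sup>+ x. ennreal (exp (K * \<mu>) * exp (- K * V x) + exp (\<kappa> * \<mu>) * exp (- \<kappa> * V x)) \<partial>leb d)"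
    unfolding \<Phi>_def
  proof (intro nn_integral_mono ennreal_leI)
    show "g_inv \<xi> (\<mu> - V x) \<le> exp (K * \<mu>) * exp (- K * V x) + exp (\<kappa> * \<mu>) * exp (- \<kappa> * V x)" for x
      using gb[of "\<mu> - V x"] by (simp add: exp_add[symmetric] right_diff_distrib)
  qed
  ultimately show "\<Phi> \<mu> < \<infinity>" by (rule order_le_less_trans[rotated])
  show "\<Phi> \<mu> \<noteq> 0"
    unfolding \<Phi>_def by (intro nn_integral_leb_pos) (auto simp: g_inv_pos[OF C])
  have inc: "g_inv \<xi> (\<mu> - V x) * exp (\<kappa> * (\<mu>' - \<mu>)) \<le> g_inv \<xi> (\<mu>' - V x)"
    "g_inv \<xi> (\<mu>' - V x) \<le> g_inv \<xi> (\<mu> - V x) * exp (K * (\<mu>' - \<mu>))" if "\<mu> \<le> \<mu>'" for x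
    using g_inv_increment[OF C, of "\<mu> - V x" "\<mu>' - V x"] that by auto
  show "\<Phi> \<mu> * ennreal (exp (\<kappa> * (\<mu>' - \<mu>))) \<le> \<Phi> \<mu>'" if "\<mu> \<le> \<mu>'"
    unfolding \<Phi>_def using inc(1)[OF that]
    by (subst nn_integral_multc[symmetric])
       (auto simp: ennreal_mult''[symmetric] intro!: nn_integral_mono ennreal_leI)
  show "\<Phi> \<mu>' \<le> \<Phi> \<mu> * ennreal (exp (K * (\<mu>' - \<mu>)))" if "\<mu> \<le> \<mu>'"
    unfolding \<Phi>_def using inc(2)[OF that]
    by (subst nn_integral_multc[symmetric])
       (auto simp: ennreal_mult''[symmetric] intro!: nn_integral_mono ennreal_leI)
qed

lemma total_mass_level_sets: "(\<integral>\<^sup>+ x. ennreal (g_inv \<xi> (\<mu> - V x)) \<partial>leb d) =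
    (\<integral>\<^sup>+ s\<in>{vs<..}. ennreal (g_inv \<xi> (\<mu> - s)) * m_V d V s \<partial>lebesgue)"
proof -
  note g_inv_measurable[OF C, measurable]
  show ?thesis by (rule level_set_integral) measurable
qed

text \<open>The logarithm of the total mass grows in \<mu> with slope between \<kappa> and K and so
  has exactly one zero. This gives the definite description in \<open>mu_const\<close> its
  meaning.\<close>

lemma q_fun_mass: "(\<integral>\<^sup>+ s\<in>{vs<..}. ennreal (q_fun d V vs \<xi> s) * m_V d V s \<partial>lebesgue) = 1"
proof -
  define \<Phi> where "\<Phi> \<mu> = (\<integral>\<^sup>+ x. ennreal (g_inv \<xi> (\<mu> - V x)) \<partial>leb d)" for \<mu>
  define f where "f \<mu> = ln (enn2real (\<Phi> \<mu>))" for \<mu>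
  note mp = total_mass_growth[folded \<Phi>_def]
  have \<Phi>: "\<Phi> \<mu> = ennreal (exp (f \<mu>))" for \<mu>
    using mp(1,2)[of \<mu>] by (cases "\<Phi> \<mu>") (auto simp: f_def)
  have "\<exists>!\<mu>. f \<mu> = 0"
  proof (rule bi_lipschitz_zero[OF cond_C_bounds(1)[OF C]])
    show "\<kappa> * (y - x) \<le> f y - f x \<and> f y - f x \<le> K * (y - x)" if "x \<le> y" for x y
      using mp(3,4)[OF that] unfolding \<Phi> by (simp add: ennreal_mult[symmetric] exp_add[symmetric])
  qed
  then have "\<exists>!\<mu>. \<Phi> \<mu> = 1" unfolding \<Phi> by simp
  then show ?thesis
    unfolding q_fun_def mu_const_def \<Phi>_def total_mass_level_sets by (rule theI')
qed

lemma q_fun_pos: "0 < q_fun d V vs \<xi> s"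
  unfolding q_fun_def by (rule g_inv_pos[OF C])

lemma q_fun_decay:
  assumes "s \<le> t"
  shows "q_fun d V vs \<xi> t * exp (\<kappa> * (t - s)) \<le> q_fun d V vs \<xi> s"
    and "q_fun d V vs \<xi> s \<le> q_fun d V vs \<xi> t * exp (K * (t - s))"
  unfolding q_fun_def
  using g_inv_increment[OF C, of "mu_const d V vs \<xi> - t" "mu_const d V vs \<xi> - s"] assms by auto

lemma q_fun_strict_antimono: "s < t \<Longrightarrow> q_fun d V vs \<xi> t < q_fun d V vs \<xi> s"
  unfolding q_fun_def by (intro g_inv_strict_mono[OF C]) simp

lemma q_fun_measurable: "q_fun d V vs \<xi> \<in> borel_measurable borel"
proof -
  note g_inv_measurable[OF C, measurable]
  show ?thesis unfolding q_fun_def[abs_def] by measurable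
qed

lemma q_fun_surj: "0 < r \<Longrightarrow> \<exists>s. q_fun d V vs \<xi> s = r"
  using the_inv_into_f_f[OF g_fun_inj[OF C], of r]
  by (intro exI[of _ "mu_const d V vs \<xi> - g_fun \<xi> r"]) (simp add: q_fun_def g_inv_def)

lemma nn_integral_nu_law:
  assumes "f \<in> borel_measurable borel"
  shows "(\<integral>\<^sup>+ r. f r \<partial>nu_law d V vs \<xi>) =
    (\<integral>\<^sup>+ s\<in>{vs<..}. ennreal (q_fun d V vs \<xi> s) * f (q_fun d V vs \<xi> s) * m_V d V s \<partial>lebesgue)"
proof -
  note V_measurable[measurable] q_fun_measurable[measurable] assms[measurable]
  have [measurable]: "pi_fun d V vs \<xi> \<in> borel_measurable (leb d)"
    unfolding pi_fun_def[abs_def] by measurable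
  have "(\<integral>\<^sup>+ r. f r \<partial>nu_law d V vs \<xi>) =
      (\<integral>\<^sup>+ x. ennreal (pi_fun d V vs \<xi> x) * f (pi_fun d V vs \<xi> x) \<partial>leb d)"
    unfolding nu_law_def by (subst nn_integral_distr) (simp_all add: nn_integral_density)
  also have "\<dots> = (\<integral>\<^sup>+ x. (\<lambda>s. ennreal (q_fun d V vs \<xi> s) * f (q_fun d V vs \<xi> s)) (V x) \<partial>leb d)"
    by (simp add: pi_fun_def)
  also have "\<dots> = (\<integral>\<^sup>+ s\<in>{vs<..}. ennreal (q_fun d V vs \<xi> s) * f (q_fun d V vs \<xi> s) * m_V d V s \<partial>lebesgue)"
    by (rule level_set_integral) measurable
  finally show ?thesis .
qed

text \<open>From its value at the minimum the profile falls at most by the factor exp (- K * (V x -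
  vs)); integrated over the space, the mass 1 is at least \<open>q vs\<close> times
  \<open>Z_const\<close>. Hence the densities stay in [0, U], where the approximation is
  controlled.\<close>

lemma q_fun_le_a_plus:
  assumes "vs \<le> s"
  shows "q_fun d V vs \<xi> s \<le> a_plus d V vs K"
proof -
  note V_measurable[measurable] q_fun_measurable[measurable]
  let ?q = "q_fun d V vs \<xi>"
  have K: "0 < K" using cond_C_bounds(1,2)[OF C] by simp
  have "integrable (leb d) (\<lambda>x. exp (K * vs) * exp (- K * V x))"
    using K by (intro integrable_mult_right exp_V_integrable)
  then have int: "integrable (leb d) (\<lambda>x. exp (- K * (V x - vs)))"
    by (simp add: exp_add[symmetric] algebra_simps)
  have Z: "ennreal (Z_const d V vs K) = (\<integral>\<^sup>+ x. ennreal (exp (- K * (V x - vs))) \<partial>leb d)"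
    unfolding Z_const_def using int by (subst nn_integral_eq_integral) auto
  have "ennreal (Z_const d V vs K) \<noteq> 0"
    unfolding Z by (intro nn_integral_leb_pos) auto
  then have Zpos: "0 < Z_const d V vs K" by (simp add: ennreal_eq_0_iff)
  have "ennreal (?q vs * Z_const d V vs K) = ennreal (?q vs) * (\<integral>\<^sup>+ x. ennreal (exp (- K * (V x - vs))) \<partial>leb d)"
    unfolding Z[symmetric] using q_fun_pos[of vs] by (simp add: ennreal_mult')
  also have "\<dots> = (\<integral>\<^sup>+ x. ennreal (?q vs * exp (- K * (V x - vs))) \<partial>leb d)"
    using q_fun_pos[of vs] by (subst nn_integral_cmult[symmetric]) (auto simp: ennreal_mult')
  also have "\<dots> \<le> (\<integral>\<^sup>+ x. ennreal (?q (V x)) \<partial>leb d)"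
  proof (intro nn_integral_mono ennreal_leI)
    fix x assume "x \<in> space (leb d)"
    then have "?q vs \<le> ?q (V x) * exp (K * (V x - vs))" by (intro q_fun_decay V_ge_min)
    then have "?q vs * exp (- K * (V x - vs)) \<le> ?q (V x) * exp (K * (V x - vs)) * exp (- K * (V x - vs))"
      by (rule mult_right_mono) simp
    also have "\<dots> = ?q (V x)" by (simp add: mult.assoc exp_add[symmetric])
    finally show "?q vs * exp (- K * (V x - vs)) \<le> ?q (V x)" .
  qed
  also have "\<dots> = 1"
    using q_fun_mass level_set_integral[of "\<lambda>s. ennreal (?q s)"] by simp
  finally have "?q vs * Z_const d V vs K \<le> 1" by simp
  then have "?q vs \<le> a_plus d V vs K"
    using Zpos by (simp add: a_plus_def inverse_eq_divide le_divide_eq)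
  moreover have "?q s \<le> ?q vs"
    using q_fun_strict_antimono[of vs s] assms by (cases "s = vs") auto
  ultimately show ?thesis by simp
qed

text \<open>Translates the bound on the density at r = q(s) back to the level s; the factor K undoes
  the division by \<xi>, and the absolute value keeps the constant nonnegative.\<close>

lemma m_V_log_bound:
  assumes nu: "nu_log_bound d V vs \<xi> r0 \<alpha> C\<^sub>\<nu>" and "vs < s" "q_fun d V vs \<xi> s \<le> r0"
  shows "m_V d V s \<le> ennreal (K * \<bar>C\<^sub>\<nu>\<bar> * (1 + ln (r0 / q_fun d V vs \<xi> s)) powr \<alpha>)"
proof -
  let ?q = "q_fun d V vs \<xi>"
  have inj: "inj_on ?q {vs..}"
    by (rule inj_onI) (metis linorder_less_linear order_less_irrefl q_fun_strict_antimono)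
  have "nu_density d V vs \<xi> (?q s) \<le> ennreal (C\<^sub>\<nu> * (1 + ln (r0 / ?q s)) powr \<alpha>)"
    using nu assms q_fun_pos[of s] q_fun_strict_antimono[of vs s]
    unfolding nu_log_bound_def a_max_def by blast
  also have "\<dots> \<le> ennreal (\<bar>C\<^sub>\<nu>\<bar> * (1 + ln (r0 / ?q s)) powr \<alpha>)"
    by (intro ennreal_leI mult_right_mono) auto
  finally have "m_V d V s / ennreal (\<xi> (?q s)) \<le> ennreal (\<bar>C\<^sub>\<nu>\<bar> * (1 + ln (r0 / ?q s)) powr \<alpha>)"
    using the_inv_into_f_f[OF inj, of s] assms(2) by (simp add: nu_density_def)
  then have "m_V d V s / ennreal (\<xi> (?q s)) * ennreal (\<xi> (?q s)) \<le>
      ennreal (\<bar>C\<^sub>\<nu>\<bar> * (1 + ln (r0 / ?q s)) powr \<alpha>) * ennreal (\<xi> (?q s))"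
    by (rule mult_right_mono) simp
  moreover have x: "0 < \<xi> (?q s)" "\<xi> (?q s) \<le> K"
    using cond_C_pos[OF C, of "?q s"] cond_C_bounds(4)[OF C, of "?q s"] q_fun_pos[of s] by auto
  then have "m_V d V s / ennreal (\<xi> (?q s)) * ennreal (\<xi> (?q s)) = m_V d V s"
    by (simp add: ennreal_divide_times ennreal_times_divide mult_divide_eq_ennreal)
  ultimately have "m_V d V s \<le> ennreal (\<bar>C\<^sub>\<nu>\<bar> * (1 + ln (r0 / ?q s)) powr \<alpha>) * ennreal (\<xi> (?q s))" by simp
  also have "\<dots> \<le> ennreal (\<bar>C\<^sub>\<nu>\<bar> * (1 + ln (r0 / ?q s)) powr \<alpha>) * ennreal K"
    using x by (intro mult_left_mono ennreal_leI) auto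
  also have "\<dots> = ennreal (K * \<bar>C\<^sub>\<nu>\<bar> * (1 + ln (r0 / ?q s)) powr \<alpha>)"
    using x by (simp add: ennreal_mult[symmetric] mult_ac)
  finally show ?thesis .
qed

text \<open>The product with the positive profile has integral 1, so \<open>m_V\<close> is infinite
  at most on a null set, and passing to \<open>enn2real\<close> in the operator loses
  nothing.\<close>

lemma m_V_finite: "AE s in lebesgue. vs < s \<longrightarrow> m_V d V s \<noteq> \<infinity>"
proof -
  note m_V_measurable[measurable] lebesgue_measurable[OF q_fun_measurable, measurable]
  note lebesgue_ident[measurable]
  have "AE s in lebesgue. ennreal (q_fun d V vs \<xi> s) * m_V d V s * indicator {vs<..} s \<noteq> \<infinity>"
    using q_fun_mass by (intro nn_integral_PInf_AE) (auto)
  then show ?thesis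
  proof eventually_elim
    case (elim s)
    then show ?case using q_fun_pos[of s] by (auto simp: ennreal_top_mult ennreal_mult_eq_top_iff)
  qed
qed

end

section \<open>Forward operator\<close>

text \<open>The exponent \<epsilon> / (\<alpha> + 1), in place of \<epsilon> / \<alpha>, keeps the
  case \<alpha> = 0 regular.\<close>

lemma one_plus_ln_powr_bound:
  fixes x :: real
  assumes "0 \<le> \<alpha>" "0 < \<epsilon>" "1 \<le> x"
  shows "(1 + ln x) powr \<alpha> \<le> (1 + (\<alpha> + 1) / \<epsilon>) powr \<alpha> * x powr \<epsilon>"
proof -
  define a where "a = \<epsilon> / (\<alpha> + 1)"
  have a: "0 < a" "a * \<alpha> \<le> \<epsilon>" using assms by (auto simp: a_def divide_simps)
  have "ln x \<le> x powr a / a" using assms a by (intro ln_powr_bound) auto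
  moreover have "1 \<le> x powr a" using assms a by (intro ge_one_powr_ge_zero) auto
  ultimately have "1 + ln x \<le> (1 + 1 / a) * x powr a" by (simp add: distrib_right)
  then have "(1 + ln x) powr \<alpha> \<le> ((1 + 1 / a) * x powr a) powr \<alpha>"
    using assms by (intro powr_mono2) auto
  also have "\<dots> = (1 + 1 / a) powr \<alpha> * x powr (a * \<alpha>)"
    using a by (simp add: powr_mult powr_powr)
  also have "\<dots> \<le> (1 + 1 / a) powr \<alpha> * x powr \<epsilon>"
    using assms a by (intro mult_left_mono powr_mono) auto
  finally show ?thesis by (simp add: a_def)
qed

lemma exp_decay_measurable: "(\<lambda>s. ennreal (exp (c * (s - s0)))) \<in> borel_measurable lebesgue"
  by (rule lebesgue_measurable) measurable

lemma nn_integral_exp_decay: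
  assumes "0 < (c :: real)"
  shows "(\<integral>\<^sup>+ s. ennreal (exp (- c * (s - s0))) * indicator {s0..} s \<partial>lebesgue) = ennreal (1 / c)"
proof -
  have "(\<integral>\<^sup>+ s. ennreal (exp (- c * (s - s0))) * indicator {s0..} s \<partial>lborel) = ennreal (0 - (- exp (- c * (s0 - s0)) / c))"
  proof (rule nn_integral_FTC_atLeast[where F = "\<lambda>s. - exp (- c * (s - s0)) / c" and T = 0])
    show "((\<lambda>s. - exp (- c * (s - s0)) / c) \<longlongrightarrow> 0) at_top"
    proof -
      have "filterlim (\<lambda>s. - s0 + s) at_top at_top"
        by (rule filterlim_tendsto_add_at_top[OF tendsto_const filterlim_ident])
      then have "filterlim (\<lambda>s. c * (- s0 + s)) at_top at_top"
        by (rule filterlim_tendsto_pos_mult_at_top[OF tendsto_const assms])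
      then have "filterlim (\<lambda>s. - (c * (- s0 + s))) at_bot at_top"
        by (simp add: filterlim_uminus_at_top)
      then have "((\<lambda>s. exp (- (c * (- s0 + s)))) \<longlongrightarrow> 0) at_top"
        by (rule filterlim_compose[OF exp_at_bot])
      then have "((\<lambda>s. - exp (- (c * (- s0 + s))) / c) \<longlongrightarrow> - 0 / c) at_top"
        using assms by (intro tendsto_intros) auto
      then show ?thesis by (simp add: algebra_simps)
    qed
    show "((\<lambda>s. - exp (- c * (s - s0)) / c) has_real_derivative exp (- c * (x - s0))) (at x)" for x
      using assms by (auto intro!: derivative_eq_intros)
  qed auto
  then show ?thesis by (simp add: nn_integral_completion)
qed

text \<open>The levels are split by the size of q. Where q > r0, the power is at most r0 to the
  power 2 * \<gamma> and the mass is 1. Where q \<le> r0, put x = r0 / q: the integrand is of order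
  x to the power -2 * \<epsilon> times a power of 1 + ln x, the latter costs x to the power
  \<epsilon>, and what remains decays exponentially in s because x grows at least at rate \<kappa>.
  Potential, dimension and coefficient enter only after Q is fixed.\<close>

lemma nu_power_integral:
  assumes "0 < \<kappa>" "0 \<le> K" "0 < 1 + 2 * \<gamma>" "\<gamma> \<le> 0" "0 \<le> \<alpha>"
  shows "\<exists>Q\<ge>0. \<forall>d V vs L \<xi>. cond_P d V vs \<longrightarrow> cond_C \<kappa> K L \<xi> \<longrightarrow> nu_log_bound d V vs \<xi> r0 \<alpha> C\<^sub>\<nu> \<longrightarrow>
    (\<integral>\<^sup>+ s\<in>{vs<..}. ennreal (q_fun d V vs \<xi> s) * ennreal ((q_fun d V vs \<xi> s powr \<gamma>)\<^sup>2) * m_V d V s \<partial>lebesgue) \<le> ennreal Q"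
proof -
  \<comment> \<open>Half of the available exponent 1 + 2 * \<gamma>: one \<epsilon> pays for the
    logarithm, the other for integrability over the levels.\<close>
  define \<epsilon> where "\<epsilon> = (1 + 2 * \<gamma>) / 2"
  have \<epsilon>: "0 < \<epsilon>" "2 * \<epsilon> = 1 + 2 * \<gamma>" using assms by (auto simp: \<epsilon>_def)
  define C\<alpha> where "C\<alpha> = (1 + (\<alpha> + 1) / \<epsilon>) powr \<alpha>"
  define B where "B = K * \<bar>C\<^sub>\<nu>\<bar> * r0 powr (2 * \<epsilon>) * C\<alpha>"
  define Q where "Q = r0 powr (2 * \<gamma>) + B * (1 / (\<kappa> * \<epsilon>))"
  have B: "0 \<le> B" using assms by (simp add: B_def C\<alpha>_def)
  have Q: "0 \<le> Q" using assms B \<epsilon> by (simp add: Q_def)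
  have "(\<integral>\<^sup>+ s\<in>{vs<..}. ennreal (q_fun d V vs \<xi> s) * ennreal ((q_fun d V vs \<xi> s powr \<gamma>)\<^sup>2) * m_V d V s \<partial>lebesgue) \<le> ennreal Q"
    if P: "cond_P d V vs" and C: "cond_C \<kappa> K L \<xi>" and nu: "nu_log_bound d V vs \<xi> r0 \<alpha> C\<^sub>\<nu>" for d V vs L \<xi>
  proof -
    define q where "q = q_fun d V vs \<xi>"
    have r0: "0 < r0" using nu by (simp add: nu_log_bound_def)
    obtain s0 where s0: "q s0 = r0" unfolding q_def using q_fun_surj[OF P C r0] by blast
    have qpos: "0 < q s" for s unfolding q_def by (rule q_fun_pos[OF P C])
    note m_V_measurable[OF P C, measurable] lebesgue_measurable[OF q_fun_measurable[OF P C], folded q_def, measurable]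
    note lebesgue_ident[measurable]
    have q2: "(q s powr \<gamma>)\<^sup>2 = q s powr (2 * \<gamma>)" for s
      using qpos[of s] by (simp add: powr_powr[symmetric] mult.commute powr_realpow)
    have pw: "ennreal (q s) * ennreal ((q s powr \<gamma>)\<^sup>2) * m_V d V s * indicator {vs<..} s \<le>
        ennreal (r0 powr (2 * \<gamma>)) * (ennreal (q s) * m_V d V s * indicator {vs<..} s) +
        ennreal B * (ennreal (exp (- (\<kappa> * \<epsilon>) * (s - s0))) * indicator {s0..} s)" for s
    proof (cases "vs < s")
      case True
      show ?thesis
      proof (cases "q s \<le> r0")
        case False
        have "q s powr (2 * \<gamma>) \<le> r0 powr (2 * \<gamma>)"
          using False r0 assms by (intro powr_mono2') auto
        then have "ennreal (q s powr (2 * \<gamma>)) * (ennreal (q s) * m_V d V s) \<le>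
            ennreal (r0 powr (2 * \<gamma>)) * (ennreal (q s) * m_V d V s)"
          by (intro mult_right_mono ennreal_leI) auto
        then show ?thesis using True unfolding q2 by (simp add: mult_ac add_increasing2)
      next
        case le: True
        have "s0 \<le> s"
          using q_fun_strict_antimono[OF P C, of s s0] le s0 unfolding q_def by (cases "s < s0") auto
        define x where "x = r0 / q s"
        have x: "1 \<le> x" using le qpos[of s] by (simp add: x_def)
        have "q s * exp (\<kappa> * (s - s0)) \<le> r0"
          using q_fun_decay(1)[OF P C \<open>s0 \<le> s\<close>] s0 unfolding q_def by simp
        then have "exp (\<kappa> * (s - s0)) \<le> x" using qpos[of s] by (simp add: x_def le_divide_eq mult.commute)
        then have "x powr (- \<epsilon>) \<le> exp (\<kappa> * (s - s0)) powr (- \<epsilon>)"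
          using \<epsilon> by (intro powr_mono2') auto
        also have "\<dots> = exp (- (\<kappa> * \<epsilon>) * (s - s0))" by (simp add: exp_powr_real mult_ac)
        finally have xe: "x powr (- \<epsilon>) \<le> exp (- (\<kappa> * \<epsilon>) * (s - s0))" .
        have qs: "q s = r0 * x powr (- 1)" using qpos[of s] r0 by (simp add: x_def powr_minus)
        have "q s * q s powr (2 * \<gamma>) = q s powr (2 * \<epsilon>)"
          using qpos[of s] by (simp add: \<epsilon> powr_add)
        also have "\<dots> = (r0 * x powr (- 1)) powr (2 * \<epsilon>)" by (simp only: qs[symmetric])
        also have "\<dots> = r0 powr (2 * \<epsilon>) * (x powr (- 1)) powr (2 * \<epsilon>)"
          using r0 by (intro powr_mult) 
        also have "(x powr (- 1)) powr (2 * \<epsilon>) = x powr (- (2 * \<epsilon>))"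
          unfolding powr_powr by simp
        finally have qx: "q s * q s powr (2 * \<gamma>) = r0 powr (2 * \<epsilon>) * x powr (- (2 * \<epsilon>))" .
        have "q s * q s powr (2 * \<gamma>) * (K * \<bar>C\<^sub>\<nu>\<bar> * (1 + ln x) powr \<alpha>) \<le>
            r0 powr (2 * \<epsilon>) * x powr (- (2 * \<epsilon>)) * (K * \<bar>C\<^sub>\<nu>\<bar> * (C\<alpha> * x powr \<epsilon>))"
          unfolding qx C\<alpha>_def using one_plus_ln_powr_bound[OF assms(5) \<epsilon>(1) x] assms
          by (intro mult_left_mono) auto
        also have "\<dots> = B * (x powr (- (2 * \<epsilon>)) * x powr \<epsilon>)" by (simp add: B_def mult_ac)
        also have "x powr (- (2 * \<epsilon>)) * x powr \<epsilon> = x powr (- \<epsilon>)" using x by (simp add: powr_add[symmetric])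
        also have "B * x powr (- \<epsilon>) \<le> B * exp (- (\<kappa> * \<epsilon>) * (s - s0))" using xe B by (rule mult_left_mono)
        finally have fin: "q s * q s powr (2 * \<gamma>) * (K * \<bar>C\<^sub>\<nu>\<bar> * (1 + ln x) powr \<alpha>) \<le> B * exp (- (\<kappa> * \<epsilon>) * (s - s0))" .
        have "m_V d V s \<le> ennreal (K * \<bar>C\<^sub>\<nu>\<bar> * (1 + ln x) powr \<alpha>)"
          unfolding x_def using m_V_log_bound[OF P C nu True] le by (simp add: q_def)
        then have "ennreal (q s) * ennreal (q s powr (2 * \<gamma>)) * m_V d V s \<le>
            ennreal (q s) * ennreal (q s powr (2 * \<gamma>)) * ennreal (K * \<bar>C\<^sub>\<nu>\<bar> * (1 + ln x) powr \<alpha>)"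
          by (rule mult_left_mono) simp
        also have "\<dots> = ennreal (q s * q s powr (2 * \<gamma>) * (K * \<bar>C\<^sub>\<nu>\<bar> * (1 + ln x) powr \<alpha>))"
          using qpos[of s] by (simp add: ennreal_mult'[symmetric])
        also have "\<dots> \<le> ennreal (B * exp (- (\<kappa> * \<epsilon>) * (s - s0)))" using fin by (rule ennreal_leI)
        also have "\<dots> = ennreal B * ennreal (exp (- (\<kappa> * \<epsilon>) * (s - s0)))" using B by (rule ennreal_mult')
        finally show ?thesis using True \<open>s0 \<le> s\<close> unfolding q2 by (simp add: add_increasing)
      qed
    qed simp
    have "(\<integral>\<^sup>+ s\<in>{vs<..}. ennreal (q s) * ennreal ((q s powr \<gamma>)\<^sup>2) * m_V d V s \<partial>lebesgue) \<le>
        (\<integral>\<^sup>+ s. ennreal (r0 powr (2 * \<gamma>)) * (ennreal (q s) * m_V d V s * indicator {vs<..} s) +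
        ennreal B * (ennreal (exp (- (\<kappa> * \<epsilon>) * (s - s0))) * indicator {s0..} s) \<partial>lebesgue)"
      by (intro nn_integral_mono pw)
    also have "\<dots> = ennreal (r0 powr (2 * \<gamma>)) * 1 + ennreal B * ennreal (1 / (\<kappa> * \<epsilon>))"
    proof -
      note exp_decay_measurable[measurable]
      show ?thesis
        using q_fun_mass[OF P C] nn_integral_exp_decay[of "\<kappa> * \<epsilon>" s0] assms(1) \<epsilon>(1)
        by (subst nn_integral_add) (simp_all add: nn_integral_cmult q_def[symmetric])
    qed
    also have "\<dots> = ennreal Q"
      using B assms(1) \<epsilon>(1) unfolding Q_def by (subst ennreal_plus) (auto simp: ennreal_mult[symmetric])
    finally show ?thesis by (simp add: q_def)
  qed
  then show ?thesis using Q by blast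
qed

text \<open>If f is not integrable, its Bochner integral is 0 by definition, so the bound covers
  this case too.\<close>

lemma integral_abs_le:
  fixes f :: "'a \<Rightarrow> real"
  assumes "(\<integral>\<^sup>+ x. ennreal \<bar>f x\<bar> \<partial>M) \<le> ennreal B" "0 \<le> B"
  shows "\<bar>LINT x|M. f x\<bar> \<le> B"
proof (cases "integrable M f")
  case True
  then have "ennreal \<bar>LINT x|M. f x\<bar> \<le> (\<integral>\<^sup>+ x. ennreal \<bar>f x\<bar> \<partial>M)"
    using integral_norm_bound_ennreal[of M f] by simp
  then have "ennreal \<bar>LINT x|M. f x\<bar> \<le> ennreal B" using assms(1) by (rule order_trans)
  then show ?thesis using assms(2) by simp
qed (use assms in \<open>simp add: not_integrable_integral_eq\<close>)

section \<open>From a pointwise bound on \<open>K_op\<close> to the weighted L2 bound on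
  \<open>A_op\<close>\<close>

context
  fixes d :: nat and V :: "(nat \<Rightarrow> real) \<Rightarrow> real" and vs \<kappa> K L :: real and \<xi> h F :: "real \<Rightarrow> real"
    and U D Q :: real
  assumes P: "cond_P d V vs" and C: "cond_C \<kappa> K L \<xi>" and U: "a_plus d V vs K \<le> U"
    and cont: "continuous_on {0<..} (K_op \<xi> h)"
    and Kh: "\<And>r. 0 < r \<Longrightarrow> r \<le> U \<Longrightarrow> \<bar>K_op \<xi> h r\<bar> \<le> D * F r"
    and F: "F \<in> borel_measurable borel" "\<And>r. 0 \<le> F r" and D: "0 \<le> D" and Q: "0 \<le> Q"
      "(\<integral>\<^sup>+ s\<in>{vs<..}. ennreal (q_fun d V vs \<xi> s) * ennreal ((F (q_fun d V vs \<xi> s))\<^sup>2) * m_V d V s \<partial>lebesgue) \<le> ennreal Q"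
begin

private abbreviation (input) "q \<equiv> q_fun d V vs \<xi>"

lemma q_range: "vs < s \<Longrightarrow> 0 < q s \<and> q s \<le> U"
  using q_fun_pos[OF P C, of s] q_fun_le_a_plus[OF P C, of s] U by simp

lemma q_meas: "q \<in> borel_measurable lebesgue"
  by (rule lebesgue_measurable[OF q_fun_measurable[OF P C]])

lemma F_q_meas: "(\<lambda>s. F (q s)) \<in> borel_measurable lebesgue"
proof -
  note F(1)[measurable] q_fun_measurable[OF P C, measurable]
  have "(\<lambda>s. F (q s)) \<in> borel_measurable borel" by measurable
  then show ?thesis by (rule lebesgue_measurable)
qed

lemma Ioi_lebesgue: "{vs<..} \<in> sets lebesgue" by simp

text \<open>By F \<le> 1 + F squared, the total mass 1 and the second moment control the first one,
  which the centring constant requires.\<close>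

lemma first_moment_bound:
  "(\<integral>\<^sup>+ s\<in>{vs<..}. ennreal (q s) * ennreal (F (q s)) * m_V d V s \<partial>lebesgue) \<le> ennreal (1 + Q)"
proof -
  note m_V_measurable[OF P C, measurable] q_meas[measurable] F_q_meas[measurable] lebesgue_ident[measurable]
  have "(\<integral>\<^sup>+ s\<in>{vs<..}. ennreal (q s) * ennreal (F (q s)) * m_V d V s \<partial>lebesgue) \<le>
      (\<integral>\<^sup>+ s. ennreal (q s) * m_V d V s * indicator {vs<..} s +
         ennreal (q s) * ennreal ((F (q s))\<^sup>2) * m_V d V s * indicator {vs<..} s \<partial>lebesgue)"
  proof (intro nn_integral_mono)
    fix s
    have "F (q s) \<le> 1 + (F (q s))\<^sup>2"
      using zero_le_power2[of "F (q s) - 1"] F(2)[of "q s"] unfolding power2_diff by simp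
    then have "ennreal (F (q s)) \<le> ennreal (1 + (F (q s))\<^sup>2)" by (rule ennreal_leI)
    also have "\<dots> = 1 + ennreal ((F (q s))\<^sup>2)" by (subst ennreal_plus) auto
    finally have "ennreal (q s) * ennreal (F (q s)) * m_V d V s * indicator {vs<..} s \<le>
        ennreal (q s) * (1 + ennreal ((F (q s))\<^sup>2)) * m_V d V s * indicator {vs<..} s"
      by (intro mult_right_mono mult_left_mono) auto
    then show "ennreal (q s) * ennreal (F (q s)) * m_V d V s * indicator {vs<..} s \<le>
        ennreal (q s) * m_V d V s * indicator {vs<..} s +
         ennreal (q s) * ennreal ((F (q s))\<^sup>2) * m_V d V s * indicator {vs<..} s"
      by (simp add: distrib_left distrib_right)
  qed
  also have "\<dots> \<le> 1 + ennreal Q"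
    using Q(2) q_fun_mass[OF P C] by (subst nn_integral_add) (auto intro: add_left_mono)
  also have "\<dots> = ennreal (1 + Q)" using Q(1) by simp
  finally show ?thesis .
qed

lemma K_pos: "0 < \<kappa>" "0 < K" using cond_C_bounds(1,2)[OF C] by auto

lemma xi_q: "0 < \<xi> (q s)" "\<kappa> \<le> \<xi> (q s)" "\<xi> (q s) \<le> K"
  using cond_C_pos[OF C, of "q s"] cond_C_bounds(3,4)[OF C, of "q s"] q_fun_pos[OF P C, of s] by auto

lemma xi_q_meas: "(\<lambda>s. \<xi> (q s)) \<in> borel_measurable lebesgue"
proof -
  have [measurable]: "(\<lambda>r. indicator {0..} r *\<^sub>R \<xi> r) \<in> borel_measurable borel"
    using cond_C_continuous[OF C] by (intro borel_measurable_continuous_on_indicator) auto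
  note q_fun_measurable[OF P C, measurable]
  have "(\<lambda>s. indicator {0..} (q s) *\<^sub>R \<xi> (q s)) \<in> borel_measurable borel" by measurable
  also have "(\<lambda>s. indicator {0..} (q s) *\<^sub>R \<xi> (q s)) = (\<lambda>s. \<xi> (q s))"
    using q_fun_pos[OF P C] by (auto simp: indicator_def less_imp_le)
  finally show ?thesis by (rule lebesgue_measurable)
qed

text \<open>The density q * \<open>m_V\<close> has mass 1, so \<xi> \<ge> \<kappa> bounds the
  integral from below. The upper bound on \<xi> is used as well: it gives integrability, without
  which the Bochner integral would be 0.\<close>

lemma denominator_bound:
  "\<kappa> \<le> (LINT s:{vs<..}|lebesgue. q s * \<xi> (q s) * enn2real (m_V d V s))"
proof -
  note m_V_measurable[OF P C, measurable] q_meas[measurable] xi_q_meas[measurable] lebesgue_ident[measurable]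
  define f where "f s = indicator {vs<..} s *\<^sub>R (q s * \<xi> (q s) * enn2real (m_V d V s))" for s
  have [measurable]: "f \<in> borel_measurable lebesgue"
    unfolding f_def by (intro borel_measurable_scaleR borel_measurable_indicator borel_measurable_times
      borel_measurable_enn2real q_meas xi_q_meas m_V_measurable[OF P C] Ioi_lebesgue)
  have f0: "0 \<le> f s" for s using q_fun_pos[OF P C, of s] xi_q(1)[of s] by (simp add: f_def)
  have f: "AE s in lebesgue. ennreal (f s) = ennreal (\<xi> (q s)) * (ennreal (q s) * m_V d V s * indicator {vs<..} s)"
    using m_V_finite[OF P C]
  proof eventually_elim
    case (elim s)
    show ?case
    proof (cases "vs < s")
      case True
      then have "m_V d V s = ennreal (enn2real (m_V d V s))" using elim by (simp add: less_top)
      then show ?thesis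
        using True q_fun_pos[OF P C, of s] xi_q(1)[of s]
        by (simp add: f_def ennreal_mult' mult_ac less_imp_le)
    qed (simp add: f_def)
  qed
  have I: "(\<integral>\<^sup>+ s. ennreal (f s) \<partial>lebesgue) =
      (\<integral>\<^sup>+ s. ennreal (\<xi> (q s)) * (ennreal (q s) * m_V d V s * indicator {vs<..} s) \<partial>lebesgue)"
    using f by (rule nn_integral_cong_AE)
  have "(\<integral>\<^sup>+ s. ennreal (f s) \<partial>lebesgue) \<le> (\<integral>\<^sup>+ s. ennreal K * (ennreal (q s) * m_V d V s * indicator {vs<..} s) \<partial>lebesgue)"
    unfolding I using xi_q by (intro nn_integral_mono mult_right_mono ennreal_leI) auto
  also have "\<dots> = ennreal K" using q_fun_mass[OF P C] by (subst nn_integral_cmult) auto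
  finally have "integrable lebesgue f"
    using f0 by (intro integrableI_bounded) (auto intro: order_le_less_trans)
  then have eq: "(\<integral>\<^sup>+ s. ennreal (f s) \<partial>lebesgue) = ennreal (LINT s|lebesgue. f s)"
    using f0 by (intro nn_integral_eq_integral) auto
  have "ennreal \<kappa> = (\<integral>\<^sup>+ s. ennreal \<kappa> * (ennreal (q s) * m_V d V s * indicator {vs<..} s) \<partial>lebesgue)"
    using q_fun_mass[OF P C] by (subst nn_integral_cmult) auto
  also have "\<dots> \<le> (\<integral>\<^sup>+ s. ennreal (f s) \<partial>lebesgue)"
    unfolding I using xi_q by (intro nn_integral_mono mult_right_mono ennreal_leI) auto
  finally have "\<kappa> \<le> (LINT s|lebesgue. f s)"
    unfolding eq using f0 by (simp add: ennreal_le_iff integral_nonneg_AE)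
  then show ?thesis by (simp add: f_def set_lebesgue_integral_def)
qed

lemma c_const_bound: "\<bar>c_const d V vs \<xi> h\<bar> \<le> K / \<kappa> * D * (1 + Q)"
proof -
  note m_V_measurable[OF P C, measurable] q_meas[measurable] F_q_meas[measurable] lebesgue_ident[measurable]
  define N where "N = (LINT s:{vs<..}|lebesgue. q s * \<xi> (q s) * K_op \<xi> h (q s) * enn2real (m_V d V s))"
  define E where "E = (LINT s:{vs<..}|lebesgue. q s * \<xi> (q s) * enn2real (m_V d V s))"
  have "\<bar>N\<bar> \<le> K * D * (1 + Q)"
    unfolding N_def set_lebesgue_integral_def
  proof (rule integral_abs_le)
    have "(\<integral>\<^sup>+ s. ennreal \<bar>indicat_real {vs<..} s *\<^sub>R (q s * \<xi> (q s) * K_op \<xi> h (q s) * enn2real (m_V d V s))\<bar> \<partial>lebesgue)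
        \<le> (\<integral>\<^sup>+ s. ennreal (K * D) * (ennreal (q s) * ennreal (F (q s)) * m_V d V s * indicator {vs<..} s) \<partial>lebesgue)"
    proof (intro nn_integral_mono)
      fix s
      show "ennreal \<bar>indicat_real {vs<..} s *\<^sub>R (q s * \<xi> (q s) * K_op \<xi> h (q s) * enn2real (m_V d V s))\<bar> \<le>
        ennreal (K * D) * (ennreal (q s) * ennreal (F (q s)) * m_V d V s * indicator {vs<..} s)"
      proof (cases "vs < s")
        case True
        define y where "y = enn2real (m_V d V s)"
        have y: "0 \<le> y" "ennreal y \<le> m_V d V s"
          by (auto simp: y_def ennreal_enn2real_if)
        have "\<bar>q s * \<xi> (q s) * K_op \<xi> h (q s) * y\<bar> = q s * (\<xi> (q s) * \<bar>K_op \<xi> h (q s)\<bar>) * y"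
          using q_range[OF True] xi_q(1)[of s] y by (simp add: abs_mult)
        also have "\<dots> \<le> q s * (K * (D * F (q s))) * y"
          using q_range[OF True] xi_q[of s] y K_pos Kh[of "q s"]
          by (intro mult_right_mono mult_left_mono mult_mono) auto
        also have "\<dots> = K * D * (q s * F (q s) * y)" by (simp add: mult_ac)
        finally have "ennreal \<bar>q s * \<xi> (q s) * K_op \<xi> h (q s) * y\<bar> \<le> ennreal (K * D * (q s * F (q s) * y))"
          by (rule ennreal_leI)
        also have "\<dots> = ennreal (K * D) * (ennreal (q s) * ennreal (F (q s)) * ennreal y)"
          using K_pos D F(2)[of "q s"] y(1) q_range[OF True] by (simp add: ennreal_mult')
        also have "\<dots> \<le> ennreal (K * D) * (ennreal (q s) * ennreal (F (q s)) * m_V d V s)"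
          using y(2) by (intro mult_left_mono) auto
        finally show ?thesis using True by (simp add: y_def)
      qed simp
    qed
    also have "\<dots> = ennreal (K * D) * (\<integral>\<^sup>+ s. ennreal (q s) * ennreal (F (q s)) * m_V d V s * indicator {vs<..} s \<partial>lebesgue)"
      by (rule nn_integral_cmult) measurable
    also have "\<dots> \<le> ennreal (K * D) * ennreal (1 + Q)"
      using first_moment_bound by (intro mult_left_mono) auto
    also have "\<dots> = ennreal (K * D * (1 + Q))"
      using K_pos D by (simp add: ennreal_mult')
    finally show "(\<integral>\<^sup>+ s. ennreal \<bar>indicat_real {vs<..} s *\<^sub>R (q s * \<xi> (q s) * K_op \<xi> h (q s) * enn2real (m_V d V s))\<bar> \<partial>lebesgue)
        \<le> ennreal (K * D * (1 + Q))" .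
  qed (use K_pos D Q in auto)
  moreover have "\<kappa> \<le> E" unfolding E_def by (rule denominator_bound)
  ultimately have "\<bar>N\<bar> / E \<le> K * D * (1 + Q) / \<kappa>"
    using K_pos D Q by (intro frac_le) auto
  moreover have "\<bar>c_const d V vs \<xi> h\<bar> = \<bar>N\<bar> / E"
    unfolding c_const_def N_def[symmetric] E_def[symmetric] using \<open>\<kappa> \<le> E\<close> K_pos by (simp add: abs_divide)
  ultimately show ?thesis by simp
qed

text \<open>The square of the sum of the centring constant and \<open>K_op\<close> is at most twice
  the sum of the squares; the former is controlled by the first moment, the latter by Q. Restricting
  to r > 0 loses no mass, as the profile is positive, and there the integrand is continuous and
  hence measurable.\<close>

lemma forward_bound:
  defines "W \<equiv> D * sqrt (2 * K\<^sup>2 * ((K / \<kappa> * (1 + Q))\<^sup>2 + Q))"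
  shows "set_integrable (nu_law d V vs \<xi>) {0<..} (\<lambda>r. (A_op d V vs \<xi> h r)\<^sup>2)"
    and "sqrt (LINT r:{0<..}|nu_law d V vs \<xi>. (A_op d V vs \<xi> h r)\<^sup>2) \<le> W"
proof -
  note m_V_measurable[OF P C, measurable] q_meas[measurable] F_q_meas[measurable] lebesgue_ident[measurable]
  define G where "G r = indicator {0<..} r *\<^sub>R (A_op d V vs \<xi> h r)\<^sup>2" for r
  define c where "c = c_const d V vs \<xi> h"
  have "continuous_on {0<..} (\<lambda>r. (A_op d V vs \<xi> h r)\<^sup>2)"
    unfolding A_op_def by (intro continuous_intros cont continuous_on_subset[OF cond_C_continuous[OF C]]) auto
  then have Gm: "G \<in> borel_measurable borel"
    unfolding G_def by (intro borel_measurable_continuous_on_indicator) auto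
  have G0: "0 \<le> G r" for r by (simp add: G_def)
  have W0: "0 \<le> W" using D Q K_pos by (simp add: W_def)
  have W2: "W\<^sup>2 = 2 * K\<^sup>2 * ((K / \<kappa> * D * (1 + Q))\<^sup>2) + 2 * K\<^sup>2 * D\<^sup>2 * Q"
  proof -
    define Y where "Y = K / \<kappa> * (1 + Q)"
    have "W\<^sup>2 = D\<^sup>2 * (2 * K\<^sup>2 * (Y\<^sup>2 + Q))"
      unfolding W_def Y_def[symmetric] power_mult_distrib using Q by simp
    moreover have e: "K / \<kappa> * D * (1 + Q) = Y * D" by (simp add: Y_def)
    ultimately show ?thesis unfolding e by (simp add: power_mult_distrib algebra_simps)
  qed
  have Gq: "G (q s) \<le> 2 * K\<^sup>2 * (K / \<kappa> * D * (1 + Q))\<^sup>2 + 2 * K\<^sup>2 * D\<^sup>2 * (F (q s))\<^sup>2" if "vs < s" for s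
  proof -
    have "(c + K_op \<xi> h (q s))\<^sup>2 \<le> 2 * c\<^sup>2 + 2 * (K_op \<xi> h (q s))\<^sup>2"
      using zero_le_power2[of "c - K_op \<xi> h (q s)"] unfolding power2_diff power2_sum by simp
    also have "c\<^sup>2 \<le> (K / \<kappa> * D * (1 + Q))\<^sup>2"
      using c_const_bound D Q(1) K_pos unfolding c_def by (subst power2_le_iff_abs_le) auto
    also have "(K_op \<xi> h (q s))\<^sup>2 \<le> (D * F (q s))\<^sup>2"
      using Kh[of "q s"] q_range[OF that] D F(2)[of "q s"] by (subst power2_le_iff_abs_le) auto
    finally have *: "(c + K_op \<xi> h (q s))\<^sup>2 \<le> 2 * (K / \<kappa> * D * (1 + Q))\<^sup>2 + 2 * (D * F (q s))\<^sup>2" by simp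
    have "G (q s) = (\<xi> (q s))\<^sup>2 * (c + K_op \<xi> h (q s))\<^sup>2"
      using q_range[OF that] by (simp add: G_def A_op_def c_def power_mult_distrib)
    also have "\<dots> \<le> K\<^sup>2 * (2 * (K / \<kappa> * D * (1 + Q))\<^sup>2 + 2 * (D * F (q s))\<^sup>2)"
      using xi_q[of s] * by (intro mult_mono power_mono) auto
    finally show ?thesis by (simp add: power_mult_distrib algebra_simps)
  qed
  have "(\<integral>\<^sup>+ r. ennreal (G r) \<partial>nu_law d V vs \<xi>) =
      (\<integral>\<^sup>+ s\<in>{vs<..}. ennreal (q s) * ennreal (G (q s)) * m_V d V s \<partial>lebesgue)"
    by (intro nn_integral_nu_law[OF P C] measurable_compose[OF Gm measurable_ennreal])
  also have "\<dots> \<le> (\<integral>\<^sup>+ s. ennreal (2 * K\<^sup>2 * (K / \<kappa> * D * (1 + Q))\<^sup>2) * (ennreal (q s) * m_V d V s * indicator {vs<..} s) +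
      ennreal (2 * K\<^sup>2 * D\<^sup>2) * (ennreal (q s) * ennreal ((F (q s))\<^sup>2) * m_V d V s * indicator {vs<..} s) \<partial>lebesgue)"
  proof (intro nn_integral_mono)
    fix s
    show "ennreal (q s) * ennreal (G (q s)) * m_V d V s * indicator {vs<..} s \<le>
      ennreal (2 * K\<^sup>2 * (K / \<kappa> * D * (1 + Q))\<^sup>2) * (ennreal (q s) * m_V d V s * indicator {vs<..} s) +
      ennreal (2 * K\<^sup>2 * D\<^sup>2) * (ennreal (q s) * ennreal ((F (q s))\<^sup>2) * m_V d V s * indicator {vs<..} s)"
    proof (cases "vs < s")
      case True
      have "ennreal (G (q s)) \<le> ennreal (2 * K\<^sup>2 * (K / \<kappa> * D * (1 + Q))\<^sup>2 + 2 * K\<^sup>2 * D\<^sup>2 * (F (q s))\<^sup>2)"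
        using Gq[OF True] by (rule ennreal_leI)
      also have "\<dots> = ennreal (2 * K\<^sup>2 * (K / \<kappa> * D * (1 + Q))\<^sup>2) + ennreal (2 * K\<^sup>2 * D\<^sup>2) * ennreal ((F (q s))\<^sup>2)"
        by (subst ennreal_plus) (simp_all add: ennreal_mult'[symmetric])
      finally have "ennreal (G (q s)) \<le> ennreal (2 * K\<^sup>2 * (K / \<kappa> * D * (1 + Q))\<^sup>2) + ennreal (2 * K\<^sup>2 * D\<^sup>2) * ennreal ((F (q s))\<^sup>2)" .
      then have "ennreal (q s) * ennreal (G (q s)) * m_V d V s \<le> ennreal (q s) *
          (ennreal (2 * K\<^sup>2 * (K / \<kappa> * D * (1 + Q))\<^sup>2) + ennreal (2 * K\<^sup>2 * D\<^sup>2) * ennreal ((F (q s))\<^sup>2)) * m_V d V s"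
        by (intro mult_right_mono mult_left_mono) auto
      then show ?thesis using True by (simp add: distrib_left distrib_right mult_ac)
    qed simp
  qed
  also have "\<dots> \<le> ennreal (2 * K\<^sup>2 * (K / \<kappa> * D * (1 + Q))\<^sup>2) * 1 + ennreal (2 * K\<^sup>2 * D\<^sup>2) * ennreal Q"
    using q_fun_mass[OF P C] Q(2)
    by (subst nn_integral_add) (auto simp: nn_integral_cmult intro!: add_left_mono mult_left_mono)
  also have "\<dots> = ennreal (W\<^sup>2)"
    unfolding W2 using Q(1) by (subst ennreal_plus) (auto simp: ennreal_mult')
  finally have I: "(\<integral>\<^sup>+ r. ennreal (G r) \<partial>nu_law d V vs \<xi>) \<le> ennreal (W\<^sup>2)" .
  have Gm': "G \<in> borel_measurable (nu_law d V vs \<xi>)"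
    using Gm by (simp add: nu_law_def)
  have int: "integrable (nu_law d V vs \<xi>) G"
    using I G0 Gm' by (intro integrableI_bounded) (auto intro: order_le_less_trans)
  then show "set_integrable (nu_law d V vs \<xi>) {0<..} (\<lambda>r. (A_op d V vs \<xi> h r)\<^sup>2)"
    unfolding set_integrable_def G_def[abs_def] .
  have "ennreal (LINT r|nu_law d V vs \<xi>. G r) \<le> ennreal (W\<^sup>2)"
    using I nn_integral_eq_integral[OF int] G0 by simp
  then have "(LINT r|nu_law d V vs \<xi>. G r) \<le> W\<^sup>2" by simp
  then have "sqrt (LINT r|nu_law d V vs \<xi>. G r) \<le> W"
    using W0 by (simp add: real_le_lsqrt)
  then show "sqrt (LINT r:{0<..}|nu_law d V vs \<xi>. (A_op d V vs \<xi> h r)\<^sup>2) \<le> W"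
    by (simp add: set_lebesgue_integral_def G_def)
qed

end

section \<open>\<open>K_op\<close> along a mesh with vanishing moments\<close>

context
  fixes \<kappa> K L :: real and \<Xi> h :: "real \<Rightarrow> real" and r M :: "nat \<Rightarrow> real" and m i0 :: nat
  assumes C: "cond_C \<kappa> K L \<Xi>" and h: "continuous_on {0..} h"
    and r: "r 0 = 0" "\<And>j. j < m \<Longrightarrow> r j < r (Suc j)" "i0 \<le> m" "r i0 = 1"
    and M: "\<And>j u. j < m \<Longrightarrow> u \<in> {r j..r (Suc j)} \<Longrightarrow> \<bar>h u\<bar> \<le> M j * (u - r j)"
    and moment: "\<And>j. j < m \<Longrightarrow> (LBINT u:{r j..r (Suc j)}. h u / (u * (\<Xi> u)\<^sup>2)) = 0"
begin

lemma K_op_integrand_continuous: "continuous_on {0<..} (\<lambda>u. h u * w_fun \<Xi> u)"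
  unfolding w_fun_def
proof (intro continuous_intros continuous_on_subset[OF h] continuous_on_subset[OF cond_C_continuous[OF C]] ballI)
  show "u * (\<Xi> u)\<^sup>2 \<noteq> 0" if "u \<in> {0<..}" for u
    using cond_C_pos[OF C, of u] that by simp
qed auto

lemma K_op_increment:
  assumes "0 < a" "a \<le> b"
  shows "K_op \<Xi> h b - K_op \<Xi> h a = (LBINT u:{a..b}. h u / (u * (\<Xi> u)\<^sup>2))"
  unfolding K_op_def interval_integral_increment[OF K_op_integrand_continuous assms]
  by (simp add: w_fun_def)

lemma K_op_continuous: "continuous_on {0<..} (K_op \<Xi> h)"
  unfolding continuous_on_eq_continuous_at[OF open_greaterThan]
proof
  fix x :: real assume x: "x \<in> {0<..}"
  define a where "a = min x 1 / 2"
  define b where "b = max x 1 + 1"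
  have ab: "0 < a" "a < x" "x < b" "a \<le> 1" "1 \<le> b" using x by (auto simp: a_def b_def min_def max_def)
  have "((\<lambda>u. LBINT y=1..u. h y * w_fun \<Xi> y) has_vector_derivative h x * w_fun \<Xi> x) (at x within {a..b})"
    using ab by (intro interval_integral_FTC2[of a 1 b, unfolded one_ereal_def[symmetric]]
        continuous_on_subset[OF K_op_integrand_continuous]) auto
  then have "continuous (at x within {a..b}) (K_op \<Xi> h)"
    unfolding K_op_def[abs_def] by (rule has_vector_derivative_continuous)
  moreover have "at x within {a..b} = at x"
    using ab by (intro at_within_interior) auto
  ultimately show "isCont (K_op \<Xi> h) x" by simp
qed

text \<open>The base point 1 of the integral is a knot, and by the moment conditions the increments
  between positive knots vanish. So \<open>K_op\<close> is zero at every positive knot, and its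
  value at x is an integral over the part of one cell left of x.\<close>

lemma K_op_mesh_bound:
  assumes j: "j < m" and x: "0 < x" "x \<in> {r j..r (Suc j)}"
  shows "\<bar>K_op \<Xi> h x\<bar> \<le> M j * (r (Suc j) - r j)\<^sup>2 / (r (Suc j) * \<kappa>\<^sup>2)"
proof -
  have mono: "r i \<le> r j" if "i \<le> j" "j \<le> m" for i j
    using mesh_mono[of m r, OF r(2) that] by simp
  have pos: "0 < r j" if "0 < j" "j \<le> m" for j
    using mono[of 1 j] r(2)[of 0] r(1) that by auto
  have "0 < i0" using r by (cases i0) auto
  have K1: "K_op \<Xi> h 1 = 0" by (simp add: K_op_def one_ereal_def)
  have const: "K_op \<Xi> h (r j) = K_op \<Xi> h (r 1)" if "1 \<le> j" "j \<le> m" for j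
    using that
  proof (induction j rule: dec_induct)
    case (step j)
    have "K_op \<Xi> h (r (Suc j)) - K_op \<Xi> h (r j) = 0"
      using step pos[of j] r(2)[of j] moment[of j] by (subst K_op_increment) auto
    then show ?case using step by simp
  qed simp
  have "K_op \<Xi> h (r 1) = 0" using const[of i0] \<open>0 < i0\<close> r(3,4) K1 by simp
  then have knot: "K_op \<Xi> h (r j) = 0" if "0 < j" "j \<le> m" for j
    using const[of j] that by simp
  have sub: "{r j..r (Suc j)} \<subseteq> {0..}" using mono[of 0 j] j r(1) by auto
  have cf: "continuous_on {r j..r (Suc j)} h" "continuous_on {r j..r (Suc j)} \<Xi>"
    using continuous_on_subset[OF h sub] continuous_on_subset[OF cond_C_continuous[OF C] sub] by auto
  have kap: "\<kappa> \<le> \<Xi> u" if "u \<in> {r j..r (Suc j)}" for u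
    using cond_C_bounds(3)[OF C, of u] that sub by auto
  have rj: "0 \<le> r j" using mono[of 0 j] j r(1) by simp
  note wb = weighted_integral_bound[OF rj r(2)[OF j] cond_C_bounds(1)[OF C] cf kap M[OF j]]
  have "K_op \<Xi> h x = (LBINT u:{r j..x}. h u / (u * (\<Xi> u)\<^sup>2))"
  proof (cases "j = 0")
    case False
    then show ?thesis using K_op_increment[of "r j" x] pos[of j] knot[of j] j x by simp
  next
    \<comment> \<open>In the first cell the left end point is 0, where \<open>K_op_increment\<close>
      does not apply. Instead x is joined to \<open>r 1\<close>, and the vanishing moment turns the
      integral over [x, r 1] into minus the one over [0, x].\<close>
    case True
    let ?f = "\<lambda>u. h u / (u * (\<Xi> u)\<^sup>2)"
    have w: "set_integrable lborel {r 0..r 1} ?f"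
      using wb(1) True by simp
    have int: "set_integrable lborel {a..b} ?f" if "{a..b} \<subseteq> {r 0..r 1}" for a b
      by (rule set_integrable_subset[OF w]) (use that in simp_all)
    have I: "(LBINT u:{a..b}. ?f u) = integral {a..b} ?f" "?f integrable_on {a..b}" if "{a..b} \<subseteq> {r 0..r 1}" for a b
      using set_borel_integral_eq_integral[OF int[OF that]] by auto
    have "integral {r 0..x} ?f + integral {x..r 1} ?f = integral {r 0..r 1} ?f"
      using x True I(2)[of "r 0" "r 1"] by (intro Henstock_Kurzweil_Integration.integral_combine) auto
    then have "(LBINT u:{r 0..x}. ?f u) + (LBINT u:{x..r 1}. ?f u) = 0"
      using I(1)[of "r 0" x] I(1)[of x "r 1"] I(1)[of "r 0" "r 1"] moment[OF j] True x by simp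
    moreover have "K_op \<Xi> h (r 1) - K_op \<Xi> h x = (LBINT u:{x..r 1}. ?f u)"
      using x True by (intro K_op_increment) auto
    moreover have "K_op \<Xi> h (r 1) = 0" using knot[of 1] j by simp
    ultimately show ?thesis using True by simp
  qed
  then show ?thesis using wb(2)[of x] x(2) by simp
qed

end

text \<open>Needed because the sieve element is identified with the spline on [0, U] only, which is
  all that \<open>deriv_on\<close> sees.\<close>

lemma holder_ball_cong:
  assumes "0 < U" "\<And>x. x \<in> {0..U} \<Longrightarrow> f x = g x" "f \<in> holder_ball \<beta> U H"
  shows "g \<in> holder_ball \<beta> U H"
proof -
  have D: "deriv_on U j f x = deriv_on U j g x" if "x \<in> {0..U}" for j x
    using that
  proof (induction j arbitrary: x)
    case (Suc j)
    have "(deriv_on U j f has_vector_derivative y) (at x within {0..U}) \<longleftrightarrow>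
        (deriv_on U j g has_vector_derivative y) (at x within {0..U})" for y
      using Suc has_vector_derivative_transform[of x "{0..U}" "deriv_on U j g" "deriv_on U j f" y]
        has_vector_derivative_transform[of x "{0..U}" "deriv_on U j f" "deriv_on U j g" y] by auto
    then show ?case unfolding deriv_on_Suc vector_derivative_def by simp
  qed (use assms(2) in simp)
  have "deriv_on U j g differentiable (at x within {0..U})"
    if "deriv_on U j f differentiable (at x within {0..U})" "x \<in> {0..U}" for j x
    using that D has_derivative_transform[of x "{0..U}" "deriv_on U j g" "deriv_on U j f"]
    unfolding differentiable_def by metis
  moreover have "continuous_on {0..U} (deriv_on U k f) \<longleftrightarrow> continuous_on {0..U} (deriv_on U k g)" for k
    using D by (intro continuous_on_cong) auto
  moreover have "sup_norm U (deriv_on U j f) = sup_norm U (deriv_on U j g)" for j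
    unfolding sup_norm_def using D by (intro SUP_cong) auto
  moreover have "(SUP (x, y) \<in> {(x, y). x \<in> {0..U} \<and> y \<in> {0..U} \<and> x \<noteq> y}.
        ennreal (\<bar>deriv_on U k f x - deriv_on U k f y\<bar> / c x y)) =
      (SUP (x, y) \<in> {(x, y). x \<in> {0..U} \<and> y \<in> {0..U} \<and> x \<noteq> y}.
        ennreal (\<bar>deriv_on U k g x - deriv_on U k g y\<bar> / c x y))" for k and c :: "real \<Rightarrow> real \<Rightarrow> real"
    using D by (intro SUP_cong) auto
  ultimately show ?thesis
    using assms(3) unfolding holder_ball_def holder_norm_def by auto
qed

section \<open>Constants as functions of the parameters\<close>

definition net_depth :: "real \<Rightarrow> nat" where
  "net_depth \<beta> = holder_order \<beta> + 2"

text \<open>A power of two, reached by iterating ReQU once per hidden layer. The depth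
  \<open>holder_order \<beta> + 2\<close> makes it exceed \<open>holder_order \<beta> + 2\<close>,
  as the smoothness of the spline requires.\<close>

definition spline_degree :: "real \<Rightarrow> nat" where
  "spline_degree \<beta> = 2 ^ net_depth \<beta>"

definition spline_property :: "real \<Rightarrow> real \<Rightarrow> real \<Rightarrow> real \<Rightarrow> real \<Rightarrow> real \<Rightarrow> bool" where
  "spline_property \<beta> H U \<kappa> K C \<longleftrightarrow> 0 \<le> C \<and>
    (\<forall>f m r. f \<in> holder_ball \<beta> U H \<longrightarrow> (\<forall>x\<in>{0..U}. \<kappa> \<le> f x \<and> f x \<le> K) \<longrightarrow>
      0 < m \<longrightarrow> r 0 = 0 \<longrightarrow> r m = U \<longrightarrow> (\<forall>j<m. r j < r (Suc j)) \<longrightarrow>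
      (\<exists>e0 e. mesh_interpolant \<beta> (spline_degree \<beta>) C U f m r e0 e))"

text \<open>In the property the function, the number of cells and the knots are quantified after C.
  The choice thus yields a function of the five parameters, and \<open>C_app\<close> can be placed
  before all other quantifiers.\<close>

definition spline_const :: "real \<Rightarrow> real \<Rightarrow> real \<Rightarrow> real \<Rightarrow> real \<Rightarrow> real" where
  "spline_const \<beta> H U \<kappa> K = (SOME C. spline_property \<beta> H U \<kappa> K C)"

lemma spline_const:
  assumes "1 < \<beta>" "0 \<le> H" "0 < \<kappa>" "0 < U"
  shows "spline_property \<beta> H U \<kappa> K (spline_const \<beta> H U \<kappa> K)"
proof -
  have "holder_order \<beta> + 2 \<le> spline_degree \<beta>"
    unfolding spline_degree_def net_depth_def by (rule less_imp_le[OF less_exp])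
  from mesh_spline_approx[OF assms(1-3) this assms(4), of K]
  have "\<exists>C. spline_property \<beta> H U \<kappa> K C" unfolding spline_property_def .
  then show ?thesis unfolding spline_const_def by (rule someI_ex)
qed

definition moment_property :: "real \<Rightarrow> real \<Rightarrow> real \<Rightarrow> real \<Rightarrow> real \<Rightarrow> real \<Rightarrow> real \<Rightarrow> bool" where
  "moment_property \<kappa> K \<gamma> r0 \<alpha> C\<^sub>\<nu> Q \<longleftrightarrow> 0 \<le> Q \<and>
    (\<forall>d V vs L \<xi>. cond_P d V vs \<longrightarrow> cond_C \<kappa> K L \<xi> \<longrightarrow> nu_log_bound d V vs \<xi> r0 \<alpha> C\<^sub>\<nu> \<longrightarrow>
      (\<integral>\<^sup>+ s\<in>{vs<..}. ennreal (q_fun d V vs \<xi> s) * ennreal ((q_fun d V vs \<xi> s powr \<gamma>)\<^sup>2) * m_V d V s \<partial>lebesgue) \<le> ennreal Q)"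

text \<open>As for the spline constant, the potential, the dimension and the coefficient are
  quantified inside the property, so the chosen value does not depend on them.\<close>

definition moment_const :: "real \<Rightarrow> real \<Rightarrow> real \<Rightarrow> real \<Rightarrow> real \<Rightarrow> real \<Rightarrow> real" where
  "moment_const \<kappa> K \<gamma> r0 \<alpha> C\<^sub>\<nu> = (SOME Q. moment_property \<kappa> K \<gamma> r0 \<alpha> C\<^sub>\<nu> Q)"

lemma moment_const:
  assumes "0 < \<kappa>" "0 \<le> K" "0 < 1 + 2 * \<gamma>" "\<gamma> \<le> 0" "0 \<le> \<alpha>"
  shows "moment_property \<kappa> K \<gamma> r0 \<alpha> C\<^sub>\<nu> (moment_const \<kappa> K \<gamma> r0 \<alpha> C\<^sub>\<nu>)"
proof -
  from nu_power_integral[OF assms, of r0 C\<^sub>\<nu>]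
  have "\<exists>Q. moment_property \<kappa> K \<gamma> r0 \<alpha> C\<^sub>\<nu> Q" unfolding moment_property_def .
  then show ?thesis unfolding moment_const_def by (rule someI_ex)
qed

text \<open>The exponent with which \<open>h\<^sub>j\<^bsup>\<beta>+1\<^esup> / r\<^sub>j\<close> scales in \<open>r\<^sub>j\<close> on the graded mesh, where \<open>h\<^sub>j\<close>
  is of order \<open>r\<^sub>j\<^bsup>1-1/\<theta>\<^esup> / m\<close>. The condition on \<open>\<theta>\<close> says that it exceeds \<open>-1/2\<close>, which makes
  its square integrable at the origin.\<close>

definition mesh_exponent :: "real \<Rightarrow> real \<Rightarrow> real" where
  "mesh_exponent \<beta> \<theta> = (1 - 1 / \<theta>) * (\<beta> + 1) - 1"

text \<open>The right end b of a cell enters through a power with exponent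
  \<open>mesh_exponent\<close>, of either sign. A positive exponent is estimated by the value at U,
  which gives the last factor; a negative one is passed on to x \<le> b and becomes the envelope
  with exponent \<open>min (mesh_exponent \<beta> \<theta>) 0\<close>.\<close>

definition kernel_const :: "real \<Rightarrow> real \<Rightarrow> real \<Rightarrow> real \<Rightarrow> real \<Rightarrow> real \<Rightarrow> real" where
  "kernel_const \<beta> H U \<kappa> K \<theta> = spline_const \<beta> H U \<kappa> K * (2 * \<theta> * U\<^sup>2) powr (\<beta> + 1) / \<kappa>\<^sup>2 *
     U powr max (mesh_exponent \<beta> \<theta>) 0"

text \<open>Every cell length is at most 2 * \<theta> * U ^ 3 / m.\<close>

definition app_const :: "real \<Rightarrow> real \<Rightarrow> real \<Rightarrow> real \<Rightarrow> real \<Rightarrow> real \<Rightarrow> real" where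
  "app_const \<beta> H U \<kappa> K \<theta> = spline_const \<beta> H U \<kappa> K * (2 * \<theta> * U ^ 3) powr \<beta>"

definition fwd_const :: "real \<Rightarrow> real \<Rightarrow> real \<Rightarrow> real \<Rightarrow> real \<Rightarrow> real \<Rightarrow> real \<Rightarrow> real \<Rightarrow> real \<Rightarrow> real" where
  "fwd_const \<beta> H U \<kappa> K \<theta> r0 \<alpha> C\<^sub>\<nu> =
     (let Q = moment_const \<kappa> K (min (mesh_exponent \<beta> \<theta>) 0) r0 \<alpha> C\<^sub>\<nu>
      in kernel_const \<beta> H U \<kappa> K \<theta> * sqrt (2 * K\<^sup>2 * ((K / \<kappa> * (1 + Q))\<^sup>2 + Q)))"

lemma mesh_exponent_gt:
  assumes "1 < \<beta>" "(2 * \<beta> + 2) / (2 * \<beta> + 1) < \<theta>"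
  shows "1 < \<theta>" "0 < 1 + 2 * min (mesh_exponent \<beta> \<theta>) 0"
proof -
  have "1 < (2 * \<beta> + 2) / (2 * \<beta> + 1)" using assms(1) by (simp add: less_divide_eq)
  then show \<theta>: "1 < \<theta>" using assms(2) by linarith
  have "2 * \<beta> + 2 < \<theta> * (2 * \<beta> + 1)" using assms by (simp add: divide_less_eq)
  then have "(2 * \<beta> + 2) / \<theta> < 2 * \<beta> + 1" using \<theta> by (simp add: divide_less_eq mult.commute)
  moreover have "1 + 2 * mesh_exponent \<beta> \<theta> = 2 * \<beta> + 1 - (2 * \<beta> + 2) / \<theta>"
    by (simp add: mesh_exponent_def algebra_simps add_divide_distrib)
  ultimately show "0 < 1 + 2 * min (mesh_exponent \<beta> \<theta>) 0" by (auto simp: min_def)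
qed

lemma mesh_kernel_bound:
  assumes "0 \<le> C" "0 < \<kappa>" "1 \<le> U" "1 < \<theta>" "0 < m" "1 < \<beta>"
    and x: "0 < x" "x \<le> b" "b \<le> U" "a < b" "b - a \<le> 2 * \<theta> * U\<^sup>2 * b powr (1 - 1 / \<theta>) / real m"
  shows "C * (b - a) powr (\<beta> - 1) * (b - a)\<^sup>2 / (b * \<kappa>\<^sup>2) \<le>
    (C * (2 * \<theta> * U\<^sup>2) powr (\<beta> + 1) / \<kappa>\<^sup>2 * U powr max (mesh_exponent \<beta> \<theta>) 0 * real m powr (- (\<beta> + 1))) *
      x powr min (mesh_exponent \<beta> \<theta>) 0"
proof -
  define h where "h = b - a"
  define \<gamma> where "\<gamma> = mesh_exponent \<beta> \<theta>"
  define G where "G = 2 * \<theta> * U\<^sup>2"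
  have b: "0 < b" and h: "0 < h" and G: "0 < G" using assms by (auto simp: h_def G_def)
  have "h powr (\<beta> - 1) * h\<^sup>2 = h powr (\<beta> - 1) * h powr 2" using h by simp
  also have "\<dots> = h powr (\<beta> + 1)" by (simp add: powr_add[symmetric] add.commute)
  also have "\<dots> \<le> (G * b powr (1 - 1 / \<theta>) / real m) powr (\<beta> + 1)"
    using h x(5) assms(6) by (intro powr_mono2) (auto simp: h_def G_def)
  also have "\<dots> = G powr (\<beta> + 1) * (b powr ((1 - 1 / \<theta>) * (\<beta> + 1)) * real m powr (- (\<beta> + 1)))"
    unfolding powr_minus_divide[of _ "\<beta> + 1"] using G b by (simp add: powr_divide powr_mult powr_powr)
  also have "b powr ((1 - 1 / \<theta>) * (\<beta> + 1)) = b powr \<gamma> * b"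
    using b by (simp add: \<gamma>_def mesh_exponent_def powr_diff)
  finally have 1: "h powr (\<beta> - 1) * h\<^sup>2 \<le> G powr (\<beta> + 1) * (b powr \<gamma> * b * real m powr (- (\<beta> + 1)))" .
  have "b powr \<gamma> = b powr max \<gamma> 0 * b powr min \<gamma> 0"
    by (simp add: max_def min_def b)
  also have "\<dots> \<le> U powr max \<gamma> 0 * x powr min \<gamma> 0"
    using b x by (intro mult_mono powr_mono2 powr_mono2') auto
  finally have 2: "b powr \<gamma> \<le> U powr max \<gamma> 0 * x powr min \<gamma> 0" .
  have "C * h powr (\<beta> - 1) * h\<^sup>2 / (b * \<kappa>\<^sup>2) = C / (b * \<kappa>\<^sup>2) * (h powr (\<beta> - 1) * h\<^sup>2)" by simp
  also have "\<dots> \<le> C / (b * \<kappa>\<^sup>2) * (G powr (\<beta> + 1) * (b powr \<gamma> * b * real m powr (- (\<beta> + 1))))"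
    using 1 assms(1) b by (intro mult_left_mono) auto
  also have "\<dots> = C * G powr (\<beta> + 1) / \<kappa>\<^sup>2 * real m powr (- (\<beta> + 1)) * b powr \<gamma>"
    using b by simp
  also have "\<dots> \<le> C * G powr (\<beta> + 1) / \<kappa>\<^sup>2 * real m powr (- (\<beta> + 1)) * (U powr max \<gamma> 0 * x powr min \<gamma> 0)"
    using 2 assms(1) by (intro mult_left_mono) auto
  finally show ?thesis by (simp add: h_def \<gamma>_def G_def mult_ac)
qed

section \<open>Approximation in the sieve\<close>

definition net_widths :: "real \<Rightarrow> nat \<Rightarrow> nat \<Rightarrow> nat" where
  "net_widths \<beta> m = (\<lambda>l. if l = 0 \<or> l = Suc (net_depth \<beta>) then 1 else (m + 1) * (spline_degree \<beta> + 2))"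

text \<open>Integrability is demanded along with each integral, since the Bochner integral of a
  nonintegrable function is 0 and the cancellation could otherwise hold vacuously.\<close>

definition sieve_target ::
  "nat \<Rightarrow> ((nat \<Rightarrow> real) \<Rightarrow> real) \<Rightarrow> real \<Rightarrow> (real \<Rightarrow> real) \<Rightarrow> real \<Rightarrow> nat \<Rightarrow> (nat \<Rightarrow> real) \<Rightarrow> real \<Rightarrow> real \<Rightarrow> (real \<Rightarrow> real) \<Rightarrow> bool" where
  "sieve_target d V vs \<Xi> U m r A F \<xi> \<longleftrightarrow>
     (\<forall>j\<in>{1..m}.
        set_integrable lborel {r (j - 1)..r j} (\<lambda>u. (\<xi> u - \<Xi> u) / (u * (\<Xi> u)\<^sup>2)) \<and>
        (LBINT u:{r (j - 1)..r j}. (\<xi> u - \<Xi> u) / (u * (\<Xi> u)\<^sup>2)) = 0) \<and>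
     sup_norm U (\<lambda>u. \<xi> u - \<Xi> u) \<le> ennreal A \<and>
     set_integrable (nu_law d V vs \<Xi>) {0<..} (\<lambda>r. (A_op d V vs \<Xi> (\<lambda>u. \<xi> u - \<Xi> u) r)\<^sup>2) \<and>
     sqrt (LINT r:{0<..}|nu_law d V vs \<Xi>. (A_op d V vs \<Xi> (\<lambda>u. \<xi> u - \<Xi> u) r)\<^sup>2) \<le> F"

text \<open>For large m the spline s is within \<eta> / 2 of \<Xi>, so (s - \<kappa>) / (K -
  \<kappa>) lies in [\<tau>, 1 - \<tau>], where S is the identity. The clamped network therefore
  reproduces s on [0, U], with its moments and its Hoelder norm.\<close>

lemma sieve_approximation:
  fixes S :: "real \<Rightarrow> real"
  assumes P: "cond_P d V vs" and "0 \<le> \<alpha>" and C: "cond_C \<kappa> K L \<Xi>"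
    and U: "max 1 (a_plus d V vs K) \<le> U" and \<beta>: "1 < \<beta>" and ball: "\<Xi> \<in> holder_ball \<beta> U H"
    and \<eta>: "0 < \<eta>" "\<And>r. r \<in> {0..U} \<Longrightarrow> \<kappa> + \<eta> \<le> \<Xi> r \<and> \<Xi> r \<le> K - \<eta>"
    and \<theta>: "(2 * \<beta> + 2) / (2 * \<beta> + 1) < \<theta>" and nu: "nu_log_bound d V vs \<Xi> r0 \<alpha> C\<^sub>\<nu>"
    and \<tau>: "0 < \<tau>" "\<tau> < \<eta> / (4 * (K - \<kappa>))"
    and S: "\<And>y z. \<bar>S y - S z\<bar> \<le> Lt * \<bar>y - z\<bar>" "\<And>z. z \<in> {\<tau>..1 - \<tau>} \<Longrightarrow> S z = z"
    and Cs: "Cs = real (2 * (net_depth \<beta> + 2) * (spline_degree \<beta> + 2) + 1)"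
  shows "\<exists>CB m0. \<forall>m\<ge>m0. \<forall>r. graded_mesh U \<theta> m r \<longrightarrow>
    (\<exists>\<xi>\<in>sieve \<beta> U \<kappa> K S (spline_const \<beta> H U \<kappa> K) (net_depth \<beta>) (net_widths \<beta> m) (nat \<lceil>Cs * real m\<rceil>) (real m powr CB).
       sieve_target d V vs \<Xi> U m r (app_const \<beta> H U \<kappa> K \<theta> * real m powr (- \<beta>))
         (fwd_const \<beta> H U \<kappa> K \<theta> r0 \<alpha> C\<^sub>\<nu> * real m powr (- (\<beta> + 1))) \<xi>)"
proof -
  define n where "n = spline_degree \<beta>"
  define q where "q = net_depth \<beta>"
  define N1 where "N1 = real (Suc n)"
  define C0 where "C0 = spline_const \<beta> H U \<kappa> K"
  define E where "E = C0 * max 1 (U powr \<beta>)"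
  define Bd where "Bd = 1 + U + E * (2 * N1) ^ n / (K - \<kappa>) + \<kappa> / (K - \<kappa>)"
  \<comment> \<open>\<open>Bd\<close> collects the bounds free of m on shifts, output weights and
    output bias. The power \<theta> * n stems from the smallest cell, and m \<ge> 2 turns
    \<open>Bd\<close> into at most m to the power log 2 Bd.\<close>
  define CB where "CB = \<theta> * real n + log 2 Bd"
  define app where "app = app_const \<beta> H U \<kappa> K \<theta>"
  have n: "n = 2 ^ q" "0 < n" and q: "1 \<le> q"
    by (auto simp: n_def q_def spline_degree_def net_depth_def)
  have kap: "0 < \<kappa>" "\<kappa> < K" "0 < K - \<kappa>" using cond_C_bounds(1,2)[OF C] by auto
  have U1: "1 \<le> U" "0 < U" "a_plus d V vs K \<le> U" using U by auto
  have \<theta>1: "1 < \<theta>" and \<gamma>: "0 < 1 + 2 * min (mesh_exponent \<beta> \<theta>) 0" using mesh_exponent_gt[OF \<beta> \<theta>] by auto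
  \<comment> \<open>For negative H the bound \<open>ennreal H\<close> is 0, and the ball would
    contain only functions vanishing on [0, U], whereas \<Xi> is at least \<kappa> > 0.\<close>
  have H0: "0 \<le> H"
  proof (rule ccontr)
    assume "\<not> 0 \<le> H"
    then have "ennreal H = ennreal 0" by (simp add: ennreal_neg)
    then have "\<Xi> \<in> holder_ball \<beta> U 0" using ball unfolding holder_ball_def by simp
    then have "\<bar>\<Xi> 0\<bar> \<le> 0" using holder_ballD(2)[of \<Xi> \<beta> U 0 0 0] U1 by simp
    then show False using \<eta>(1) \<eta>(2)[of 0] U1 kap by simp
  qed
  have C0: "0 \<le> C0" and spline: "spline_property \<beta> H U \<kappa> K C0"
    using spline_const[OF \<beta> H0 kap(1) U1(2), of K] by (auto simp: C0_def spline_property_def)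
  have E: "C0 \<le> E" "C0 * U powr \<beta> \<le> E" "0 \<le> E"
    using C0 by (auto simp: E_def mult_left_mono mult_le_cancel_left1)
  have N1: "1 \<le> N1" by (simp add: N1_def)
  have Bd: "1 \<le> Bd" "U \<le> Bd" "E * (2 * N1) ^ n / (K - \<kappa>) \<le> Bd" "\<kappa> / (K - \<kappa>) \<le> Bd"
    using U1 E N1 kap by (auto simp: Bd_def)
  have app: "0 \<le> app" using C0 by (simp add: app_def app_const_def C0_def)
  obtain m1 where m1: "2 \<le> m1" "\<And>m r. m1 \<le> m \<Longrightarrow> graded_mesh U \<theta> m r \<Longrightarrow>
    r 0 = 0 \<and> r m = U \<and> (\<exists>i\<le>m. r i = 1) \<and>
    (\<forall>j<m. r j < r (Suc j) \<and> r (Suc j) - r j \<le> 2 * \<theta> * U\<^sup>2 * r (Suc j) powr (1 - 1 / \<theta>) / real m \<and>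
       real m powr (- \<theta>) / 2 \<le> r (Suc j) - r j)"
    using graded_mesh_bounds[OF U1(1) \<theta>1] by blast
  \<comment> \<open>The second entry, with \<beta> > 1, makes the approximation error at most \<eta>
    / 2.\<close>
  define m0 where "m0 = max m1 (nat \<lceil>2 * app / \<eta>\<rceil>)"
  have "\<exists>\<xi>\<in>sieve \<beta> U \<kappa> K S C0 q (net_widths \<beta> m) (nat \<lceil>Cs * real m\<rceil>) (real m powr CB).
       sieve_target d V vs \<Xi> U m r (app * real m powr (- \<beta>))
         (fwd_const \<beta> H U \<kappa> K \<theta> r0 \<alpha> C\<^sub>\<nu> * real m powr (- (\<beta> + 1))) \<xi>"
    if m: "m0 \<le> m" and gm: "graded_mesh U \<theta> m r" for m r
  proof -
    have m2: "2 \<le> m" "m1 \<le> m" "2 * app / \<eta> \<le> real m"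
      using m m1(1) unfolding m0_def by auto
    have mpos: "0 < m" "0 < real m" "1 \<le> real m" "2 \<le> real m" using m2 by auto
    note mesh = m1(2)[OF m2(2) gm]
    have r0m: "r 0 = 0" "r m = U" using mesh by auto
    obtain i0 where i0: "i0 \<le> m" "r i0 = 1" using mesh by blast
    have rlt: "r j < r (Suc j)" if "j < m" for j using mesh that by blast
    have hup: "r (Suc j) - r j \<le> 2 * \<theta> * U\<^sup>2 * r (Suc j) powr (1 - 1 / \<theta>) / real m" if "j < m" for j
      using mesh that by blast
    have hlow: "real m powr (- \<theta>) / 2 \<le> r (Suc j) - r j" if "j < m" for j using mesh that by blast
    have rmono: "r i \<le> r j" if "i \<le> j" "j \<le> m" for i j
      using mesh_mono[of m r, OF rlt that] by simp
    have rU: "0 \<le> r j \<and> r j \<le> U" if "j \<le> m" for j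
      using rmono[of 0 j] rmono[of j m] that r0m by auto
    have hU: "r (Suc j) - r j \<le> U" if "j < m" for j using rU[of j] rU[of "Suc j"] that by auto
    have hm: "r (Suc j) - r j \<le> 2 * \<theta> * U ^ 3 / real m" if "j < m" for j
    proof -
      have "r (Suc j) powr (1 - 1 / \<theta>) \<le> U powr (1 - 1 / \<theta>)"
        using rU[of "Suc j"] that \<theta>1 by (intro powr_mono2) auto
      also have "\<dots> \<le> U powr 1" using U1 \<theta>1 by (intro powr_mono) auto
      finally have "2 * \<theta> * U\<^sup>2 * r (Suc j) powr (1 - 1 / \<theta>) / real m \<le> 2 * \<theta> * U\<^sup>2 * U / real m"
        using \<theta>1 U1 by (intro divide_right_mono mult_left_mono) auto
      then show ?thesis using hup[OF that] by (simp add: power2_eq_square power3_eq_cube mult.assoc)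
    qed
    have \<Xi>U: "\<forall>x\<in>{0..U}. \<kappa> \<le> \<Xi> x \<and> \<Xi> x \<le> K"
      using cond_C_bounds(3,4)[OF C] by auto
    have "\<exists>e0 e. mesh_interpolant \<beta> n C0 U \<Xi> m r e0 e"
      by (rule spline[unfolded spline_property_def, folded n_def, THEN conjunct2, rule_format, of \<Xi> m r,
          OF ball \<Xi>U[rule_format] mpos(1) r0m rlt]; assumption)
    then obtain e0 e where "mesh_interpolant \<beta> n C0 U \<Xi> m r e0 e" by blast
    note sp = this[unfolded mesh_interpolant_def Let_def]
    have e0: "\<bar>e0 i\<bar> \<le> C0" if "i \<le> Suc n" for i using sp that by blast
    have e: "\<bar>e j i\<bar> \<le> C0 * (r (Suc j) - r j) powr \<beta>" if "j < m" "i \<le> Suc n" for j i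
      using sp that by blast
    have sball: "mesh_spline n e0 e r m 0 \<in> holder_ball \<beta> U C0" using sp by blast
    have scell: "\<bar>mesh_spline n e0 e r m 0 x - \<Xi> x\<bar> \<le> C0 * (r (Suc j) - r j) powr (\<beta> - 1) * (x - r j)"
      if "j < m" "x \<in> {r j..r (Suc j)}" for j x using sp that by blast
    have smom: "(LBINT x:{r j..r (Suc j)}. (mesh_spline n e0 e r m 0 x - \<Xi> x) / (x * (\<Xi> x)\<^sup>2)) = 0"
      if "j < m" for j using sp that by blast
    define s where "s = mesh_spline n e0 e r m 0"
    have sapp: "\<bar>s x - \<Xi> x\<bar> \<le> app * real m powr (- \<beta>)" if x: "x \<in> {0..U}" for x
    proof -
      obtain j where j: "j < m" "r j \<le> x" "x \<le> r (Suc j)"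
        using mesh_cell_exists[of r x m] x r0m mpos(1) by auto
      define h where "h = r (Suc j) - r j"
      have h: "0 < h" using rlt[OF j(1)] by (simp add: h_def)
      have "\<bar>s x - \<Xi> x\<bar> \<le> C0 * h powr (\<beta> - 1) * (x - r j)"
        using scell[OF j(1), of x] j by (simp add: s_def h_def)
      also have "\<dots> \<le> C0 * h powr (\<beta> - 1) * h"
        using C0 j by (intro mult_left_mono) (auto simp: h_def)
      also have "\<dots> = C0 * h powr \<beta>" using h by (simp add: powr_diff)
      also have "\<dots> \<le> C0 * (2 * \<theta> * U ^ 3 / real m) powr \<beta>"
        using C0 h hm[OF j(1)] \<beta> by (intro mult_left_mono powr_mono2) (auto simp: h_def)
      also have "(2 * \<theta> * U ^ 3 / real m) powr \<beta> = (2 * \<theta> * U ^ 3) powr \<beta> * real m powr (- \<beta>)"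
        using U1 \<theta>1 mpos by (simp add: powr_divide powr_minus_divide)
      finally show ?thesis by (simp add: app_def app_const_def C0_def mult.assoc)
    qed
    have small: "app * real m powr (- \<beta>) \<le> \<eta> / 2"
    proof -
      have "real m powr (- \<beta>) \<le> real m powr (- 1)" using mpos \<beta> by (intro powr_mono) auto
      then have "app * real m powr (- \<beta>) \<le> app * real m powr (- 1)" using app by (rule mult_left_mono)
      also have "\<dots> = app / real m" using mpos by (simp add: powr_minus_divide)
      also have "\<dots> \<le> \<eta> / 2" using m2(3) mpos \<eta>(1) by (simp add: field_simps)
      finally show ?thesis .
    qed
    define \<delta> where "\<delta> = real m powr (- \<theta>) / 2"
    have \<delta>: "0 < \<delta>" "\<delta> \<le> 1"
    proof -
      show "0 < \<delta>" using mpos by (simp add: \<delta>_def)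
      have "real m powr (- \<theta>) \<le> real m powr 0" using mpos \<theta>1 by (intro powr_mono) auto
      then show "\<delta> \<le> 1" using mpos by (simp add: \<delta>_def)
    qed
    have eE: "\<bar>e j i\<bar> \<le> E" if "j < m" "i \<le> Suc n" for i j
    proof -
      have "C0 * (r (Suc j) - r j) powr \<beta> \<le> C0 * U powr \<beta>"
        using C0 rlt[OF that(1)] hU[OF that(1)] \<beta> by (intro mult_left_mono powr_mono2) auto
      then show ?thesis using e[OF that] E by linarith
    qed
    define M where "M = (m + 1) * (n + 2)"
    have "\<exists>t d. (\<forall>i<M. \<bar>t i\<bar> \<le> U \<and> \<bar>d i\<bar> \<le> E * (N1 / \<delta>) ^ n) \<and>
        (\<forall>x. s x = (\<Sum>i<M. d i * tp n (x - t i)))"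
      unfolding M_def N1_def s_def
    proof (rule mesh_spline_as_truncated_powers[OF n(2) U1(1) _ \<delta>])
      show "\<delta> \<le> r (Suc j) - r j" if "j < m" for j using hlow[OF that] by (simp add: \<delta>_def)
      show "\<bar>e0 i\<bar> \<le> E" if "i \<le> Suc n" for i using e0[OF that] E(1) by linarith
    qed (use rU eE in auto)
    then obtain t d' where td: "\<And>i. i < M \<Longrightarrow> \<bar>t i\<bar> \<le> U \<and> \<bar>d' i\<bar> \<le> E * (N1 / \<delta>) ^ n"
      and s_eq: "\<And>x. s x = (\<Sum>i<M. d' i * tp n (x - t i))"
      by blast
    define B where "B = real m powr CB"
    have B: "real m powr (\<theta> * real n) * Bd \<le> B"
    proof -
      have "Bd = 2 powr log 2 Bd" using Bd by simp
      also have "\<dots> \<le> real m powr log 2 Bd" using mpos Bd by (intro powr_mono2) auto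
      finally show ?thesis unfolding B_def CB_def powr_add by (intro mult_left_mono) auto
    qed
    have mth: "1 \<le> real m powr (\<theta> * real n)" using mpos \<theta>1 by (intro ge_one_powr_ge_zero) auto
    have BdB: "Bd \<le> B" using mult_right_mono[OF mth, of Bd] Bd B by linarith
    have dB: "\<bar>d' i / (K - \<kappa>)\<bar> \<le> B" if "i < M" for i
    proof -
      have "N1 / \<delta> = (2 * N1) * real m powr \<theta>"
        using mpos by (simp add: \<delta>_def powr_minus_divide)
      then have "(N1 / \<delta>) ^ n = (2 * N1) ^ n * (real m powr \<theta>) ^ n"
        by (simp only: power_mult_distrib)
      also have "(real m powr \<theta>) ^ n = real m powr (\<theta> * real n)"
        using mpos by (simp add: powr_realpow[symmetric] powr_powr)
      finally have "\<bar>d' i\<bar> / (K - \<kappa>) \<le> E * ((2 * N1) ^ n * real m powr (\<theta> * real n)) / (K - \<kappa>)"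
        using td[OF that] kap by (intro divide_right_mono) auto
      also have "\<dots> = real m powr (\<theta> * real n) * (E * (2 * N1) ^ n / (K - \<kappa>))" by simp
      also have "\<dots> \<le> real m powr (\<theta> * real n) * Bd" using Bd by (intro mult_left_mono) auto
      finally show ?thesis using B kap by (simp add: abs_divide)
    qed
    \<comment> \<open>Weights and output bias incorporate the inverse of the affine map v \<mapsto>
      \<kappa> + (K - \<kappa>) * v that the sieve applies after S.\<close>
    define Nt where "Nt = (\<lambda>x. (\<Sum>i<M. d' i / (K - \<kappa>) * tp (2 ^ q) (x - t i)) + (- \<kappa> / (K - \<kappa>)))"
    have "Nt \<in> NN q (\<lambda>l. if l = 0 \<or> l = Suc q then 1 else M) (nat \<lceil>Cs * real m\<rceil>) B"
      unfolding Nt_def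
    proof (rule truncated_powers_in_NN[OF q])
      show "1 \<le> B" using Bd BdB by linarith
      show "\<bar>t i\<bar> \<le> B" if "i < M" for i using td[OF that] Bd BdB by linarith
      show "\<bar>d' i / (K - \<kappa>)\<bar> \<le> B" if "i < M" for i using dB[OF that] .
      show "\<bar>- \<kappa> / (K - \<kappa>)\<bar> \<le> B" using Bd BdB kap by simp
      \<comment> \<open>The number of cells including the extra one is m + 1 \<le> 2 * m, which
        explains the factor 2 in \<open>Cs\<close>.\<close>
      have "(q + 2) * M + 1 \<le> (2 * (q + 2) * (n + 2) + 1) * m"
      proof -
        have "(q + 2) * ((m + 1) * (n + 2)) \<le> (q + 2) * ((2 * m) * (n + 2))"
          using mpos by (intro mult_le_mono) auto
        then show ?thesis using mpos(1) unfolding M_def by (simp add: algebra_simps)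
      qed
      then have "real ((q + 2) * M + 1) \<le> Cs * real m"
        unfolding Cs n_def[symmetric] q_def[symmetric] of_nat_mult[symmetric] of_nat_le_iff .
      then show "(q + 2) * M + 1 \<le> nat \<lceil>Cs * real m\<rceil>" by linarith
    qed
    then have NtNN: "Nt \<in> NN q (net_widths \<beta> m) (nat \<lceil>Cs * real m\<rceil>) B"
      unfolding net_widths_def q_def M_def n_def .
    have Nt: "Nt x = (s x - \<kappa>) / (K - \<kappa>)" for x
      unfolding Nt_def s_eq n(1) by (simp add: sum_divide_distrib diff_divide_distrib)
    define \<xi> where "\<xi> = (\<lambda>r. \<kappa> + (K - \<kappa>) * S (Nt (min r U)))"
    have \<xi>s: "\<xi> x = s x" if x: "x \<in> {0..U}" for x
    proof -
      have sx: "\<kappa> + \<eta> / 2 \<le> s x" "s x \<le> K - \<eta> / 2"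
        using sapp[OF x] small \<eta>(2)[OF x] by (auto simp: abs_le_iff)
      have \<tau>': "\<tau> * (K - \<kappa>) \<le> \<eta> / 2"
      proof -
        have "\<tau> * (K - \<kappa>) * 4 < \<eta>" using \<tau>(2) kap by (simp add: less_divide_eq algebra_simps)
        then show ?thesis using mult_pos_pos[OF \<tau>(1) kap(3)] by linarith
      qed
      have "\<tau> \<le> (s x - \<kappa>) / (K - \<kappa>)" using sx \<tau>' kap by (simp add: le_divide_eq)
      moreover have "(s x - \<kappa>) / (K - \<kappa>) \<le> 1 - \<tau>"
      proof -
        have "\<tau> * (K - \<kappa>) \<le> K - s x" using sx(2) order_trans[OF \<tau>', of "K - s x"] by linarith
        then have "s x - \<kappa> \<le> (1 - \<tau>) * (K - \<kappa>)" by (simp add: algebra_simps)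
        then show ?thesis using kap by (simp add: pos_divide_le_eq)
      qed
      ultimately have "S (Nt x) = (s x - \<kappa>) / (K - \<kappa>)" unfolding Nt by (intro S(2)) auto
      then show ?thesis using x kap by (simp add: \<xi>_def)
    qed
    have "\<xi> \<in> holder_ball \<beta> U C0"
      by (rule holder_ball_cong[OF U1(2) _ sball]) (simp add: \<xi>s s_def)
    then have \<xi>sieve: "\<xi> \<in> sieve \<beta> U \<kappa> K S C0 q (net_widths \<beta> m) (nat \<lceil>Cs * real m\<rceil>) (real m powr CB)"
      using NtNN unfolding sieve_def \<xi>_def B_def by blast
    define h where "h = (\<lambda>u. \<xi> u - \<Xi> u)"
    have contS: "continuous_on UNIV S"
    proof (rule lipschitz_on_continuous_on)
      show "\<bar>Lt\<bar>-lipschitz_on UNIV S"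
      proof (rule lipschitz_onI)
        fix x y
        have "\<bar>S x - S y\<bar> \<le> Lt * \<bar>x - y\<bar>" by (rule S(1))
        also have "\<dots> \<le> \<bar>Lt\<bar> * \<bar>x - y\<bar>" by (intro mult_right_mono) auto
        finally show "dist (S x) (S y) \<le> \<bar>Lt\<bar> * dist x y" by (simp add: dist_real_def)
      qed simp
    qed
    have "continuous_on UNIV (\<lambda>x. Nt (min x U))"
      unfolding Nt_def by (intro continuous_intros)
    then have "continuous_on UNIV (\<lambda>x. S (Nt (min x U)))"
      by (rule continuous_on_compose2[OF contS]) simp
    then have "continuous_on UNIV \<xi>"
      unfolding \<xi>_def by (intro continuous_on_add continuous_on_mult continuous_on_const)
    then have "continuous_on {0..} \<xi>" by (rule continuous_on_subset) simp
    then have ch: "continuous_on {0..} h"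
      unfolding h_def by (intro continuous_intros cond_C_continuous[OF C])
    have inU: "x \<in> {0..U}" if "j < m" "x \<in> {r j..r (Suc j)}" for j x
      using that rU[of j] rU[of "Suc j"] by auto
    have hM: "\<bar>h x\<bar> \<le> C0 * (r (Suc j) - r j) powr (\<beta> - 1) * (x - r j)" if "j < m" "x \<in> {r j..r (Suc j)}" for j x
      using scell[OF that] \<xi>s[OF inU[OF that]] by (simp add: h_def s_def)
    have hmom: "(LBINT x:{r j..r (Suc j)}. h x / (x * (\<Xi> x)\<^sup>2)) = 0" if "j < m" for j
    proof -
      have "(LBINT x:{r j..r (Suc j)}. h x / (x * (\<Xi> x)\<^sup>2)) =
          (LBINT x:{r j..r (Suc j)}. (mesh_spline n e0 e r m 0 x - \<Xi> x) / (x * (\<Xi> x)\<^sup>2))"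
        by (intro set_lebesgue_integral_cong) (use \<xi>s[OF inU[OF that]] in \<open>auto simp: h_def s_def\<close>)
      then show ?thesis using smom[OF that] by simp
    qed
    have hint: "set_integrable lborel {r j..r (Suc j)} (\<lambda>u. h u / (u * (\<Xi> u)\<^sup>2))" if "j < m" for j
    proof (rule weighted_integral_bound(1)[where \<kappa> = \<kappa> and M = "C0 * (r (Suc j) - r j) powr (\<beta> - 1)"])
      have sub: "{r j..r (Suc j)} \<subseteq> {0..}" using inU[OF that] by auto
      show "continuous_on {r j..r (Suc j)} h" "continuous_on {r j..r (Suc j)} \<Xi>"
        using continuous_on_subset[OF ch sub] continuous_on_subset[OF cond_C_continuous[OF C] sub] by auto
      show "\<kappa> \<le> \<Xi> u" if "u \<in> {r j..r (Suc j)}" for u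
        using \<Xi>U inU[OF \<open>j < m\<close> that] by auto
    qed (use that rlt rU kap hM in auto)
    note mesh_facts = C ch r0m(1) rlt i0 hM hmom
    define \<gamma>0 where "\<gamma>0 = min (mesh_exponent \<beta> \<theta>) 0"
    define D where "D = kernel_const \<beta> H U \<kappa> K \<theta> * real m powr (- (\<beta> + 1))"
    define Q where "Q = moment_const \<kappa> K \<gamma>0 r0 \<alpha> C\<^sub>\<nu>"
    have "moment_property \<kappa> K \<gamma>0 r0 \<alpha> C\<^sub>\<nu> Q"
      unfolding Q_def using kap \<gamma> assms(2) by (intro moment_const) (auto simp: \<gamma>0_def)
    then have Q: "0 \<le> Q" "(\<integral>\<^sup>+ s\<in>{vs<..}. ennreal (q_fun d V vs \<Xi> s) *
        ennreal ((q_fun d V vs \<Xi> s powr \<gamma>0)\<^sup>2) * m_V d V s \<partial>lebesgue) \<le> ennreal Q"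
      using P C nu unfolding moment_property_def by blast+
    have D: "0 \<le> D" using C0 kap by (simp add: D_def kernel_const_def C0_def)
    have Kh: "\<bar>K_op \<Xi> h x\<bar> \<le> D * x powr \<gamma>0" if x: "0 < x" "x \<le> U" for x
    proof -
      obtain j where j: "j < m" "r j \<le> x" "x \<le> r (Suc j)"
        using mesh_cell_exists[of r x m] x r0m mpos(1) by auto
      have "\<bar>K_op \<Xi> h x\<bar> \<le> C0 * (r (Suc j) - r j) powr (\<beta> - 1) * (r (Suc j) - r j)\<^sup>2 / (r (Suc j) * \<kappa>\<^sup>2)"
        using j x by (intro K_op_mesh_bound[OF mesh_facts]) auto
      also have "\<dots> \<le> D * x powr \<gamma>0"
        unfolding D_def kernel_const_def C0_def[symmetric] \<gamma>0_def
        using C0 kap U1 \<theta>1 mpos \<beta> x j rU[of "Suc j"] rlt hup by (intro mesh_kernel_bound) auto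
      finally show ?thesis .
    qed
    have fw: "set_integrable (nu_law d V vs \<Xi>) {0<..} (\<lambda>r. (A_op d V vs \<Xi> h r)\<^sup>2)"
      "sqrt (LINT r:{0<..}|nu_law d V vs \<Xi>. (A_op d V vs \<Xi> h r)\<^sup>2) \<le>
        D * sqrt (2 * K\<^sup>2 * ((K / \<kappa> * (1 + Q))\<^sup>2 + Q))"
      by (rule forward_bound[OF P C U1(3) K_op_continuous[OF mesh_facts] Kh _ _ D Q]; simp)+
    show ?thesis
      unfolding sieve_target_def
    proof (intro bexI[OF _ \<xi>sieve] conjI ballI)
      fix j assume "j \<in> {1..m}"
      then obtain j' where j': "j = Suc j'" "j' < m" by (cases j) auto
      show "set_integrable lborel {r (j - 1)..r j} (\<lambda>u. (\<xi> u - \<Xi> u) / (u * (\<Xi> u)\<^sup>2))"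
        "(LBINT u:{r (j - 1)..r j}. (\<xi> u - \<Xi> u) / (u * (\<Xi> u)\<^sup>2)) = 0"
        using hint[OF j'(2)] hmom[OF j'(2)] by (simp_all add: j'(1) h_def)
    next
      show "sup_norm U (\<lambda>u. \<xi> u - \<Xi> u) \<le> ennreal (app * real m powr (- \<beta>))"
        using sapp \<xi>s app by (simp add: sup_norm_le_iff)
      show "set_integrable (nu_law d V vs \<Xi>) {0<..} (\<lambda>r. (A_op d V vs \<Xi> (\<lambda>u. \<xi> u - \<Xi> u) r)\<^sup>2)"
        using fw(1) by (simp add: h_def)
      show "sqrt (LINT r:{0<..}|nu_law d V vs \<Xi>. (A_op d V vs \<Xi> (\<lambda>u. \<xi> u - \<Xi> u) r)\<^sup>2)
         \<le> fwd_const \<beta> H U \<kappa> K \<theta> r0 \<alpha> C\<^sub>\<nu> * real m powr (- (\<beta> + 1))"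
        using fw(2) by (simp add: h_def fwd_const_def Let_def D_def Q_def \<gamma>0_def mult_ac)
    qed
  qed
  then show ?thesis unfolding C0_def q_def app_def by blast
qed

theorem lemma4p2:
  "\<exists>(C_app :: real \<Rightarrow> real \<Rightarrow> real \<Rightarrow> real \<Rightarrow> real \<Rightarrow> real \<Rightarrow> real)
    (C_fwd :: real \<Rightarrow> real \<Rightarrow> real \<Rightarrow> real \<Rightarrow> real \<Rightarrow> real \<Rightarrow> real \<Rightarrow> real \<Rightarrow> real \<Rightarrow> real)
    (C_ent :: nat \<Rightarrow> real \<Rightarrow> real \<Rightarrow> real \<Rightarrow> real \<Rightarrow> real \<Rightarrow> real \<Rightarrow> real \<Rightarrow> real).
    \<forall>(d :: nat) (V :: (nat \<Rightarrow> real) \<Rightarrow> real) (vs :: real) (\<alpha> :: real)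
      (\<kappa> :: real) (K :: real) (L :: real) (\<Xi>0 :: real \<Rightarrow> real)
      (\<beta> :: real) (H :: real) (U :: real) (\<eta>0 :: real) (\<theta> :: real)
      (r0 :: real) (C\<^sub>\<nu> :: real) (\<tau> :: real) (S :: real \<Rightarrow> real) (L\<^sub>\<tau> :: real).
      cond_P d V vs \<and> cond_G d V vs \<alpha> \<and> cond_C \<kappa> K L \<Xi>0 \<and>
      max 1 (a_plus d V vs K) \<le> U \<and>
      1 < \<beta> \<and> \<Xi>0 \<in> holder_ball \<beta> U H \<and>
      0 < \<eta>0 \<and> (\<forall>r\<in>{0..U}. \<kappa> + \<eta>0 \<le> \<Xi>0 r \<and> \<Xi>0 r \<le> K - \<eta>0) \<and>
      (2 * \<beta> + 2) / (2 * \<beta> + 1) < \<theta> \<and>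
      nu_log_bound d V vs \<Xi>0 r0 \<alpha> C\<^sub>\<nu> \<and>
      0 < \<tau> \<and> \<tau> < \<eta>0 / (4 * (K - \<kappa>)) \<and>
      (\<forall>z. S z \<in> {0..1}) \<and> (\<forall>y z. \<bar>S y - S z\<bar> \<le> L\<^sub>\<tau> * \<bar>y - z\<bar>) \<and> (\<forall>z\<in>{\<tau>..1 - \<tau>}. S z = z)
      \<longrightarrow>
      (\<exists>(L_net :: nat) (C_p :: real) (C_s :: real) (C_B :: real) (m0 :: nat) (H1 :: real)
         (p :: nat \<Rightarrow> nat \<Rightarrow> nat) (B :: nat \<Rightarrow> real) (X :: nat \<Rightarrow> (real \<Rightarrow> real) set).
         (\<forall>m\<ge>1. (\<forall>j\<le>L_net + 1. real (p m j) \<le> C_p * real m) \<and> B m \<le> real m powr C_B) \<and>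
         (\<forall>m. X m = sieve \<beta> U \<kappa> K S H1 L_net (p m) (nat \<lceil>C_s * real m\<rceil>) (B m)) \<and>
         (\<forall>m\<ge>m0. \<forall>r. graded_mesh U \<theta> m r \<longrightarrow>
            (\<exists>\<xi>\<in>X m.
               (\<forall>j\<in>{1..m}.
                  set_integrable lborel {r (j - 1)..r j} (\<lambda>u. (\<xi> u - \<Xi>0 u) / (u * (\<Xi>0 u)\<^sup>2)) \<and>
                  (LBINT u:{r (j - 1)..r j}. (\<xi> u - \<Xi>0 u) / (u * (\<Xi>0 u)\<^sup>2)) = 0) \<and>
               sup_norm U (\<lambda>u. \<xi> u - \<Xi>0 u)
                 \<le> ennreal (C_app \<beta> H U \<kappa> K \<theta> * real m powr (- \<beta>)) \<and>
               set_integrable (nu_law d V vs \<Xi>0) {0<..}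
                 (\<lambda>r. (A_op d V vs \<Xi>0 (\<lambda>u. \<xi> u - \<Xi>0 u) r)\<^sup>2) \<and>
               sqrt (LINT r:{0<..}|nu_law d V vs \<Xi>0. (A_op d V vs \<Xi>0 (\<lambda>u. \<xi> u - \<Xi>0 u) r)\<^sup>2)
                 \<le> C_fwd \<beta> H U \<kappa> K \<theta> r0 \<alpha> C\<^sub>\<nu> * real m powr (- (\<beta> + 1)))) \<and>
         0 < C_ent L_net C_p C_s C_B U \<kappa> K L\<^sub>\<tau> \<and>
         (\<forall>m\<ge>1. \<forall>\<epsilon>\<in>{0<..1}.
            covering_number U \<epsilon> (X m) \<noteq> \<infinity> \<and>
            ln (real (the_enat (covering_number U \<epsilon> (X m))))
              \<le> C_ent L_net C_p C_s C_B U \<kappa> K L\<^sub>\<tau> * real m *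
                 ln (C_ent L_net C_p C_s C_B U \<kappa> K L\<^sub>\<tau> * real m / \<epsilon>)))"
proof (rule exI[of _ app_const], rule exI[of _ fwd_const], rule exI[of _ entropy_const], intro allI impI, goal_cases)
  case prems: (1 d V vs \<alpha> \<kappa> K L \<Xi>0 \<beta> H U \<eta>0 \<theta> r0 C\<^sub>\<nu> \<tau> S L\<^sub>\<tau>)
  then have \<alpha>: "0 \<le> \<alpha>" and U: "1 \<le> U" and \<kappa>: "\<kappa> < K" unfolding cond_G_def cond_C_def by auto
  define Lnet where "Lnet = net_depth \<beta>"
  define Cp where "Cp = real (2 * (spline_degree \<beta> + 2))"
  define Cs where "Cs = real (2 * (net_depth \<beta> + 2) * (spline_degree \<beta> + 2) + 1)"
  define H1 where "H1 = spline_const \<beta> H U \<kappa> K"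
  obtain CB m0 where main: "\<forall>m\<ge>m0. \<forall>r. graded_mesh U \<theta> m r \<longrightarrow>
    (\<exists>\<xi>\<in>sieve \<beta> U \<kappa> K S H1 Lnet (net_widths \<beta> m) (nat \<lceil>Cs * real m\<rceil>) (real m powr CB).
       sieve_target d V vs \<Xi>0 U m r (app_const \<beta> H U \<kappa> K \<theta> * real m powr (- \<beta>))
         (fwd_const \<beta> H U \<kappa> K \<theta> r0 \<alpha> C\<^sub>\<nu> * real m powr (- (\<beta> + 1))) \<xi>)"
    unfolding Lnet_def H1_def
    using sieve_approximation[of d V vs \<alpha> \<kappa> K L \<Xi>0 U \<beta> H \<eta>0 \<theta> r0 C\<^sub>\<nu> \<tau> S L\<^sub>\<tau> Cs] prems \<alpha> Cs_def by blast
  have widths: "real (net_widths \<beta> m j) \<le> Cp * real m" if "1 \<le> m" for m j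
  proof -
    have "net_widths \<beta> m j \<le> (m + 1) * (spline_degree \<beta> + 2)" by (simp add: net_widths_def)
    also have "\<dots> \<le> 2 * m * (spline_degree \<beta> + 2)" using that by (intro mult_le_mono1) simp
    finally have "real (net_widths \<beta> m j) \<le> real (2 * m * (spline_degree \<beta> + 2))" by (rule of_nat_mono)
    then show ?thesis by (simp add: Cp_def algebra_simps)
  qed
  note ent = sieve_entropy[where L = Lnet and Cp = Cp and Cs = Cs and CB = CB and U = U and \<kappa> = \<kappa> and K = K
      and S = S and Lt = L\<^sub>\<tau>, OF _ widths order_refl U \<kappa>]
  show ?case
  proof (rule exI[of _ Lnet], rule exI[of _ Cp], rule exI[of _ Cs], rule exI[of _ CB], rule exI[of _ m0],
      rule exI[of _ H1], rule exI[of _ "net_widths \<beta>"], rule exI[of _ "\<lambda>m. real m powr CB"],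
      rule exI[of _ "\<lambda>m. sieve \<beta> U \<kappa> K S H1 Lnet (net_widths \<beta> m) (nat \<lceil>Cs * real m\<rceil>) (real m powr CB)"],
      intro conjI, goal_cases)
    case 1
    show ?case using widths by simp
  next
    case 2
    show ?case by simp
  next
    case 3
    show ?case using main unfolding sieve_target_def .
  next
    case 4
    \<comment> \<open>The entropy constant involves neither m nor \<epsilon>, so its positivity is
      read off at m = 1 and \<epsilon> = 1.\<close>
    show ?case using prems ent(1)[of 1 1] by auto
  next
    case 5
    show ?case using prems ent(2,3) by auto
  qed
qed

end
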